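(* The free globularly generated double category functor $Q:\mathbf{bCat}^*\to\mathbf{gCat}$ is left adjoint to the restriction $H^*\restriction_{\mathbf{gCat}}:\mathbf{gCat}\to\mathbf{bCat}^*$ of the decorated horizontalization functor, i.e. $Q\dashv H^*\restriction_{\mathbf{gCat}}$, with the pair $(\pi^\bullet,j)$ as counit-unit pair, where $\pi^\bullet$ is the collection of canonical double projections $\pi^C:Q_{H^*C}\to C$, $C$ in $\mathbf{gCat}$, and $j$ is the collection of inclusions $j^{\mathcal{B}}:\mathcal{B}\to H^*Q_{\mathcal{B}}$, $\mathcal{B}$ in $\mathbf{bCat}^*$.
   Context: Double categories. A double category $C$ (possibly weak in the horizontal direction) consists of a category $C_0$ (objects and vertical morphisms), a category $C_1$ (horizontal morphisms and squares; composition in $C_1$ is vertical composition, written $\bullet$), functors $s,t:C_1\to C_0$ (left and right edge), a horizontal identity functor $i:C_0\to C_1$ (its value on a vertical morphism $f$ is the square $i_f$), a horizontal composition functor $*:C_1\times_{C_0}C_1\to C_1$ (the composite of $\Phi$ followed on its right by $\Psi$ is written $\Psi*\Phi$), and invertible globular associator and left/right unitor natural transformations satisfying the usual coherence axioms. A square is globular if its left and right edges are identity vertical morphisms. $HC$ denotes the horizontal bicategory of $C$: 0-cells, 1-cells, 2-cells are the objects, horizontal morphisms, globular squares of $C$. A double functor $F:C\to C'$ is a pair of functors $F_0:C_0\to C_0'$, $F_1:C_1\to C_1'$ commuting with $s,t$ and compatible with $i$ and $*$ up to specified coherent invertible globular squares; it is strict if these are identities. Decorated bicategories. A decorated bicategory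 $\mathcal{B}$ is a bicategory (also written $\mathcal{B}$) together with a category $\mathcal{B}^*$ (the decoration) whose objects are the 0-cells of $\mathcal{B}$. A decorated pseudofunctor $G:\mathcal{B}\to\mathcal{B}'$ is a pseudofunctor together with a functor $G^*:\mathcal{B}^*\to\mathcal{B}'^*$ agreeing with it on 0-cells. For a double category $C$, $H^*C$ is $HC$ decorated by $C_0$; for a double functor $F$, $H^*F$ is the decorated pseudofunctor given by $F_0$ and the restriction of $F$ to horizontal morphisms and globular squares. $C$ is globularly generated if every square of $C$ can be obtained by vertical and horizontal compositions from globular squares and squares $i_f$. $\mathbf{bCat}^*$ is the category of decorated bicategories and decorated pseudofunctors, $\mathbf{dCat}$ the category of double categories and double functors, $\mathbf{gCat}$ its full subcategory of globularly generated double categories. The free globularly generated double category $Q_{\mathcal{B}}$. Let $\mathbb{G}$ be the collection of formal squares of two kinds: for every 2-cell $\varphi:\alpha\Rightarrow\beta$ of $\mathcal{B}$ with $\alpha,\beta:a\to b$, a square $\varphi$ with top $\alpha$, bottom $\beta$, left edge $id_a$, right edge $id_b$; and for every morphism $f:a\to b$ of $\mathcal{B}^*$, a square $i_f$ with top the identity 1-cell $i_a$, bottom $i_b$, left and right edges $f$. The squares $i_{id_a}$ and $id_{i_a}$ are regarded as equal. Form all formal expressions obtained from $\mathbb{G}$ by formal vertical composition $\Psi\bullet\Phi$ (when the bottom of $\Phi$ equals the top of $\Psi$; left and right edges compose in $\mathcal{B}^*$) and formal parenthesized horizontal composition $\Psi*\Phi$ (when the right edge of $\Phi$ equals the left edge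 of $\Psi$; tops and bottoms compose as 1-cells of $\mathcal{B}$). Then $Q_{\mathcal{B}}$ has $\mathcal{B}^*$ as category of objects, the 1-cells of $\mathcal{B}$ (with their composition and identities) as horizontal morphisms, and as squares the expressions modulo the smallest equivalence relation compatible with $\bullet$ and $*$ such that: $\bullet$ is associative and the identity 2-cell $id_\alpha$ is a vertical identity at $\alpha$; (1) $(\Psi_2\bullet\Psi_1)*(\Phi_2\bullet\Phi_1)\sim(\Psi_2*\Phi_2)\bullet(\Psi_1*\Phi_1)$ whenever both sides make sense; (2) for vertically composable 2-cells of $\mathcal{B}$ the formal composite $\psi\bullet\varphi$ is identified with their vertical composite in $\mathcal{B}$, and $i_g\bullet i_f\sim i_{gf}$ for composable $f,g$ in $\mathcal{B}^*$; (3) for horizontally composable 2-cells of $\mathcal{B}$ the formal composite $\psi*\varphi$ is identified with their horizontal composite in $\mathcal{B}$; (4) the left and right unitors of $\mathcal{B}$ are natural with respect to all squares; (5) the associators of $\mathcal{B}$ are natural with respect to all squares. Horizontal identities are the $i_f$; associators and unitors are those of $\mathcal{B}$. $Q_{\mathcal{B}}$ is globularly generated, and $\mathcal{B}$ is a sub-decorated bicategory of $H^*Q_{\mathcal{B}}$; the inclusion $j^{\mathcal{B}}:\mathcal{B}\to H^*Q_{\mathcal{B}}$ is the identity on $\mathcal{B}^*$ and on 1-cells and sends each 2-cell to its class. The functor $Q$. $Q$ sends $\mathcal{B}$ to $Q_{\mathcal{B}}$ and a decorated pseudofunctor $G:\mathcal{B}\to\mathcal{B}'$ to the free double functor $Q_G:Q_{\mathcal{B}}\to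 Q_{\mathcal{B}'}$, which is the unique double functor with $H^*Q_G\restriction_{\mathcal{B}}=G$ (i.e. $H^*Q_G\circ j^{\mathcal{B}}=j^{\mathcal{B}'}\circ G$). Canonical double projection. For $C$ in $\mathbf{gCat}$, $\pi^C:Q_{H^*C}\to C$ is the unique strict double functor acting as the identity on $H^*C$ (objects, vertical morphisms, horizontal morphisms and 2-cells of $HC$); it is surjective on squares. *)

theory Defs
  imports Main "HOL-Library.FuncSet"
begin

section \<open>Categories and functors\<close>

record ('o, 'm) cat =
  Ob  :: "'o set"
  Mor :: "'m set"
  Dom :: "'m \<Rightarrow> 'o"
  Cod :: "'m \<Rightarrow> 'o"
  Idn :: "'o \<Rightarrow> 'm"
  Cmp :: "'m \<Rightarrow> 'm \<Rightarrow> 'm"  (infixr "\<cdot>\<index>" 70)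

locale category =
  fixes C :: "('o, 'm) cat"
  assumes dom_ob: "f \<in> Mor C \<Longrightarrow> Dom C f \<in> Ob C"
    and cod_ob: "f \<in> Mor C \<Longrightarrow> Cod C f \<in> Ob C"
    and idn_mor: "a \<in> Ob C \<Longrightarrow> Idn C a \<in> Mor C"
    and dom_idn: "a \<in> Ob C \<Longrightarrow> Dom C (Idn C a) = a"
    and cod_idn: "a \<in> Ob C \<Longrightarrow> Cod C (Idn C a) = a"
    and cmp_mor: "\<lbrakk>f \<in> Mor C; g \<in> Mor C; Cod C f = Dom C g\<rbrakk> \<Longrightarrow> g \<cdot>\<^bsub>C\<^esub> f \<in> Mor C"
    and dom_cmp: "\<lbrakk>f \<in> Mor C; g \<in> Mor C; Cod C f = Dom C g\<rbrakk> \<Longrightarrow> Dom C (g \<cdot>\<^bsub>C\<^esub> f) = Dom C f"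
    and cod_cmp: "\<lbrakk>f \<in> Mor C; g \<in> Mor C; Cod C f = Dom C g\<rbrakk> \<Longrightarrow> Cod C (g \<cdot>\<^bsub>C\<^esub> f) = Cod C g"
    and cmp_idn_dom: "f \<in> Mor C \<Longrightarrow> f \<cdot>\<^bsub>C\<^esub> Idn C (Dom C f) = f"
    and cmp_idn_cod: "f \<in> Mor C \<Longrightarrow> Idn C (Cod C f) \<cdot>\<^bsub>C\<^esub> f = f"
    and cmp_assoc: "\<lbrakk>f \<in> Mor C; g \<in> Mor C; h \<in> Mor C; Cod C f = Dom C g; Cod C g = Dom C h\<rbrakk>
        \<Longrightarrow> (h \<cdot>\<^bsub>C\<^esub> g) \<cdot>\<^bsub>C\<^esub> f = h \<cdot>\<^bsub>C\<^esub> (g \<cdot>\<^bsub>C\<^esub> f)"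

definition is_iso :: "('o, 'm) cat \<Rightarrow> 'm \<Rightarrow> bool" where
  "is_iso C f \<longleftrightarrow> f \<in> Mor C \<and>
     (\<exists>g \<in> Mor C. Dom C g = Cod C f \<and> Cod C g = Dom C f \<and>
        g \<cdot>\<^bsub>C\<^esub> f = Idn C (Dom C f) \<and> f \<cdot>\<^bsub>C\<^esub> g = Idn C (Cod C f))"

record ('o, 'm, 'p, 'n) ftr =
  FO :: "'o \<Rightarrow> 'p"
  FM :: "'m \<Rightarrow> 'n"

locale cat_functor =
  fixes C :: "('o, 'm) cat" and D :: "('p, 'n) cat" and F :: "('o, 'm, 'p, 'n) ftr"
  assumes source_category: "category C"
    and target_category: "category D"
    and fun_ob: "a \<in> Ob C \<Longrightarrow> FO F a \<in> Ob D"
    and fun_mor: "f \<in> Mor C \<Longrightarrow> FM F f \<in> Mor D"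
    and fun_dom: "f \<in> Mor C \<Longrightarrow> Dom D (FM F f) = FO F (Dom C f)"
    and fun_cod: "f \<in> Mor C \<Longrightarrow> Cod D (FM F f) = FO F (Cod C f)"
    and fun_idn: "a \<in> Ob C \<Longrightarrow> FM F (Idn C a) = Idn D (FO F a)"
    and fun_cmp: "\<lbrakk>f \<in> Mor C; g \<in> Mor C; Cod C f = Dom C g\<rbrakk>
        \<Longrightarrow> FM F (g \<cdot>\<^bsub>C\<^esub> f) = FM F g \<cdot>\<^bsub>D\<^esub> FM F f"

text \<open>Functors take the junk value \<^const>\<open>undefined\<close> outside their source category whenever we
  want equality of HOL records to be equality of functors; this is what \<open>ext_functor\<close> adds.\<close>

definition ext_functor :: "('o, 'm) cat \<Rightarrow> ('p, 'n) cat \<Rightarrow> ('o, 'm, 'p, 'n) ftr \<Rightarrow> bool" where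
  "ext_functor C D F \<longleftrightarrow>
     cat_functor C D F \<and> FO F \<in> extensional (Ob C) \<and> FM F \<in> extensional (Mor C)"

definition id_ftr :: "('o, 'm) cat \<Rightarrow> ('o, 'm, 'o, 'm) ftr" where
  "id_ftr C = \<lparr> FO = (\<lambda>a\<in>Ob C. a), FM = (\<lambda>f\<in>Mor C. f) \<rparr>"

definition comp_ftr ::
  "('o, 'm) cat \<Rightarrow> ('p, 'n, 'q, 'k) ftr \<Rightarrow> ('o, 'm, 'p, 'n) ftr \<Rightarrow> ('o, 'm, 'q, 'k) ftr" where
  "comp_ftr C G F = \<lparr> FO = compose (Ob C) (FO G) (FO F), FM = compose (Mor C) (FM G) (FM F) \<rparr>"

definition discrete_cat :: "'o set \<Rightarrow> ('o, 'o) cat" where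
  "discrete_cat X = \<lparr> Ob = X, Mor = X, Dom = (\<lambda>a. a), Cod = (\<lambda>a. a), Idn = (\<lambda>a. a),
     Cmp = (\<lambda>b a. a) \<rparr>"

text \<open>The strict pullback of functors \<open>S\<close> (on the category \<open>C\<close>) and \<open>T\<close> (on \<open>D\<close>) with a common
  target.\<close>

definition fibre_product ::
  "('h, 'c) cat \<Rightarrow> ('h', 'c') cat \<Rightarrow> ('h, 'c, 'o, 'v) ftr \<Rightarrow> ('h', 'c', 'o, 'v) ftr
     \<Rightarrow> ('h \<times> 'h', 'c \<times> 'c') cat" where
  "fibre_product C D S T =
     \<lparr> Ob = {(b, a). b \<in> Ob C \<and> a \<in> Ob D \<and> FO S b = FO T a},
       Mor = {(g, f). g \<in> Mor C \<and> f \<in> Mor D \<and> FM S g = FM T f},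
       Dom = map_prod (Dom C) (Dom D),
       Cod = map_prod (Cod C) (Cod D),
       Idn = map_prod (Idn C) (Idn D),
       Cmp = (\<lambda>(g', f') (g, f). (g' \<cdot>\<^bsub>C\<^esub> g, f' \<cdot>\<^bsub>D\<^esub> f)) \<rparr>"

text \<open>Binary notation for a functor \<open>H\<close> defined on pairs, used for horizontal composition:
  \<open>\<star>\<close> on objects (1-cells), \<open>\<ast>\<close> on morphisms (2-cells, squares).  As for \<open>\<cdot>\<close>, the right-hand
  argument comes first.\<close>

abbreviation hcomp1 :: "('h \<times> 'h, 'c \<times> 'c, 'h, 'c) ftr \<Rightarrow> 'h \<Rightarrow> 'h \<Rightarrow> 'h" (infixr "\<star>\<index>" 75)
  where "b \<star>\<^bsub>H\<^esub> a \<equiv> FO H (b, a)"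

abbreviation hcomp2 :: "('h \<times> 'h, 'c \<times> 'c, 'h, 'c) ftr \<Rightarrow> 'c \<Rightarrow> 'c \<Rightarrow> 'c" (infixr "\<ast>\<index>" 75)
  where "g \<ast>\<^bsub>H\<^esub> f \<equiv> FM H (g, f)"


section \<open>Decorated bicategories\<close>

text \<open>\<open>cells\<close> is the disjoint union of the hom-categories: its objects are the 1-cells, its
  morphisms the 2-cells, its composition the vertical composition of 2-cells.  The component
  \<open>bassoc c b a\<close> of the associator goes from \<open>(c \<star> b) \<star> a\<close> to \<open>c \<star> (b \<star> a)\<close>; the unitors \<open>blunit a\<close>
  and \<open>brunit a\<close> go from \<open>i \<star> a\<close> and \<open>a \<star> i\<close> to \<open>a\<close>.\<close>

record ('o, 'h, 'c) bicat =
  cells0 :: "'o set"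
  cells :: "('h, 'c) cat"
  bsrc :: "'h \<Rightarrow> 'o"
  btgt :: "'h \<Rightarrow> 'o"
  bunit :: "'o \<Rightarrow> 'h"
  bhcomp :: "('h \<times> 'h, 'c \<times> 'c, 'h, 'c) ftr"
  bassoc :: "'h \<Rightarrow> 'h \<Rightarrow> 'h \<Rightarrow> 'c"
  blunit :: "'h \<Rightarrow> 'c"
  brunit :: "'h \<Rightarrow> 'c"

definition bsrc_ftr :: "('o, 'h, 'c) bicat \<Rightarrow> ('h, 'c, 'o, 'o) ftr" where
  "bsrc_ftr B = \<lparr> FO = bsrc B, FM = (\<lambda>x. bsrc B (Dom (cells B) x)) \<rparr>"

definition btgt_ftr :: "('o, 'h, 'c) bicat \<Rightarrow> ('h, 'c, 'o, 'o) ftr" where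
  "btgt_ftr B = \<lparr> FO = btgt B, FM = (\<lambda>x. btgt B (Dom (cells B) x)) \<rparr>"

text \<open>Pairs \<open>(\<psi>, \<phi>)\<close> of cells with \<open>\<phi>\<close> followed by \<open>\<psi>\<close>.  That \<open>bsrc_ftr\<close> and \<open>btgt_ftr\<close> are functors
  to a discrete category says that 2-cells live between parallel 1-cells.\<close>

definition bpairs :: "('o, 'h, 'c) bicat \<Rightarrow> ('h \<times> 'h, 'c \<times> 'c) cat" where
  "bpairs B = fibre_product (cells B) (cells B) (bsrc_ftr B) (btgt_ftr B)"

locale bicategory =
  fixes B :: "('o, 'h, 'c) bicat"
  assumes src_functor: "cat_functor (cells B) (discrete_cat (cells0 B)) (bsrc_ftr B)"
    and tgt_functor: "cat_functor (cells B) (discrete_cat (cells0 B)) (btgt_ftr B)"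
    and unit_ob: "a \<in> cells0 B \<Longrightarrow> bunit B a \<in> Ob (cells B)"
    and src_unit: "a \<in> cells0 B \<Longrightarrow> bsrc B (bunit B a) = a"
    and tgt_unit: "a \<in> cells0 B \<Longrightarrow> btgt B (bunit B a) = a"
    and hcomp_functor: "cat_functor (bpairs B) (cells B) (bhcomp B)"
    and src_hcomp: "(\<beta>, \<alpha>) \<in> Ob (bpairs B) \<Longrightarrow> bsrc B (\<beta> \<star>\<^bsub>bhcomp B\<^esub> \<alpha>) = bsrc B \<alpha>"
    and tgt_hcomp: "(\<beta>, \<alpha>) \<in> Ob (bpairs B) \<Longrightarrow> btgt B (\<beta> \<star>\<^bsub>bhcomp B\<^esub> \<alpha>) = btgt B \<beta>"
    and assoc_iso: "\<lbrakk>(\<gamma>, \<beta>) \<in> Ob (bpairs B); (\<beta>, \<alpha>) \<in> Ob (bpairs B)\<rbrakk>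
        \<Longrightarrow> is_iso (cells B) (bassoc B \<gamma> \<beta> \<alpha>)"
    and assoc_dom: "\<lbrakk>(\<gamma>, \<beta>) \<in> Ob (bpairs B); (\<beta>, \<alpha>) \<in> Ob (bpairs B)\<rbrakk>
        \<Longrightarrow> Dom (cells B) (bassoc B \<gamma> \<beta> \<alpha>) = (\<gamma> \<star>\<^bsub>bhcomp B\<^esub> \<beta>) \<star>\<^bsub>bhcomp B\<^esub> \<alpha>"
    and assoc_cod: "\<lbrakk>(\<gamma>, \<beta>) \<in> Ob (bpairs B); (\<beta>, \<alpha>) \<in> Ob (bpairs B)\<rbrakk>
        \<Longrightarrow> Cod (cells B) (bassoc B \<gamma> \<beta> \<alpha>) = \<gamma> \<star>\<^bsub>bhcomp B\<^esub> (\<beta> \<star>\<^bsub>bhcomp B\<^esub> \<alpha>)"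
    and assoc_natural: "\<lbrakk>(\<theta>, \<psi>) \<in> Mor (bpairs B); (\<psi>, \<phi>) \<in> Mor (bpairs B)\<rbrakk>
        \<Longrightarrow> bassoc B (Cod (cells B) \<theta>) (Cod (cells B) \<psi>) (Cod (cells B) \<phi>)
              \<cdot>\<^bsub>cells B\<^esub> ((\<theta> \<ast>\<^bsub>bhcomp B\<^esub> \<psi>) \<ast>\<^bsub>bhcomp B\<^esub> \<phi>)
          = (\<theta> \<ast>\<^bsub>bhcomp B\<^esub> (\<psi> \<ast>\<^bsub>bhcomp B\<^esub> \<phi>))
              \<cdot>\<^bsub>cells B\<^esub> bassoc B (Dom (cells B) \<theta>) (Dom (cells B) \<psi>) (Dom (cells B) \<phi>)"
    and lunit_iso: "\<alpha> \<in> Ob (cells B) \<Longrightarrow> is_iso (cells B) (blunit B \<alpha>)"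
    and lunit_dom: "\<alpha> \<in> Ob (cells B) \<Longrightarrow>
        Dom (cells B) (blunit B \<alpha>) = bunit B (btgt B \<alpha>) \<star>\<^bsub>bhcomp B\<^esub> \<alpha>"
    and lunit_cod: "\<alpha> \<in> Ob (cells B) \<Longrightarrow> Cod (cells B) (blunit B \<alpha>) = \<alpha>"
    and lunit_natural: "\<phi> \<in> Mor (cells B) \<Longrightarrow>
        blunit B (Cod (cells B) \<phi>) \<cdot>\<^bsub>cells B\<^esub>
          (Idn (cells B) (bunit B (btgt B (Dom (cells B) \<phi>))) \<ast>\<^bsub>bhcomp B\<^esub> \<phi>)
        = \<phi> \<cdot>\<^bsub>cells B\<^esub> blunit B (Dom (cells B) \<phi>)"
    and runit_iso: "\<alpha> \<in> Ob (cells B) \<Longrightarrow> is_iso (cells B) (brunit B \<alpha>)"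
    and runit_dom: "\<alpha> \<in> Ob (cells B) \<Longrightarrow>
        Dom (cells B) (brunit B \<alpha>) = \<alpha> \<star>\<^bsub>bhcomp B\<^esub> bunit B (bsrc B \<alpha>)"
    and runit_cod: "\<alpha> \<in> Ob (cells B) \<Longrightarrow> Cod (cells B) (brunit B \<alpha>) = \<alpha>"
    and runit_natural: "\<phi> \<in> Mor (cells B) \<Longrightarrow>
        brunit B (Cod (cells B) \<phi>) \<cdot>\<^bsub>cells B\<^esub>
          (\<phi> \<ast>\<^bsub>bhcomp B\<^esub> Idn (cells B) (bunit B (bsrc B (Dom (cells B) \<phi>))))
        = \<phi> \<cdot>\<^bsub>cells B\<^esub> brunit B (Dom (cells B) \<phi>)"
    and pentagon: "\<lbrakk>(\<delta>, \<gamma>) \<in> Ob (bpairs B); (\<gamma>, \<beta>) \<in> Ob (bpairs B); (\<beta>, \<alpha>) \<in> Ob (bpairs B)\<rbrakk>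
        \<Longrightarrow> bassoc B \<delta> \<gamma> (\<beta> \<star>\<^bsub>bhcomp B\<^esub> \<alpha>) \<cdot>\<^bsub>cells B\<^esub> bassoc B (\<delta> \<star>\<^bsub>bhcomp B\<^esub> \<gamma>) \<beta> \<alpha>
          = (Idn (cells B) \<delta> \<ast>\<^bsub>bhcomp B\<^esub> bassoc B \<gamma> \<beta> \<alpha>)
            \<cdot>\<^bsub>cells B\<^esub> bassoc B \<delta> (\<gamma> \<star>\<^bsub>bhcomp B\<^esub> \<beta>) \<alpha>
            \<cdot>\<^bsub>cells B\<^esub> (bassoc B \<delta> \<gamma> \<beta> \<ast>\<^bsub>bhcomp B\<^esub> Idn (cells B) \<alpha>)"
    and triangle: "(\<beta>, \<alpha>) \<in> Ob (bpairs B)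
        \<Longrightarrow> (Idn (cells B) \<beta> \<ast>\<^bsub>bhcomp B\<^esub> blunit B \<alpha>) \<cdot>\<^bsub>cells B\<^esub> bassoc B \<beta> (bunit B (btgt B \<alpha>)) \<alpha>
          = brunit B \<beta> \<ast>\<^bsub>bhcomp B\<^esub> Idn (cells B) \<alpha>"

text \<open>A pseudofunctor \<open>P\<close> carries comparison 2-cells \<open>Pcmp (\<beta>, \<alpha>) : P \<beta> \<star> P \<alpha> \<Rightarrow> P (\<beta> \<star> \<alpha>)\<close> and
  \<open>Punit a : i (P a) \<Rightarrow> P (i a)\<close>.\<close>

record ('o, 'h, 'c, 'p, 'k, 'd) psf =
  P_ob :: "'o \<Rightarrow> 'p"
  P_cells :: "('h, 'c, 'k, 'd) ftr"
  Pcmp :: "'h \<times> 'h \<Rightarrow> 'd"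
  Punit :: "'o \<Rightarrow> 'd"

locale pseudofunctor =
  fixes B :: "('o, 'h, 'c) bicat" and B' :: "('p, 'k, 'd) bicat"
    and P :: "('o, 'h, 'c, 'p, 'k, 'd) psf"
  assumes source_bicategory: "bicategory B"
    and target_bicategory: "bicategory B'"
    and P_ob_cell: "a \<in> cells0 B \<Longrightarrow> P_ob P a \<in> cells0 B'"
    and P_cells_functor: "ext_functor (cells B) (cells B') (P_cells P)"
    and P_src: "\<alpha> \<in> Ob (cells B) \<Longrightarrow> bsrc B' (FO (P_cells P) \<alpha>) = P_ob P (bsrc B \<alpha>)"
    and P_tgt: "\<alpha> \<in> Ob (cells B) \<Longrightarrow> btgt B' (FO (P_cells P) \<alpha>) = P_ob P (btgt B \<alpha>)"
    and Pcmp_iso: "(\<beta>, \<alpha>) \<in> Ob (bpairs B) \<Longrightarrow> is_iso (cells B') (Pcmp P (\<beta>, \<alpha>))"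
    and Pcmp_dom: "(\<beta>, \<alpha>) \<in> Ob (bpairs B) \<Longrightarrow>
        Dom (cells B') (Pcmp P (\<beta>, \<alpha>)) = FO (P_cells P) \<beta> \<star>\<^bsub>bhcomp B'\<^esub> FO (P_cells P) \<alpha>"
    and Pcmp_cod: "(\<beta>, \<alpha>) \<in> Ob (bpairs B) \<Longrightarrow>
        Cod (cells B') (Pcmp P (\<beta>, \<alpha>)) = FO (P_cells P) (\<beta> \<star>\<^bsub>bhcomp B\<^esub> \<alpha>)"
    and Pcmp_natural: "(\<psi>, \<phi>) \<in> Mor (bpairs B) \<Longrightarrow>
        FM (P_cells P) (\<psi> \<ast>\<^bsub>bhcomp B\<^esub> \<phi>) \<cdot>\<^bsub>cells B'\<^esub> Pcmp P (Dom (cells B) \<psi>, Dom (cells B) \<phi>)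
        = Pcmp P (Cod (cells B) \<psi>, Cod (cells B) \<phi>)
            \<cdot>\<^bsub>cells B'\<^esub> (FM (P_cells P) \<psi> \<ast>\<^bsub>bhcomp B'\<^esub> FM (P_cells P) \<phi>)"
    and Punit_iso: "a \<in> cells0 B \<Longrightarrow> is_iso (cells B') (Punit P a)"
    and Punit_dom: "a \<in> cells0 B \<Longrightarrow> Dom (cells B') (Punit P a) = bunit B' (P_ob P a)"
    and Punit_cod: "a \<in> cells0 B \<Longrightarrow> Cod (cells B') (Punit P a) = FO (P_cells P) (bunit B a)"
    and P_assoc: "\<lbrakk>(\<gamma>, \<beta>) \<in> Ob (bpairs B); (\<beta>, \<alpha>) \<in> Ob (bpairs B)\<rbrakk> \<Longrightarrow>
        FM (P_cells P) (bassoc B \<gamma> \<beta> \<alpha>) \<cdot>\<^bsub>cells B'\<^esub> Pcmp P (\<gamma> \<star>\<^bsub>bhcomp B\<^esub> \<beta>, \<alpha>)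
          \<cdot>\<^bsub>cells B'\<^esub> (Pcmp P (\<gamma>, \<beta>) \<ast>\<^bsub>bhcomp B'\<^esub> Idn (cells B') (FO (P_cells P) \<alpha>))
        = Pcmp P (\<gamma>, \<beta> \<star>\<^bsub>bhcomp B\<^esub> \<alpha>)
          \<cdot>\<^bsub>cells B'\<^esub> (Idn (cells B') (FO (P_cells P) \<gamma>) \<ast>\<^bsub>bhcomp B'\<^esub> Pcmp P (\<beta>, \<alpha>))
          \<cdot>\<^bsub>cells B'\<^esub> bassoc B' (FO (P_cells P) \<gamma>) (FO (P_cells P) \<beta>) (FO (P_cells P) \<alpha>)"
    and P_lunit: "\<alpha> \<in> Ob (cells B) \<Longrightarrow>
        FM (P_cells P) (blunit B \<alpha>) \<cdot>\<^bsub>cells B'\<^esub> Pcmp P (bunit B (btgt B \<alpha>), \<alpha>)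
          \<cdot>\<^bsub>cells B'\<^esub> (Punit P (btgt B \<alpha>) \<ast>\<^bsub>bhcomp B'\<^esub> Idn (cells B') (FO (P_cells P) \<alpha>))
        = blunit B' (FO (P_cells P) \<alpha>)"
    and P_runit: "\<alpha> \<in> Ob (cells B) \<Longrightarrow>
        FM (P_cells P) (brunit B \<alpha>) \<cdot>\<^bsub>cells B'\<^esub> Pcmp P (\<alpha>, bunit B (bsrc B \<alpha>))
          \<cdot>\<^bsub>cells B'\<^esub> (Idn (cells B') (FO (P_cells P) \<alpha>) \<ast>\<^bsub>bhcomp B'\<^esub> Punit P (bsrc B \<alpha>))
        = brunit B' (FO (P_cells P) \<alpha>)"
    and P_extensional: "P_ob P \<in> extensional (cells0 B)"
        "Pcmp P \<in> extensional (Ob (bpairs B))" "Punit P \<in> extensional (cells0 B)"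

definition id_psf :: "('o, 'h, 'c) bicat \<Rightarrow> ('o, 'h, 'c, 'o, 'h, 'c) psf" where
  "id_psf B = \<lparr> P_ob = (\<lambda>a\<in>cells0 B. a), P_cells = id_ftr (cells B),
     Pcmp = (\<lambda>(\<beta>, \<alpha>) \<in> Ob (bpairs B). Idn (cells B) (\<beta> \<star>\<^bsub>bhcomp B\<^esub> \<alpha>)),
     Punit = (\<lambda>a \<in> cells0 B. Idn (cells B) (bunit B a)) \<rparr>"

text \<open>The composite of \<open>P\<close> on \<open>B\<close> with \<open>R\<close>, where \<open>B''\<close> is the target of \<open>R\<close>.\<close>

definition comp_psf ::
  "('o, 'h, 'c) bicat \<Rightarrow> ('q, 'l, 'e) bicat \<Rightarrow> ('p, 'k, 'd, 'q, 'l, 'e) psf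
    \<Rightarrow> ('o, 'h, 'c, 'p, 'k, 'd) psf \<Rightarrow> ('o, 'h, 'c, 'q, 'l, 'e) psf" where
  "comp_psf B B'' R P = \<lparr> P_ob = compose (cells0 B) (P_ob R) (P_ob P),
     P_cells = comp_ftr (cells B) (P_cells R) (P_cells P),
     Pcmp = (\<lambda>(\<beta>, \<alpha>) \<in> Ob (bpairs B).
        FM (P_cells R) (Pcmp P (\<beta>, \<alpha>)) \<cdot>\<^bsub>cells B''\<^esub> Pcmp R (FO (P_cells P) \<beta>, FO (P_cells P) \<alpha>)),
     Punit = (\<lambda>a \<in> cells0 B. FM (P_cells R) (Punit P a) \<cdot>\<^bsub>cells B''\<^esub> Punit R (P_ob P a)) \<rparr>"

record ('o, 'v, 'h, 'c) dbicat =
  und :: "('o, 'h, 'c) bicat"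
  deco :: "('o, 'v) cat"

definition decorated_bicategory :: "('o, 'v, 'h, 'c) dbicat \<Rightarrow> bool" where
  "decorated_bicategory B \<longleftrightarrow>
     bicategory (und B) \<and> category (deco B) \<and> Ob (deco B) = cells0 (und B)"

record ('o, 'v, 'h, 'c, 'p, 'w, 'k, 'd) dpsf =
  psf_part :: "('o, 'h, 'c, 'p, 'k, 'd) psf"
  deco_part :: "('o, 'v, 'p, 'w) ftr"

definition decorated_pseudofunctor ::
  "('o, 'v, 'h, 'c) dbicat \<Rightarrow> ('p, 'w, 'k, 'd) dbicat
    \<Rightarrow> ('o, 'v, 'h, 'c, 'p, 'w, 'k, 'd) dpsf \<Rightarrow> bool" where
  "decorated_pseudofunctor B B' G \<longleftrightarrow>
     decorated_bicategory B \<and> decorated_bicategory B' \<and>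
     pseudofunctor (und B) (und B') (psf_part G) \<and>
     ext_functor (deco B) (deco B') (deco_part G) \<and>
     (\<forall>a \<in> cells0 (und B). FO (deco_part G) a = P_ob (psf_part G) a)"

definition id_dpsf :: "('o, 'v, 'h, 'c) dbicat \<Rightarrow> ('o, 'v, 'h, 'c, 'o, 'v, 'h, 'c) dpsf" where
  "id_dpsf B = \<lparr> psf_part = id_psf (und B), deco_part = id_ftr (deco B) \<rparr>"

definition comp_dpsf ::
  "('o, 'v, 'h, 'c) dbicat \<Rightarrow> ('q, 'x, 'l, 'e) dbicat \<Rightarrow> ('p, 'w, 'k, 'd, 'q, 'x, 'l, 'e) dpsf
    \<Rightarrow> ('o, 'v, 'h, 'c, 'p, 'w, 'k, 'd) dpsf \<Rightarrow> ('o, 'v, 'h, 'c, 'q, 'x, 'l, 'e) dpsf" where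
  "comp_dpsf B B'' G' G =
     \<lparr> psf_part = comp_psf (und B) (und B'') (psf_part G') (psf_part G),
       deco_part = comp_ftr (deco B) (deco_part G') (deco_part G) \<rparr>"


section \<open>Double categories\<close>

text \<open>Conventions for the associator and the unitors are those of \<^typ>\<open>('o, 'h, 'c) bicat\<close>.  In
  \<open>hsq D\<close> the domain of a square is its top, the codomain its bottom.\<close>

record ('o, 'v, 'h, 's) dbl =
  vert :: "('o, 'v) cat"
  hsq :: "('h, 's) cat"
  lft :: "('h, 's, 'o, 'v) ftr"
  rgt :: "('h, 's, 'o, 'v) ftr"
  hid :: "('o, 'v, 'h, 's) ftr"
  dhcomp :: "('h \<times> 'h, 's \<times> 's, 'h, 's) ftr"
  dassoc :: "'h \<Rightarrow> 'h \<Rightarrow> 'h \<Rightarrow> 's"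
  dlunit :: "'h \<Rightarrow> 's"
  drunit :: "'h \<Rightarrow> 's"

definition dpairs :: "('o, 'v, 'h, 's) dbl \<Rightarrow> ('h \<times> 'h, 's \<times> 's) cat" where
  "dpairs D = fibre_product (hsq D) (hsq D) (lft D) (rgt D)"

definition globular :: "('o, 'v, 'h, 's) dbl \<Rightarrow> 's set" where
  "globular D = {\<Phi> \<in> Mor (hsq D). (\<exists>a \<in> Ob (vert D). FM (lft D) \<Phi> = Idn (vert D) a) \<and>
                                  (\<exists>b \<in> Ob (vert D). FM (rgt D) \<Phi> = Idn (vert D) b)}"

locale double_category =
  fixes D :: "('o, 'v, 'h, 's) dbl"
  assumes lft_functor: "cat_functor (hsq D) (vert D) (lft D)"
    and rgt_functor: "cat_functor (hsq D) (vert D) (rgt D)"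
    and hid_functor: "cat_functor (vert D) (hsq D) (hid D)"
    and lft_hid_ob: "a \<in> Ob (vert D) \<Longrightarrow> FO (lft D) (FO (hid D) a) = a"
    and lft_hid_mor: "f \<in> Mor (vert D) \<Longrightarrow> FM (lft D) (FM (hid D) f) = f"
    and rgt_hid_ob: "a \<in> Ob (vert D) \<Longrightarrow> FO (rgt D) (FO (hid D) a) = a"
    and rgt_hid_mor: "f \<in> Mor (vert D) \<Longrightarrow> FM (rgt D) (FM (hid D) f) = f"
    and hcomp_functor: "cat_functor (dpairs D) (hsq D) (dhcomp D)"
    and lft_hcomp_ob: "(\<beta>, \<alpha>) \<in> Ob (dpairs D) \<Longrightarrow> FO (lft D) (\<beta> \<star>\<^bsub>dhcomp D\<^esub> \<alpha>) = FO (lft D) \<alpha>"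
    and lft_hcomp_mor: "(\<Psi>, \<Phi>) \<in> Mor (dpairs D) \<Longrightarrow> FM (lft D) (\<Psi> \<ast>\<^bsub>dhcomp D\<^esub> \<Phi>) = FM (lft D) \<Phi>"
    and rgt_hcomp_ob: "(\<beta>, \<alpha>) \<in> Ob (dpairs D) \<Longrightarrow> FO (rgt D) (\<beta> \<star>\<^bsub>dhcomp D\<^esub> \<alpha>) = FO (rgt D) \<beta>"
    and rgt_hcomp_mor: "(\<Psi>, \<Phi>) \<in> Mor (dpairs D) \<Longrightarrow> FM (rgt D) (\<Psi> \<ast>\<^bsub>dhcomp D\<^esub> \<Phi>) = FM (rgt D) \<Psi>"
    and assoc_globular: "\<lbrakk>(\<gamma>, \<beta>) \<in> Ob (dpairs D); (\<beta>, \<alpha>) \<in> Ob (dpairs D)\<rbrakk>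
        \<Longrightarrow> dassoc D \<gamma> \<beta> \<alpha> \<in> globular D"
    and assoc_iso: "\<lbrakk>(\<gamma>, \<beta>) \<in> Ob (dpairs D); (\<beta>, \<alpha>) \<in> Ob (dpairs D)\<rbrakk>
        \<Longrightarrow> is_iso (hsq D) (dassoc D \<gamma> \<beta> \<alpha>)"
    and assoc_dom: "\<lbrakk>(\<gamma>, \<beta>) \<in> Ob (dpairs D); (\<beta>, \<alpha>) \<in> Ob (dpairs D)\<rbrakk>
        \<Longrightarrow> Dom (hsq D) (dassoc D \<gamma> \<beta> \<alpha>) = (\<gamma> \<star>\<^bsub>dhcomp D\<^esub> \<beta>) \<star>\<^bsub>dhcomp D\<^esub> \<alpha>"
    and assoc_cod: "\<lbrakk>(\<gamma>, \<beta>) \<in> Ob (dpairs D); (\<beta>, \<alpha>) \<in> Ob (dpairs D)\<rbrakk>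
        \<Longrightarrow> Cod (hsq D) (dassoc D \<gamma> \<beta> \<alpha>) = \<gamma> \<star>\<^bsub>dhcomp D\<^esub> (\<beta> \<star>\<^bsub>dhcomp D\<^esub> \<alpha>)"
    and assoc_natural: "\<lbrakk>(\<Theta>, \<Psi>) \<in> Mor (dpairs D); (\<Psi>, \<Phi>) \<in> Mor (dpairs D)\<rbrakk>
        \<Longrightarrow> dassoc D (Cod (hsq D) \<Theta>) (Cod (hsq D) \<Psi>) (Cod (hsq D) \<Phi>)
              \<cdot>\<^bsub>hsq D\<^esub> ((\<Theta> \<ast>\<^bsub>dhcomp D\<^esub> \<Psi>) \<ast>\<^bsub>dhcomp D\<^esub> \<Phi>)
          = (\<Theta> \<ast>\<^bsub>dhcomp D\<^esub> (\<Psi> \<ast>\<^bsub>dhcomp D\<^esub> \<Phi>))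
              \<cdot>\<^bsub>hsq D\<^esub> dassoc D (Dom (hsq D) \<Theta>) (Dom (hsq D) \<Psi>) (Dom (hsq D) \<Phi>)"
    and lunit_globular: "\<alpha> \<in> Ob (hsq D) \<Longrightarrow> dlunit D \<alpha> \<in> globular D"
    and lunit_iso: "\<alpha> \<in> Ob (hsq D) \<Longrightarrow> is_iso (hsq D) (dlunit D \<alpha>)"
    and lunit_dom: "\<alpha> \<in> Ob (hsq D) \<Longrightarrow>
        Dom (hsq D) (dlunit D \<alpha>) = FO (hid D) (FO (rgt D) \<alpha>) \<star>\<^bsub>dhcomp D\<^esub> \<alpha>"
    and lunit_cod: "\<alpha> \<in> Ob (hsq D) \<Longrightarrow> Cod (hsq D) (dlunit D \<alpha>) = \<alpha>"
    and lunit_natural: "\<Phi> \<in> Mor (hsq D) \<Longrightarrow>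
        dlunit D (Cod (hsq D) \<Phi>) \<cdot>\<^bsub>hsq D\<^esub> (FM (hid D) (FM (rgt D) \<Phi>) \<ast>\<^bsub>dhcomp D\<^esub> \<Phi>)
        = \<Phi> \<cdot>\<^bsub>hsq D\<^esub> dlunit D (Dom (hsq D) \<Phi>)"
    and runit_globular: "\<alpha> \<in> Ob (hsq D) \<Longrightarrow> drunit D \<alpha> \<in> globular D"
    and runit_iso: "\<alpha> \<in> Ob (hsq D) \<Longrightarrow> is_iso (hsq D) (drunit D \<alpha>)"
    and runit_dom: "\<alpha> \<in> Ob (hsq D) \<Longrightarrow>
        Dom (hsq D) (drunit D \<alpha>) = \<alpha> \<star>\<^bsub>dhcomp D\<^esub> FO (hid D) (FO (lft D) \<alpha>)"
    and runit_cod: "\<alpha> \<in> Ob (hsq D) \<Longrightarrow> Cod (hsq D) (drunit D \<alpha>) = \<alpha>"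
    and runit_natural: "\<Phi> \<in> Mor (hsq D) \<Longrightarrow>
        drunit D (Cod (hsq D) \<Phi>) \<cdot>\<^bsub>hsq D\<^esub> (\<Phi> \<ast>\<^bsub>dhcomp D\<^esub> FM (hid D) (FM (lft D) \<Phi>))
        = \<Phi> \<cdot>\<^bsub>hsq D\<^esub> drunit D (Dom (hsq D) \<Phi>)"
    and pentagon: "\<lbrakk>(\<delta>, \<gamma>) \<in> Ob (dpairs D); (\<gamma>, \<beta>) \<in> Ob (dpairs D); (\<beta>, \<alpha>) \<in> Ob (dpairs D)\<rbrakk>
        \<Longrightarrow> dassoc D \<delta> \<gamma> (\<beta> \<star>\<^bsub>dhcomp D\<^esub> \<alpha>) \<cdot>\<^bsub>hsq D\<^esub> dassoc D (\<delta> \<star>\<^bsub>dhcomp D\<^esub> \<gamma>) \<beta> \<alpha>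
          = (Idn (hsq D) \<delta> \<ast>\<^bsub>dhcomp D\<^esub> dassoc D \<gamma> \<beta> \<alpha>)
            \<cdot>\<^bsub>hsq D\<^esub> dassoc D \<delta> (\<gamma> \<star>\<^bsub>dhcomp D\<^esub> \<beta>) \<alpha>
            \<cdot>\<^bsub>hsq D\<^esub> (dassoc D \<delta> \<gamma> \<beta> \<ast>\<^bsub>dhcomp D\<^esub> Idn (hsq D) \<alpha>)"
    and triangle: "(\<beta>, \<alpha>) \<in> Ob (dpairs D)
        \<Longrightarrow> (Idn (hsq D) \<beta> \<ast>\<^bsub>dhcomp D\<^esub> dlunit D \<alpha>)
              \<cdot>\<^bsub>hsq D\<^esub> dassoc D \<beta> (FO (hid D) (FO (rgt D) \<alpha>)) \<alpha>
          = drunit D \<beta> \<ast>\<^bsub>dhcomp D\<^esub> Idn (hsq D) \<alpha>"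

inductive_set generated_squares :: "('o, 'v, 'h, 's) dbl \<Rightarrow> 's set" for D where
  gen_globular: "\<Phi> \<in> globular D \<Longrightarrow> \<Phi> \<in> generated_squares D"
| gen_hid: "f \<in> Mor (vert D) \<Longrightarrow> FM (hid D) f \<in> generated_squares D"
| gen_vcomp: "\<lbrakk>\<Phi> \<in> generated_squares D; \<Psi> \<in> generated_squares D; Cod (hsq D) \<Phi> = Dom (hsq D) \<Psi>\<rbrakk>
    \<Longrightarrow> \<Psi> \<cdot>\<^bsub>hsq D\<^esub> \<Phi> \<in> generated_squares D"
| gen_hcomp: "\<lbrakk>\<Phi> \<in> generated_squares D; \<Psi> \<in> generated_squares D; FM (rgt D) \<Phi> = FM (lft D) \<Psi>\<rbrakk>
    \<Longrightarrow> \<Psi> \<ast>\<^bsub>dhcomp D\<^esub> \<Phi> \<in> generated_squares D"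

definition globularly_generated_double_category :: "('o, 'v, 'h, 's) dbl \<Rightarrow> bool" where
  "globularly_generated_double_category D \<longleftrightarrow>
     double_category D \<and> Mor (hsq D) \<subseteq> generated_squares D"

text \<open>Comparison squares of a double functor are oriented as for pseudofunctors:
  \<open>Dcmp (\<beta>, \<alpha>) : F \<beta> \<star> F \<alpha> \<rightarrow> F (\<beta> \<star> \<alpha>)\<close> and \<open>Dunit a : i (F a) \<rightarrow> F (i a)\<close>.\<close>

record ('o, 'v, 'h, 's, 'p, 'w, 'k, 't) dftr =
  D_vert :: "('o, 'v, 'p, 'w) ftr"
  D_hsq :: "('h, 's, 'k, 't) ftr"
  Dcmp :: "'h \<times> 'h \<Rightarrow> 't"
  Dunit :: "'o \<Rightarrow> 't"

locale double_functor =
  fixes D :: "('o, 'v, 'h, 's) dbl" and D' :: "('p, 'w, 'k, 't) dbl"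
    and F :: "('o, 'v, 'h, 's, 'p, 'w, 'k, 't) dftr"
  assumes source_double_category: "double_category D"
    and target_double_category: "double_category D'"
    and D_vert_functor: "ext_functor (vert D) (vert D') (D_vert F)"
    and D_hsq_functor: "ext_functor (hsq D) (hsq D') (D_hsq F)"
    and lft_ob: "\<alpha> \<in> Ob (hsq D) \<Longrightarrow> FO (lft D') (FO (D_hsq F) \<alpha>) = FO (D_vert F) (FO (lft D) \<alpha>)"
    and lft_mor: "\<Phi> \<in> Mor (hsq D) \<Longrightarrow> FM (lft D') (FM (D_hsq F) \<Phi>) = FM (D_vert F) (FM (lft D) \<Phi>)"
    and rgt_ob: "\<alpha> \<in> Ob (hsq D) \<Longrightarrow> FO (rgt D') (FO (D_hsq F) \<alpha>) = FO (D_vert F) (FO (rgt D) \<alpha>)"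
    and rgt_mor: "\<Phi> \<in> Mor (hsq D) \<Longrightarrow> FM (rgt D') (FM (D_hsq F) \<Phi>) = FM (D_vert F) (FM (rgt D) \<Phi>)"
    and Dcmp_globular: "(\<beta>, \<alpha>) \<in> Ob (dpairs D) \<Longrightarrow> Dcmp F (\<beta>, \<alpha>) \<in> globular D'"
    and Dcmp_iso: "(\<beta>, \<alpha>) \<in> Ob (dpairs D) \<Longrightarrow> is_iso (hsq D') (Dcmp F (\<beta>, \<alpha>))"
    and Dcmp_dom: "(\<beta>, \<alpha>) \<in> Ob (dpairs D) \<Longrightarrow>
        Dom (hsq D') (Dcmp F (\<beta>, \<alpha>)) = FO (D_hsq F) \<beta> \<star>\<^bsub>dhcomp D'\<^esub> FO (D_hsq F) \<alpha>"
    and Dcmp_cod: "(\<beta>, \<alpha>) \<in> Ob (dpairs D) \<Longrightarrow>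
        Cod (hsq D') (Dcmp F (\<beta>, \<alpha>)) = FO (D_hsq F) (\<beta> \<star>\<^bsub>dhcomp D\<^esub> \<alpha>)"
    and Dcmp_natural: "(\<Psi>, \<Phi>) \<in> Mor (dpairs D) \<Longrightarrow>
        FM (D_hsq F) (\<Psi> \<ast>\<^bsub>dhcomp D\<^esub> \<Phi>) \<cdot>\<^bsub>hsq D'\<^esub> Dcmp F (Dom (hsq D) \<Psi>, Dom (hsq D) \<Phi>)
        = Dcmp F (Cod (hsq D) \<Psi>, Cod (hsq D) \<Phi>)
            \<cdot>\<^bsub>hsq D'\<^esub> (FM (D_hsq F) \<Psi> \<ast>\<^bsub>dhcomp D'\<^esub> FM (D_hsq F) \<Phi>)"
    and Dunit_globular: "a \<in> Ob (vert D) \<Longrightarrow> Dunit F a \<in> globular D'"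
    and Dunit_iso: "a \<in> Ob (vert D) \<Longrightarrow> is_iso (hsq D') (Dunit F a)"
    and Dunit_dom: "a \<in> Ob (vert D) \<Longrightarrow> Dom (hsq D') (Dunit F a) = FO (hid D') (FO (D_vert F) a)"
    and Dunit_cod: "a \<in> Ob (vert D) \<Longrightarrow> Cod (hsq D') (Dunit F a) = FO (D_hsq F) (FO (hid D) a)"
    and Dunit_natural: "f \<in> Mor (vert D) \<Longrightarrow>
        FM (D_hsq F) (FM (hid D) f) \<cdot>\<^bsub>hsq D'\<^esub> Dunit F (Dom (vert D) f)
        = Dunit F (Cod (vert D) f) \<cdot>\<^bsub>hsq D'\<^esub> FM (hid D') (FM (D_vert F) f)"
    and D_assoc: "\<lbrakk>(\<gamma>, \<beta>) \<in> Ob (dpairs D); (\<beta>, \<alpha>) \<in> Ob (dpairs D)\<rbrakk> \<Longrightarrow>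
        FM (D_hsq F) (dassoc D \<gamma> \<beta> \<alpha>) \<cdot>\<^bsub>hsq D'\<^esub> Dcmp F (\<gamma> \<star>\<^bsub>dhcomp D\<^esub> \<beta>, \<alpha>)
          \<cdot>\<^bsub>hsq D'\<^esub> (Dcmp F (\<gamma>, \<beta>) \<ast>\<^bsub>dhcomp D'\<^esub> Idn (hsq D') (FO (D_hsq F) \<alpha>))
        = Dcmp F (\<gamma>, \<beta> \<star>\<^bsub>dhcomp D\<^esub> \<alpha>)
          \<cdot>\<^bsub>hsq D'\<^esub> (Idn (hsq D') (FO (D_hsq F) \<gamma>) \<ast>\<^bsub>dhcomp D'\<^esub> Dcmp F (\<beta>, \<alpha>))
          \<cdot>\<^bsub>hsq D'\<^esub> dassoc D' (FO (D_hsq F) \<gamma>) (FO (D_hsq F) \<beta>) (FO (D_hsq F) \<alpha>)"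
    and D_lunit: "\<alpha> \<in> Ob (hsq D) \<Longrightarrow>
        FM (D_hsq F) (dlunit D \<alpha>) \<cdot>\<^bsub>hsq D'\<^esub> Dcmp F (FO (hid D) (FO (rgt D) \<alpha>), \<alpha>)
          \<cdot>\<^bsub>hsq D'\<^esub> (Dunit F (FO (rgt D) \<alpha>) \<ast>\<^bsub>dhcomp D'\<^esub> Idn (hsq D') (FO (D_hsq F) \<alpha>))
        = dlunit D' (FO (D_hsq F) \<alpha>)"
    and D_runit: "\<alpha> \<in> Ob (hsq D) \<Longrightarrow>
        FM (D_hsq F) (drunit D \<alpha>) \<cdot>\<^bsub>hsq D'\<^esub> Dcmp F (\<alpha>, FO (hid D) (FO (lft D) \<alpha>))
          \<cdot>\<^bsub>hsq D'\<^esub> (Idn (hsq D') (FO (D_hsq F) \<alpha>) \<ast>\<^bsub>dhcomp D'\<^esub> Dunit F (FO (lft D) \<alpha>))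
        = drunit D' (FO (D_hsq F) \<alpha>)"
    and D_extensional: "Dcmp F \<in> extensional (Ob (dpairs D))"
        "Dunit F \<in> extensional (Ob (vert D))"

definition strict_double_functor ::
  "('o, 'v, 'h, 's) dbl \<Rightarrow> ('p, 'w, 'k, 't) dbl \<Rightarrow> ('o, 'v, 'h, 's, 'p, 'w, 'k, 't) dftr \<Rightarrow> bool" where
  "strict_double_functor D D' F \<longleftrightarrow> double_functor D D' F \<and>
     (\<forall>(\<beta>, \<alpha>) \<in> Ob (dpairs D).
        Dcmp F (\<beta>, \<alpha>) = Idn (hsq D') (FO (D_hsq F) \<beta> \<star>\<^bsub>dhcomp D'\<^esub> FO (D_hsq F) \<alpha>)) \<and>
     (\<forall>a \<in> Ob (vert D). Dunit F a = Idn (hsq D') (FO (hid D') (FO (D_vert F) a)))"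

definition id_dftr :: "('o, 'v, 'h, 's) dbl \<Rightarrow> ('o, 'v, 'h, 's, 'o, 'v, 'h, 's) dftr" where
  "id_dftr D = \<lparr> D_vert = id_ftr (vert D), D_hsq = id_ftr (hsq D),
     Dcmp = (\<lambda>(\<beta>, \<alpha>) \<in> Ob (dpairs D). Idn (hsq D) (\<beta> \<star>\<^bsub>dhcomp D\<^esub> \<alpha>)),
     Dunit = (\<lambda>a \<in> Ob (vert D). Idn (hsq D) (FO (hid D) a)) \<rparr>"

definition comp_dftr ::
  "('o, 'v, 'h, 's) dbl \<Rightarrow> ('q, 'x, 'l, 'u) dbl \<Rightarrow> ('p, 'w, 'k, 't, 'q, 'x, 'l, 'u) dftr
    \<Rightarrow> ('o, 'v, 'h, 's, 'p, 'w, 'k, 't) dftr \<Rightarrow> ('o, 'v, 'h, 's, 'q, 'x, 'l, 'u) dftr" where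
  "comp_dftr D D'' G F = \<lparr> D_vert = comp_ftr (vert D) (D_vert G) (D_vert F),
     D_hsq = comp_ftr (hsq D) (D_hsq G) (D_hsq F),
     Dcmp = (\<lambda>(\<beta>, \<alpha>) \<in> Ob (dpairs D).
        FM (D_hsq G) (Dcmp F (\<beta>, \<alpha>)) \<cdot>\<^bsub>hsq D''\<^esub> Dcmp G (FO (D_hsq F) \<beta>, FO (D_hsq F) \<alpha>)),
     Dunit = (\<lambda>a \<in> Ob (vert D). FM (D_hsq G) (Dunit F a) \<cdot>\<^bsub>hsq D''\<^esub> Dunit G (FO (D_vert F) a)) \<rparr>"


section \<open>Decorated horizontalization\<close>

definition horizontal_bicategory :: "('o, 'v, 'h, 's) dbl \<Rightarrow> ('o, 'h, 's) bicat" where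
  "horizontal_bicategory D =
     \<lparr> cells0 = Ob (vert D), cells = (hsq D)\<lparr> Mor := globular D \<rparr>,
       bsrc = FO (lft D), btgt = FO (rgt D), bunit = FO (hid D), bhcomp = dhcomp D,
       bassoc = dassoc D, blunit = dlunit D, brunit = drunit D \<rparr>"

definition Hstar :: "('o, 'v, 'h, 's) dbl \<Rightarrow> ('o, 'v, 'h, 's) dbicat" where
  "Hstar D = \<lparr> und = horizontal_bicategory D, deco = vert D \<rparr>"

definition Hstar_map ::
  "('o, 'v, 'h, 's) dbl \<Rightarrow> ('o, 'v, 'h, 's, 'p, 'w, 'k, 't) dftr
    \<Rightarrow> ('o, 'v, 'h, 's, 'p, 'w, 'k, 't) dpsf" where
  "Hstar_map D F =
     \<lparr> psf_part = \<lparr> P_ob = FO (D_vert F),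
         P_cells = \<lparr> FO = FO (D_hsq F), FM = restrict (FM (D_hsq F)) (globular D) \<rparr>,
         Pcmp = Dcmp F, Punit = Dunit F \<rparr>,
       deco_part = D_vert F \<rparr>"


section \<open>The free globularly generated double category\<close>

datatype ('v, 'c) fexp =
    Cell 'c                                    \<comment> \<open>a 2-cell\<close>
  | HId 'v                                     \<comment> \<open>the square \<open>i_f\<close>\<close>
  | VComp "('v, 'c) fexp" "('v, 'c) fexp"      \<comment> \<open>\<open>VComp \<Psi> \<Phi>\<close> is \<open>\<Psi> \<bullet> \<Phi>\<close>\<close>
  | HComp "('v, 'c) fexp" "('v, 'c) fexp"      \<comment> \<open>\<open>HComp \<Psi> \<Phi>\<close> is \<open>\<Psi> * \<Phi>\<close>\<close>

primrec ftop :: "('o, 'v, 'h, 'c) dbicat \<Rightarrow> ('v, 'c) fexp \<Rightarrow> 'h" where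
  "ftop B (Cell \<phi>) = Dom (cells (und B)) \<phi>"
| "ftop B (HId f) = bunit (und B) (Dom (deco B) f)"
| "ftop B (VComp \<Psi> \<Phi>) = ftop B \<Phi>"
| "ftop B (HComp \<Psi> \<Phi>) = ftop B \<Psi> \<star>\<^bsub>bhcomp (und B)\<^esub> ftop B \<Phi>"

primrec fbot :: "('o, 'v, 'h, 'c) dbicat \<Rightarrow> ('v, 'c) fexp \<Rightarrow> 'h" where
  "fbot B (Cell \<phi>) = Cod (cells (und B)) \<phi>"
| "fbot B (HId f) = bunit (und B) (Cod (deco B) f)"
| "fbot B (VComp \<Psi> \<Phi>) = fbot B \<Psi>"
| "fbot B (HComp \<Psi> \<Phi>) = fbot B \<Psi> \<star>\<^bsub>bhcomp (und B)\<^esub> fbot B \<Phi>"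

primrec flft :: "('o, 'v, 'h, 'c) dbicat \<Rightarrow> ('v, 'c) fexp \<Rightarrow> 'v" where
  "flft B (Cell \<phi>) = Idn (deco B) (bsrc (und B) (Dom (cells (und B)) \<phi>))"
| "flft B (HId f) = f"
| "flft B (VComp \<Psi> \<Phi>) = flft B \<Psi> \<cdot>\<^bsub>deco B\<^esub> flft B \<Phi>"
| "flft B (HComp \<Psi> \<Phi>) = flft B \<Phi>"

primrec frgt :: "('o, 'v, 'h, 'c) dbicat \<Rightarrow> ('v, 'c) fexp \<Rightarrow> 'v" where
  "frgt B (Cell \<phi>) = Idn (deco B) (btgt (und B) (Dom (cells (und B)) \<phi>))"
| "frgt B (HId f) = f"
| "frgt B (VComp \<Psi> \<Phi>) = frgt B \<Psi> \<cdot>\<^bsub>deco B\<^esub> frgt B \<Phi>"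
| "frgt B (HComp \<Psi> \<Phi>) = frgt B \<Psi>"

text \<open>Only the expressions satisfying \<open>fwf\<close> are formal squares.\<close>

primrec fwf :: "('o, 'v, 'h, 'c) dbicat \<Rightarrow> ('v, 'c) fexp \<Rightarrow> bool" where
  "fwf B (Cell \<phi>) \<longleftrightarrow> \<phi> \<in> Mor (cells (und B))"
| "fwf B (HId f) \<longleftrightarrow> f \<in> Mor (deco B)"
| "fwf B (VComp \<Psi> \<Phi>) \<longleftrightarrow> fwf B \<Psi> \<and> fwf B \<Phi> \<and> fbot B \<Phi> = ftop B \<Psi>"
| "fwf B (HComp \<Psi> \<Phi>) \<longleftrightarrow> fwf B \<Psi> \<and> fwf B \<Phi> \<and> frgt B \<Phi> = flft B \<Psi>"

inductive feq :: "('o, 'v, 'h, 'c) dbicat \<Rightarrow> ('v, 'c) fexp \<Rightarrow> ('v, 'c) fexp \<Rightarrow> bool" for B where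
  feq_refl: "fwf B \<Phi> \<Longrightarrow> feq B \<Phi> \<Phi>"
| feq_sym: "feq B \<Phi> \<Psi> \<Longrightarrow> feq B \<Psi> \<Phi>"
| feq_trans: "\<lbrakk>feq B \<Phi> \<Psi>; feq B \<Psi> \<Theta>\<rbrakk> \<Longrightarrow> feq B \<Phi> \<Theta>"
| feq_VComp: "\<lbrakk>feq B \<Psi> \<Psi>'; feq B \<Phi> \<Phi>'; fwf B (VComp \<Psi> \<Phi>); fwf B (VComp \<Psi>' \<Phi>')\<rbrakk>
    \<Longrightarrow> feq B (VComp \<Psi> \<Phi>) (VComp \<Psi>' \<Phi>')"
| feq_HComp: "\<lbrakk>feq B \<Psi> \<Psi>'; feq B \<Phi> \<Phi>'; fwf B (HComp \<Psi> \<Phi>); fwf B (HComp \<Psi>' \<Phi>')\<rbrakk>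
    \<Longrightarrow> feq B (HComp \<Psi> \<Phi>) (HComp \<Psi>' \<Phi>')"
| feq_hid_idn: "a \<in> cells0 (und B) \<Longrightarrow>
    feq B (HId (Idn (deco B) a)) (Cell (Idn (cells (und B)) (bunit (und B) a)))"
| feq_vassoc: "\<lbrakk>fwf B (VComp \<Theta> \<Psi>); fwf B (VComp \<Psi> \<Phi>)\<rbrakk> \<Longrightarrow>
    feq B (VComp (VComp \<Theta> \<Psi>) \<Phi>) (VComp \<Theta> (VComp \<Psi> \<Phi>))"
| feq_vidn_top: "fwf B \<Phi> \<Longrightarrow> feq B (VComp \<Phi> (Cell (Idn (cells (und B)) (ftop B \<Phi>)))) \<Phi>"
| feq_vidn_bot: "fwf B \<Phi> \<Longrightarrow> feq B (VComp (Cell (Idn (cells (und B)) (fbot B \<Phi>))) \<Phi>) \<Phi>"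
| feq_exchange: "\<lbrakk>fwf B (HComp (VComp \<Psi>\<^sub>2 \<Psi>\<^sub>1) (VComp \<Phi>\<^sub>2 \<Phi>\<^sub>1));
      fwf B (VComp (HComp \<Psi>\<^sub>2 \<Phi>\<^sub>2) (HComp \<Psi>\<^sub>1 \<Phi>\<^sub>1))\<rbrakk> \<Longrightarrow>
    feq B (HComp (VComp \<Psi>\<^sub>2 \<Psi>\<^sub>1) (VComp \<Phi>\<^sub>2 \<Phi>\<^sub>1)) (VComp (HComp \<Psi>\<^sub>2 \<Phi>\<^sub>2) (HComp \<Psi>\<^sub>1 \<Phi>\<^sub>1))"
| feq_cell_vcomp: "\<lbrakk>\<phi> \<in> Mor (cells (und B)); \<psi> \<in> Mor (cells (und B));
      Cod (cells (und B)) \<phi> = Dom (cells (und B)) \<psi>\<rbrakk> \<Longrightarrow>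
    feq B (VComp (Cell \<psi>) (Cell \<phi>)) (Cell (\<psi> \<cdot>\<^bsub>cells (und B)\<^esub> \<phi>))"
| feq_hid_vcomp: "\<lbrakk>f \<in> Mor (deco B); g \<in> Mor (deco B); Cod (deco B) f = Dom (deco B) g\<rbrakk> \<Longrightarrow>
    feq B (VComp (HId g) (HId f)) (HId (g \<cdot>\<^bsub>deco B\<^esub> f))"
| feq_cell_hcomp: "(\<psi>, \<phi>) \<in> Mor (bpairs (und B)) \<Longrightarrow>
    feq B (HComp (Cell \<psi>) (Cell \<phi>)) (Cell (\<psi> \<ast>\<^bsub>bhcomp (und B)\<^esub> \<phi>))"
| feq_lunit: "fwf B \<Phi> \<Longrightarrow>
    feq B (VComp (Cell (blunit (und B) (fbot B \<Phi>))) (HComp (HId (frgt B \<Phi>)) \<Phi>))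
          (VComp \<Phi> (Cell (blunit (und B) (ftop B \<Phi>))))"
| feq_runit: "fwf B \<Phi> \<Longrightarrow>
    feq B (VComp (Cell (brunit (und B) (fbot B \<Phi>))) (HComp \<Phi> (HId (flft B \<Phi>))))
          (VComp \<Phi> (Cell (brunit (und B) (ftop B \<Phi>))))"
| feq_assoc: "\<lbrakk>fwf B (HComp \<Theta> \<Psi>); fwf B (HComp \<Psi> \<Phi>)\<rbrakk> \<Longrightarrow>
    feq B (VComp (Cell (bassoc (und B) (fbot B \<Theta>) (fbot B \<Psi>) (fbot B \<Phi>))) (HComp (HComp \<Theta> \<Psi>) \<Phi>))
          (VComp (HComp \<Theta> (HComp \<Psi> \<Phi>)) (Cell (bassoc (und B) (ftop B \<Theta>) (ftop B \<Psi>) (ftop B \<Phi>))))"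

definition fclass :: "('o, 'v, 'h, 'c) dbicat \<Rightarrow> ('v, 'c) fexp \<Rightarrow> ('v, 'c) fexp set" where
  "fclass B \<Phi> = {\<Psi>. feq B \<Phi> \<Psi>}"

definition frep :: "('v, 'c) fexp set \<Rightarrow> ('v, 'c) fexp" where
  "frep X = (SOME \<Phi>. \<Phi> \<in> X)"

definition Q :: "('o, 'v, 'h, 'c) dbicat \<Rightarrow> ('o, 'v, 'h, ('v, 'c) fexp set) dbl" where
  "Q B =
     \<lparr> vert = deco B,
       hsq = \<lparr> Ob = Ob (cells (und B)),
               Mor = fclass B ` {\<Phi>. fwf B \<Phi>},
               Dom = (\<lambda>X. ftop B (frep X)),
               Cod = (\<lambda>X. fbot B (frep X)),
               Idn = (\<lambda>\<alpha>. fclass B (Cell (Idn (cells (und B)) \<alpha>))),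
               Cmp = (\<lambda>Y X. fclass B (VComp (frep Y) (frep X))) \<rparr>,
       lft = \<lparr> FO = bsrc (und B), FM = (\<lambda>X. flft B (frep X)) \<rparr>,
       rgt = \<lparr> FO = btgt (und B), FM = (\<lambda>X. frgt B (frep X)) \<rparr>,
       hid = \<lparr> FO = bunit (und B), FM = (\<lambda>f. fclass B (HId f)) \<rparr>,
       dhcomp = \<lparr> FO = FO (bhcomp (und B)),
                  FM = (\<lambda>(Y, X). fclass B (HComp (frep Y) (frep X))) \<rparr>,
       dassoc = (\<lambda>\<gamma> \<beta> \<alpha>. fclass B (Cell (bassoc (und B) \<gamma> \<beta> \<alpha>))),
       dlunit = (\<lambda>\<alpha>. fclass B (Cell (blunit (und B) \<alpha>))),
       drunit = (\<lambda>\<alpha>. fclass B (Cell (brunit (und B) \<alpha>))) \<rparr>"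

text \<open>The inclusion of \<open>B\<close> in \<open>H\<^sup>* Q B\<close>, as a strict decorated pseudofunctor.\<close>

definition jincl ::
  "('o, 'v, 'h, 'c) dbicat \<Rightarrow> ('o, 'v, 'h, 'c, 'o, 'v, 'h, ('v, 'c) fexp set) dpsf" where
  "jincl B =
     \<lparr> psf_part =
         \<lparr> P_ob = (\<lambda>a \<in> cells0 (und B). a),
           P_cells = \<lparr> FO = (\<lambda>\<alpha> \<in> Ob (cells (und B)). \<alpha>),
                  FM = (\<lambda>\<phi> \<in> Mor (cells (und B)). fclass B (Cell \<phi>)) \<rparr>,
           Pcmp = (\<lambda>(\<beta>, \<alpha>) \<in> Ob (bpairs (und B)). Idn (hsq (Q B)) (\<beta> \<star>\<^bsub>bhcomp (und B)\<^esub> \<alpha>)),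
           Punit = (\<lambda>a \<in> cells0 (und B). Idn (hsq (Q B)) (bunit (und B) a)) \<rparr>,
       deco_part = id_ftr (deco B) \<rparr>"

definition Q_map ::
  "('o, 'v, 'h, 'c) dbicat \<Rightarrow> ('p, 'w, 'k, 'd) dbicat \<Rightarrow> ('o, 'v, 'h, 'c, 'p, 'w, 'k, 'd) dpsf
    \<Rightarrow> ('o, 'v, 'h, ('v, 'c) fexp set, 'p, 'w, 'k, ('w, 'd) fexp set) dftr" where
  "Q_map B B' G = (THE F. double_functor (Q B) (Q B') F \<and>
     comp_dpsf B (Hstar (Q B')) (Hstar_map (Q B) F) (jincl B)
       = comp_dpsf B (Hstar (Q B')) (jincl B') G)"

text \<open>A square of \<open>Q (H\<^sup>* C)\<close> lies in \<open>H\<^sup>* C\<close> when it is the class of a globular square of \<open>C\<close>.\<close>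

definition canonical_projection ::
  "('o, 'v, 'h, 's) dbl \<Rightarrow> ('o, 'v, 'h, ('v, 's) fexp set, 'o, 'v, 'h, 's) dftr" where
  "canonical_projection C = (THE F. strict_double_functor (Q (Hstar C)) C F \<and>
     (\<forall>a \<in> Ob (vert C). FO (D_vert F) a = a) \<and>
     (\<forall>f \<in> Mor (vert C). FM (D_vert F) f = f) \<and>
     (\<forall>\<alpha> \<in> Ob (hsq C). FO (D_hsq F) \<alpha> = \<alpha>) \<and>
     (\<forall>\<phi> \<in> globular C. FM (D_hsq F) (fclass (Hstar C) (Cell \<phi>)) = \<phi>))"

end

theory Submission
  imports Defs
begin

text \<open>Everything follows from a universal property: for a double category \<open>D\<close>, restriction along
  \<open>j\<close> is a bijection from the double functors \<open>Q B \<rightarrow> D\<close> to the decorated pseudofunctors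
  \<open>B \<rightarrow> H\<^sup>* D\<close>.  A double functor on \<open>Q B\<close> is determined by its restriction because its comparison
  squares are invertible, so that their naturality fixes the image of each \<open>i\<^sub>f\<close> and of each
  horizontal composite.  Conversely the same equations define an extension by recursion on formal
  squares, and the coherence axioms of a pseudofunctor are what makes it respect the relations
  imposing naturality of the associators and unitors.  Then \<open>Q G\<close> and \<open>\<pi>\<close> are the extensions of
  \<open>j \<circ> G\<close> and of the identity of \<open>H\<^sup>* C\<close>, and all required equations between double functors are
  checked on restrictions along \<open>j\<close>.\<close>

section \<open>Categories, isomorphisms and functors\<close>

text \<open>What shapes the work is weakness: a pseudofunctor preserves horizontal composites and
  units only up to its comparison 2-cells, so formal squares cannot simply be evaluated in the
  target. Each \<open>HId\<close> and \<open>HComp\<close> node is conjugated by comparison squares.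
  The relations then become equations cluttered with inverses, and the recurring device is to
  precompose with an invertible square and cancel it by \<open>iso_epi\<close>, so that the axioms
  apply in their inverse-free form. Squares of \<open>Q B\<close> are classes handled through chosen
  representatives, so boundaries must first be shown invariant under \<open>feq\<close>. Globular
  squares of \<open>Q B\<close> can be more than classes of single 2-cells, hence agreement is
  tested along j, on generators only. Extensionality fixes the junk values outside the carriers; it
  turns pointwise agreement into equality of records, and so gives meaning to the definite
  descriptions in \<open>Q_map\<close> and \<open>canonical_projection\<close>.\<close>

context category
begin

lemma cmp_idn_right: "f \<in> Mor C \<Longrightarrow> Dom C f = a \<Longrightarrow> f \<cdot>\<^bsub>C\<^esub> Idn C a = f"
  using cmp_idn_dom[of f] by simp

lemma cmp_idn_left: "f \<in> Mor C \<Longrightarrow> Cod C f = a \<Longrightarrow> Idn C a \<cdot>\<^bsub>C\<^esub> f = f"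
  using cmp_idn_cod[of f] by simp

lemmas cat_simps [simp] = dom_ob cod_ob idn_mor dom_idn cod_idn cmp_mor dom_cmp cod_cmp
  cmp_idn_right cmp_idn_left

lemma iso_mor [simp]: "is_iso C e \<Longrightarrow> e \<in> Mor C"
  by (simp add: is_iso_def)

lemma isoI:
  assumes "e \<in> Mor C" "g \<in> Mor C" "Dom C g = Cod C e" "Cod C g = Dom C e"
    "g \<cdot>\<^bsub>C\<^esub> e = Idn C (Dom C e)" "e \<cdot>\<^bsub>C\<^esub> g = Idn C (Cod C e)"
  shows "is_iso C e"
  unfolding is_iso_def using assms by (intro conjI bexI[of _ g]) simp_all

lemma iso_idn [simp]: "a \<in> Ob C \<Longrightarrow> is_iso C (Idn C a)"
  by (rule isoI[where g = "Idn C a"]) auto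

text \<open>\<open>is_iso\<close> only asserts that an inverse exists, so one is chosen; the facts
  below concern isomorphisms only.\<close>

definition cinv :: "'m \<Rightarrow> 'm" where
  "cinv e = (SOME g. g \<in> Mor C \<and> Dom C g = Cod C e \<and> Cod C g = Dom C e \<and>
        g \<cdot>\<^bsub>C\<^esub> e = Idn C (Dom C e) \<and> e \<cdot>\<^bsub>C\<^esub> g = Idn C (Cod C e))"

lemma cinv [simp]:
  assumes "is_iso C e"
  shows "cinv e \<in> Mor C" "Dom C (cinv e) = Cod C e" "Cod C (cinv e) = Dom C e"
    "cinv e \<cdot>\<^bsub>C\<^esub> e = Idn C (Dom C e)" "e \<cdot>\<^bsub>C\<^esub> cinv e = Idn C (Cod C e)"
proof -
  have "\<exists>g. g \<in> Mor C \<and> Dom C g = Cod C e \<and> Cod C g = Dom C e \<and>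
        g \<cdot>\<^bsub>C\<^esub> e = Idn C (Dom C e) \<and> e \<cdot>\<^bsub>C\<^esub> g = Idn C (Cod C e)"
    using assms unfolding is_iso_def by blast
  from someI_ex[OF this, folded cinv_def]
  show "cinv e \<in> Mor C" "Dom C (cinv e) = Cod C e" "Cod C (cinv e) = Dom C e"
    "cinv e \<cdot>\<^bsub>C\<^esub> e = Idn C (Dom C e)" "e \<cdot>\<^bsub>C\<^esub> cinv e = Idn C (Cod C e)"
    by simp_all
qed

lemma cinv_idn [simp]: "a \<in> Ob C \<Longrightarrow> cinv (Idn C a) = Idn C a"
  using cinv(4)[of "Idn C a"] cinv(1,2)[of "Idn C a"] by (simp del: cinv)

lemma cinv_cancel [simp]:
  assumes "is_iso C e" "x \<in> Mor C"
  shows "Cod C x = Dom C e \<Longrightarrow> cinv e \<cdot>\<^bsub>C\<^esub> e \<cdot>\<^bsub>C\<^esub> x = x"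
    and "Cod C x = Cod C e \<Longrightarrow> e \<cdot>\<^bsub>C\<^esub> cinv e \<cdot>\<^bsub>C\<^esub> x = x"
  using assms by (simp_all flip: cmp_assoc)

lemma iso_cmp:
  assumes "is_iso C e" "is_iso C f" "Cod C e = Dom C f"
  shows "is_iso C (f \<cdot>\<^bsub>C\<^esub> e)"
  using assms by (intro isoI[where g = "cinv e \<cdot>\<^bsub>C\<^esub> cinv f"]) (simp_all add: cmp_assoc)

text \<open>The cancellation principle used throughout: comparison squares are invertible, so two
  candidates for the image of a square agree once they agree after precomposition with one.\<close>

lemma iso_epi:
  assumes "is_iso C e" "f \<in> Mor C" "g \<in> Mor C" "Dom C f = Cod C e" "Dom C g = Cod C e"
    and eq: "f \<cdot>\<^bsub>C\<^esub> e = g \<cdot>\<^bsub>C\<^esub> e"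
  shows "f = g"
proof -
  have "f = (f \<cdot>\<^bsub>C\<^esub> e) \<cdot>\<^bsub>C\<^esub> cinv e" "g = (g \<cdot>\<^bsub>C\<^esub> e) \<cdot>\<^bsub>C\<^esub> cinv e"
    using assms(1-5) by (simp_all add: cmp_assoc)
  then show ?thesis
    using eq by simp
qed

end

context cat_functor
begin

sublocale src: category C by (rule source_category)
sublocale tgt: category D by (rule target_category)

lemmas functor_simps [simp] = fun_ob fun_mor fun_dom fun_cod fun_idn fun_cmp

lemma fun_iso [simp]:
  assumes "is_iso C e" shows "is_iso D (FM F e)"
proof -
  have "FM F (src.cinv e) \<cdot>\<^bsub>D\<^esub> FM F e = FM F (src.cinv e \<cdot>\<^bsub>C\<^esub> e)"
    "FM F e \<cdot>\<^bsub>D\<^esub> FM F (src.cinv e) = FM F (e \<cdot>\<^bsub>C\<^esub> src.cinv e)"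
    using assms by (simp_all del: src.cinv(4,5))
  then show ?thesis
    using assms by (intro tgt.isoI[where g = "FM F (src.cinv e)"]) simp_all
qed

end

lemma cat_functor_comp:
  assumes "cat_functor C D F" "cat_functor D E G"
  shows "cat_functor C E (comp_ftr C G F)"
proof -
  interpret F: cat_functor C D F by fact
  interpret G: cat_functor D E G by fact
  show ?thesis
    by unfold_locales (auto simp: comp_ftr_def compose_eq)
qed

lemma cat_functor_id: "category C \<Longrightarrow> cat_functor C C (id_ftr C)"
proof -
  assume "category C"
  then interpret category C .
  show ?thesis
    by unfold_locales (auto simp: id_ftr_def)
qed

lemma ext_functor_comp:
  "ext_functor C D F \<Longrightarrow> ext_functor D E G \<Longrightarrow> ext_functor C E (comp_ftr C G F)"
  using cat_functor_comp by (auto simp: ext_functor_def comp_ftr_def)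

lemma ext_functor_id: "category C \<Longrightarrow> ext_functor C C (id_ftr C)"
  using cat_functor_id by (auto simp: ext_functor_def id_ftr_def)

section \<open>Bicategories and double categories\<close>

abbreviation vcomp_sq :: "('o, 'v, 'h, 's) dbl \<Rightarrow> 's \<Rightarrow> 's \<Rightarrow> 's" (infixr "\<bullet>\<index>" 70)
  where "\<Psi> \<bullet>\<^bsub>D\<^esub> \<Phi> \<equiv> \<Psi> \<cdot>\<^bsub>hsq D\<^esub> \<Phi>"

abbreviation hcomp_sq :: "('o, 'v, 'h, 's) dbl \<Rightarrow> 's \<Rightarrow> 's \<Rightarrow> 's" (infixr "\<otimes>\<index>" 75)
  where "\<Psi> \<otimes>\<^bsub>D\<^esub> \<Phi> \<equiv> FM (dhcomp D) (\<Psi>, \<Phi>)"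

abbreviation hcomp_ob :: "('o, 'v, 'h, 's) dbl \<Rightarrow> 'h \<Rightarrow> 'h \<Rightarrow> 'h" (infixr "\<odot>\<index>" 75)
  where "\<beta> \<odot>\<^bsub>D\<^esub> \<alpha> \<equiv> FO (dhcomp D) (\<beta>, \<alpha>)"

lemma fibre_product_simps [simp]:
  "(b, a) \<in> Ob (fibre_product C D S T) \<longleftrightarrow> b \<in> Ob C \<and> a \<in> Ob D \<and> FO S b = FO T a"
  "(g, f) \<in> Mor (fibre_product C D S T) \<longleftrightarrow> g \<in> Mor C \<and> f \<in> Mor D \<and> FM S g = FM T f"
  "Dom (fibre_product C D S T) (g, f) = (Dom C g, Dom D f)"
  "Cod (fibre_product C D S T) (g, f) = (Cod C g, Cod D f)"
  "Idn (fibre_product C D S T) (b, a) = (Idn C b, Idn D a)"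
  "(g', f') \<cdot>\<^bsub>fibre_product C D S T\<^esub> (g, f) = (g' \<cdot>\<^bsub>C\<^esub> g, f' \<cdot>\<^bsub>D\<^esub> f)"
  by (auto simp: fibre_product_def)

text \<open>Functoriality carries an equality of images of morphisms to their domains and codomains;
  this is the fact \<open>d\<close>, and it makes the ends of a matching pair match again.\<close>

lemma category_fibre_product:
  assumes "cat_functor C E S" "cat_functor D E T"
  shows "category (fibre_product C D S T)"
proof -
  interpret S: cat_functor C E S by fact
  interpret T: cat_functor D E T by fact
  have fst_snd: "Mor (fibre_product C D S T) = {(g, f). g \<in> Mor C \<and> f \<in> Mor D \<and> FM S g = FM T f}"
    "Ob (fibre_product C D S T) = {(b, a). b \<in> Ob C \<and> a \<in> Ob D \<and> FO S b = FO T a}"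
    by (auto simp: fibre_product_def)
  have d: "FO S (Dom C g) = FO T (Dom D f)" "FO S (Cod C g) = FO T (Cod D f)"
    if "g \<in> Mor C" "f \<in> Mor D" "FM S g = FM T f" for g f
    using S.fun_dom[of g] T.fun_dom[of f] S.fun_cod[of g] T.fun_cod[of f] that by simp_all
  show ?thesis
    by unfold_locales (auto simp: fst_snd d S.src.cmp_assoc T.src.cmp_assoc)
qed

section \<open>Double categories: edges, interchange and globular squares\<close>

context double_category
begin

sublocale L: cat_functor "hsq D" "vert D" "lft D" by (rule lft_functor)
sublocale R: cat_functor "hsq D" "vert D" "rgt D" by (rule rgt_functor)
sublocale I: cat_functor "vert D" "hsq D" "hid D" by (rule hid_functor)

lemma dpairs_Ob [simp]:
  "(\<beta>, \<alpha>) \<in> Ob (dpairs D) \<longleftrightarrow> \<beta> \<in> Ob (hsq D) \<and> \<alpha> \<in> Ob (hsq D) \<and> FO (lft D) \<beta> = FO (rgt D) \<alpha>"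
  by (simp add: dpairs_def)

lemma dpairs_Mor [simp]:
  "(\<Psi>, \<Phi>) \<in> Mor (dpairs D) \<longleftrightarrow> \<Psi> \<in> Mor (hsq D) \<and> \<Phi> \<in> Mor (hsq D) \<and> FM (lft D) \<Psi> = FM (rgt D) \<Phi>"
  by (simp add: dpairs_def)

text \<open>Composability of squares is a condition on vertical edges, composability of their tops
  and bottoms one on objects; functoriality of the edge functors passes from the first to the
  second.\<close>

lemma edge_ends:
  assumes "\<Psi> \<in> Mor (hsq D)" "\<Phi> \<in> Mor (hsq D)" "FM (lft D) \<Psi> = FM (rgt D) \<Phi>"
  shows "FO (lft D) (Dom (hsq D) \<Psi>) = FO (rgt D) (Dom (hsq D) \<Phi>)"
    and "FO (lft D) (Cod (hsq D) \<Psi>) = FO (rgt D) (Cod (hsq D) \<Phi>)"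
  using L.fun_dom[of \<Psi>] R.fun_dom[of \<Phi>] L.fun_cod[of \<Psi>] R.fun_cod[of \<Phi>] assms by simp_all

lemma hcomp_ob [simp]:
  "\<lbrakk>\<beta> \<in> Ob (hsq D); \<alpha> \<in> Ob (hsq D); FO (lft D) \<beta> = FO (rgt D) \<alpha>\<rbrakk> \<Longrightarrow> \<beta> \<odot>\<^bsub>D\<^esub> \<alpha> \<in> Ob (hsq D)"
  using cat_functor.fun_ob[OF hcomp_functor, of "(\<beta>, \<alpha>)"] by (simp add: dpairs_def)

lemma hcomp_mor [simp]:
  assumes "\<Psi> \<in> Mor (hsq D)" "\<Phi> \<in> Mor (hsq D)" "FM (lft D) \<Psi> = FM (rgt D) \<Phi>"
  shows "\<Psi> \<otimes>\<^bsub>D\<^esub> \<Phi> \<in> Mor (hsq D)"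
    and "Dom (hsq D) (\<Psi> \<otimes>\<^bsub>D\<^esub> \<Phi>) = Dom (hsq D) \<Psi> \<odot>\<^bsub>D\<^esub> Dom (hsq D) \<Phi>"
    and "Cod (hsq D) (\<Psi> \<otimes>\<^bsub>D\<^esub> \<Phi>) = Cod (hsq D) \<Psi> \<odot>\<^bsub>D\<^esub> Cod (hsq D) \<Phi>"
  using assms cat_functor.fun_mor[OF hcomp_functor, of "(\<Psi>, \<Phi>)"]
    cat_functor.fun_dom[OF hcomp_functor, of "(\<Psi>, \<Phi>)"]
    cat_functor.fun_cod[OF hcomp_functor, of "(\<Psi>, \<Phi>)"] by (simp_all add: dpairs_def)

lemma hcomp_idn [simp]:
  "\<lbrakk>\<beta> \<in> Ob (hsq D); \<alpha> \<in> Ob (hsq D); FO (lft D) \<beta> = FO (rgt D) \<alpha>\<rbrakk>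
    \<Longrightarrow> Idn (hsq D) \<beta> \<otimes>\<^bsub>D\<^esub> Idn (hsq D) \<alpha> = Idn (hsq D) (\<beta> \<odot>\<^bsub>D\<^esub> \<alpha>)"
  using cat_functor.fun_idn[OF hcomp_functor, of "(\<beta>, \<alpha>)"] by (simp add: dpairs_def)

lemma interchange:
  assumes "\<Psi>\<^sub>1 \<in> Mor (hsq D)" "\<Phi>\<^sub>1 \<in> Mor (hsq D)" "FM (lft D) \<Psi>\<^sub>1 = FM (rgt D) \<Phi>\<^sub>1"
    "\<Psi>\<^sub>2 \<in> Mor (hsq D)" "\<Phi>\<^sub>2 \<in> Mor (hsq D)" "FM (lft D) \<Psi>\<^sub>2 = FM (rgt D) \<Phi>\<^sub>2"
    "Cod (hsq D) \<Psi>\<^sub>1 = Dom (hsq D) \<Psi>\<^sub>2" "Cod (hsq D) \<Phi>\<^sub>1 = Dom (hsq D) \<Phi>\<^sub>2"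
  shows "(\<Psi>\<^sub>2 \<otimes>\<^bsub>D\<^esub> \<Phi>\<^sub>2) \<bullet>\<^bsub>D\<^esub> (\<Psi>\<^sub>1 \<otimes>\<^bsub>D\<^esub> \<Phi>\<^sub>1) = (\<Psi>\<^sub>2 \<bullet>\<^bsub>D\<^esub> \<Psi>\<^sub>1) \<otimes>\<^bsub>D\<^esub> (\<Phi>\<^sub>2 \<bullet>\<^bsub>D\<^esub> \<Phi>\<^sub>1)"
  using cat_functor.fun_cmp[OF hcomp_functor, of "(\<Psi>\<^sub>1, \<Phi>\<^sub>1)" "(\<Psi>\<^sub>2, \<Phi>\<^sub>2)"] assms
  by (simp add: dpairs_def)

text \<open>By interchange the composite of the two inverses is the inverse; the last assumption is
  what makes that composite defined.\<close>

lemma iso_hcomp: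
  assumes "is_iso (hsq D) \<Psi>" "is_iso (hsq D) \<Phi>" "FM (lft D) \<Psi> = FM (rgt D) \<Phi>"
    "FM (lft D) (L.src.cinv \<Psi>) = FM (rgt D) (L.src.cinv \<Phi>)"
  shows "is_iso (hsq D) (\<Psi> \<otimes>\<^bsub>D\<^esub> \<Phi>)"
  using assms edge_ends[of \<Psi> \<Phi>]
  by (intro L.src.isoI[where g = "L.src.cinv \<Psi> \<otimes>\<^bsub>D\<^esub> L.src.cinv \<Phi>"]) (simp_all add: interchange)

lemma hcomp_edges [simp]:
  "\<lbrakk>\<beta> \<in> Ob (hsq D); \<alpha> \<in> Ob (hsq D); FO (lft D) \<beta> = FO (rgt D) \<alpha>\<rbrakk>
    \<Longrightarrow> FO (lft D) (\<beta> \<odot>\<^bsub>D\<^esub> \<alpha>) = FO (lft D) \<alpha>"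
  "\<lbrakk>\<beta> \<in> Ob (hsq D); \<alpha> \<in> Ob (hsq D); FO (lft D) \<beta> = FO (rgt D) \<alpha>\<rbrakk>
    \<Longrightarrow> FO (rgt D) (\<beta> \<odot>\<^bsub>D\<^esub> \<alpha>) = FO (rgt D) \<beta>"
  "\<lbrakk>\<Psi> \<in> Mor (hsq D); \<Phi> \<in> Mor (hsq D); FM (lft D) \<Psi> = FM (rgt D) \<Phi>\<rbrakk>
    \<Longrightarrow> FM (lft D) (\<Psi> \<otimes>\<^bsub>D\<^esub> \<Phi>) = FM (lft D) \<Phi>"
  "\<lbrakk>\<Psi> \<in> Mor (hsq D); \<Phi> \<in> Mor (hsq D); FM (lft D) \<Psi> = FM (rgt D) \<Phi>\<rbrakk>
    \<Longrightarrow> FM (rgt D) (\<Psi> \<otimes>\<^bsub>D\<^esub> \<Phi>) = FM (rgt D) \<Psi>"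
  by (simp_all add: lft_hcomp_ob rgt_hcomp_ob lft_hcomp_mor rgt_hcomp_mor)

lemmas hid_edges [simp] = lft_hid_ob lft_hid_mor rgt_hid_ob rgt_hid_mor

lemma edge_idn_ends:
  assumes "\<Phi> \<in> Mor (hsq D)"
  shows "FM (lft D) \<Phi> = Idn (vert D) a \<Longrightarrow> a \<in> Ob (vert D) \<Longrightarrow> FO (lft D) (Dom (hsq D) \<Phi>) = a"
    and "FM (lft D) \<Phi> = Idn (vert D) a \<Longrightarrow> a \<in> Ob (vert D) \<Longrightarrow> FO (lft D) (Cod (hsq D) \<Phi>) = a"
    and "FM (rgt D) \<Phi> = Idn (vert D) a \<Longrightarrow> a \<in> Ob (vert D) \<Longrightarrow> FO (rgt D) (Dom (hsq D) \<Phi>) = a"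
    and "FM (rgt D) \<Phi> = Idn (vert D) a \<Longrightarrow> a \<in> Ob (vert D) \<Longrightarrow> FO (rgt D) (Cod (hsq D) \<Phi>) = a"
  using L.fun_dom[of \<Phi>] R.fun_dom[of \<Phi>] L.fun_cod[of \<Phi>] R.fun_cod[of \<Phi>] assms
  by simp_all

lemma globularI:
  assumes "\<Phi> \<in> Mor (hsq D)" "FM (lft D) \<Phi> = Idn (vert D) a" "FM (rgt D) \<Phi> = Idn (vert D) b"
    "a \<in> Ob (vert D)" "b \<in> Ob (vert D)"
  shows "\<Phi> \<in> globular D"
  using assms by (auto simp: globular_def)

text \<open>\<open>globular\<close> asks only for edges that are identities of some objects;
  functoriality of the edge functors pins these objects down as the ends of the top and of the
  bottom.\<close>

lemma globularD:
  assumes "\<Phi> \<in> globular D"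
  shows "\<Phi> \<in> Mor (hsq D)"
    and "FM (lft D) \<Phi> = Idn (vert D) (FO (lft D) (Dom (hsq D) \<Phi>))"
    and "FM (rgt D) \<Phi> = Idn (vert D) (FO (rgt D) (Dom (hsq D) \<Phi>))"
    and "FO (lft D) (Cod (hsq D) \<Phi>) = FO (lft D) (Dom (hsq D) \<Phi>)"
    and "FO (rgt D) (Cod (hsq D) \<Phi>) = FO (rgt D) (Dom (hsq D) \<Phi>)"
  using assms edge_idn_ends[of \<Phi>] by (auto simp: globular_def)

lemma globular_idn [simp]: "\<alpha> \<in> Ob (hsq D) \<Longrightarrow> Idn (hsq D) \<alpha> \<in> globular D"
  by (rule globularI) auto

lemma globular_vcomp [simp]:
  "\<lbrakk>\<Phi> \<in> globular D; \<Psi> \<in> globular D; Cod (hsq D) \<Phi> = Dom (hsq D) \<Psi>\<rbrakk> \<Longrightarrow> \<Psi> \<bullet>\<^bsub>D\<^esub> \<Phi> \<in> globular D"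
  using globularD[of \<Phi>] globularD[of \<Psi>]
  by (intro globularI[where a = "FO (lft D) (Dom (hsq D) \<Phi>)" and b = "FO (rgt D) (Dom (hsq D) \<Phi>)"])
    auto

text \<open>This is why horizontal composability means the same in \<open>D\<close> and in its
  horizontal bicategory: between globular squares it only depends on end objects.\<close>

lemma globular_edge_eq:
  assumes "\<Psi> \<in> globular D" "\<Phi> \<in> globular D"
  shows "FM (lft D) \<Psi> = FM (rgt D) \<Phi>
    \<longleftrightarrow> FO (lft D) (Dom (hsq D) \<Psi>) = FO (rgt D) (Dom (hsq D) \<Phi>)"
proof
  assume "FM (lft D) \<Psi> = FM (rgt D) \<Phi>"
  then show "FO (lft D) (Dom (hsq D) \<Psi>) = FO (rgt D) (Dom (hsq D) \<Phi>)"
    by (rule edge_ends(1)[OF globularD(1)[OF assms(1)] globularD(1)[OF assms(2)]])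
qed (simp add: globularD(2)[OF assms(1)] globularD(3)[OF assms(2)])

lemma globular_hcomp [simp]:
  assumes "\<Psi> \<in> globular D" "\<Phi> \<in> globular D"
    "FO (lft D) (Dom (hsq D) \<Psi>) = FO (rgt D) (Dom (hsq D) \<Phi>)"
  shows "\<Psi> \<otimes>\<^bsub>D\<^esub> \<Phi> \<in> globular D"
  using globularD[OF assms(1)] globularD[OF assms(2)] assms(3) globular_edge_eq[OF assms(1,2)]
  by (intro globularI[where a = "FO (lft D) (Dom (hsq D) \<Phi>)" and b = "FO (rgt D) (Dom (hsq D) \<Psi>)"])
    auto

text \<open>The edge functors send \<open>cinv \<Phi> \<bullet> \<Phi>\<close> to an identity, and
  the edge of \<open>\<Phi>\<close> is itself an identity, so that of the inverse is too.
  Invertibility in the horizontal bicategory needs this, since the inverse must be one of its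
  2-cells.\<close>

lemma globular_cinv:
  assumes "\<Phi> \<in> globular D" "is_iso (hsq D) \<Phi>"
  shows "L.src.cinv \<Phi> \<in> globular D"
proof -
  note g = globularD[OF assms(1)]
  have "FM (lft D) (L.src.cinv \<Phi>) \<cdot>\<^bsub>vert D\<^esub> FM (lft D) \<Phi> = FM (lft D) (L.src.cinv \<Phi> \<bullet>\<^bsub>D\<^esub> \<Phi>)"
    "FM (rgt D) (L.src.cinv \<Phi>) \<cdot>\<^bsub>vert D\<^esub> FM (rgt D) \<Phi> = FM (rgt D) (L.src.cinv \<Phi> \<bullet>\<^bsub>D\<^esub> \<Phi>)"
    using assms by (simp_all del: L.src.cinv(4,5) g(2,3))
  then show ?thesis
    using assms g
    by (intro globularI[where a = "FO (lft D) (Dom (hsq D) \<Phi>)" and b = "FO (rgt D) (Dom (hsq D) \<Phi>)"])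
      simp_all
qed

end

context double_category
begin

lemma assoc_simps [simp]:
  assumes "\<gamma> \<in> Ob (hsq D)" "\<beta> \<in> Ob (hsq D)" "\<alpha> \<in> Ob (hsq D)"
    "FO (lft D) \<gamma> = FO (rgt D) \<beta>" "FO (lft D) \<beta> = FO (rgt D) \<alpha>"
  shows "dassoc D \<gamma> \<beta> \<alpha> \<in> globular D"
    and "dassoc D \<gamma> \<beta> \<alpha> \<in> Mor (hsq D)"
    and "is_iso (hsq D) (dassoc D \<gamma> \<beta> \<alpha>)"
    and "Dom (hsq D) (dassoc D \<gamma> \<beta> \<alpha>) = (\<gamma> \<odot>\<^bsub>D\<^esub> \<beta>) \<odot>\<^bsub>D\<^esub> \<alpha>"
    and "Cod (hsq D) (dassoc D \<gamma> \<beta> \<alpha>) = \<gamma> \<odot>\<^bsub>D\<^esub> (\<beta> \<odot>\<^bsub>D\<^esub> \<alpha>)"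
    and "FM (lft D) (dassoc D \<gamma> \<beta> \<alpha>) = Idn (vert D) (FO (lft D) \<alpha>)"
    and "FM (rgt D) (dassoc D \<gamma> \<beta> \<alpha>) = Idn (vert D) (FO (rgt D) \<gamma>)"
  using assms assoc_globular assoc_iso assoc_dom assoc_cod globularD[of "dassoc D \<gamma> \<beta> \<alpha>"]
  by simp_all

lemma lunit_simps [simp]:
  assumes "\<alpha> \<in> Ob (hsq D)"
  shows "dlunit D \<alpha> \<in> globular D"
    and "dlunit D \<alpha> \<in> Mor (hsq D)"
    and "is_iso (hsq D) (dlunit D \<alpha>)"
    and "Dom (hsq D) (dlunit D \<alpha>) = FO (hid D) (FO (rgt D) \<alpha>) \<odot>\<^bsub>D\<^esub> \<alpha>"
    and "Cod (hsq D) (dlunit D \<alpha>) = \<alpha>"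
    and "FM (lft D) (dlunit D \<alpha>) = Idn (vert D) (FO (lft D) \<alpha>)"
    and "FM (rgt D) (dlunit D \<alpha>) = Idn (vert D) (FO (rgt D) \<alpha>)"
  using assms lunit_globular lunit_iso lunit_dom lunit_cod globularD[of "dlunit D \<alpha>"]
  by simp_all

lemma runit_simps [simp]:
  assumes "\<alpha> \<in> Ob (hsq D)"
  shows "drunit D \<alpha> \<in> globular D"
    and "drunit D \<alpha> \<in> Mor (hsq D)"
    and "is_iso (hsq D) (drunit D \<alpha>)"
    and "Dom (hsq D) (drunit D \<alpha>) = \<alpha> \<odot>\<^bsub>D\<^esub> FO (hid D) (FO (lft D) \<alpha>)"
    and "Cod (hsq D) (drunit D \<alpha>) = \<alpha>"
    and "FM (lft D) (drunit D \<alpha>) = Idn (vert D) (FO (lft D) \<alpha>)"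
    and "FM (rgt D) (drunit D \<alpha>) = Idn (vert D) (FO (rgt D) \<alpha>)"
  using assms runit_globular runit_iso runit_dom runit_cod globularD[of "drunit D \<alpha>"]
  by simp_all

end

lemma category_discrete: "category (discrete_cat X)"
  by unfold_locales (auto simp: discrete_cat_def)

section \<open>Bicategories: boundaries of composites and of structure cells\<close>

context bicategory
begin

sublocale S: cat_functor "cells B" "discrete_cat (cells0 B)" "bsrc_ftr B" by (rule src_functor)
sublocale T: cat_functor "cells B" "discrete_cat (cells0 B)" "btgt_ftr B" by (rule tgt_functor)

lemma bsrc_simps [simp]:
  "\<alpha> \<in> Ob (cells B) \<Longrightarrow> bsrc B \<alpha> \<in> cells0 B"
  "\<phi> \<in> Mor (cells B) \<Longrightarrow> bsrc B (Cod (cells B) \<phi>) = bsrc B (Dom (cells B) \<phi>)"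
  "\<alpha> \<in> Ob (cells B) \<Longrightarrow> btgt B \<alpha> \<in> cells0 B"
  "\<phi> \<in> Mor (cells B) \<Longrightarrow> btgt B (Cod (cells B) \<phi>) = btgt B (Dom (cells B) \<phi>)"
  using S.fun_ob[of \<alpha>] S.fun_cod[of \<phi>] T.fun_ob[of \<alpha>] T.fun_cod[of \<phi>]
  by (simp_all add: bsrc_ftr_def btgt_ftr_def discrete_cat_def)

lemma bunit_simps [simp]:
  "a \<in> cells0 B \<Longrightarrow> bunit B a \<in> Ob (cells B)"
  "a \<in> cells0 B \<Longrightarrow> bsrc B (bunit B a) = a"
  "a \<in> cells0 B \<Longrightarrow> btgt B (bunit B a) = a"
  by (simp_all add: unit_ob src_unit tgt_unit)

lemma bpairs_Ob [simp]:
  "(\<beta>, \<alpha>) \<in> Ob (bpairs B) \<longleftrightarrow> \<beta> \<in> Ob (cells B) \<and> \<alpha> \<in> Ob (cells B) \<and> bsrc B \<beta> = btgt B \<alpha>"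
  by (simp add: bpairs_def bsrc_ftr_def btgt_ftr_def)

lemma bpairs_Mor [simp]:
  "(\<psi>, \<phi>) \<in> Mor (bpairs B) \<longleftrightarrow> \<psi> \<in> Mor (cells B) \<and> \<phi> \<in> Mor (cells B) \<and>
     bsrc B (Dom (cells B) \<psi>) = btgt B (Dom (cells B) \<phi>)"
  by (simp add: bpairs_def bsrc_ftr_def btgt_ftr_def)

lemma bhcomp_ob [simp]:
  assumes "\<beta> \<in> Ob (cells B)" "\<alpha> \<in> Ob (cells B)" "bsrc B \<beta> = btgt B \<alpha>"
  shows "\<beta> \<star>\<^bsub>bhcomp B\<^esub> \<alpha> \<in> Ob (cells B)"
    and "bsrc B (\<beta> \<star>\<^bsub>bhcomp B\<^esub> \<alpha>) = bsrc B \<alpha>"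
    and "btgt B (\<beta> \<star>\<^bsub>bhcomp B\<^esub> \<alpha>) = btgt B \<beta>"
  using cat_functor.fun_ob[OF hcomp_functor, of "(\<beta>, \<alpha>)"] assms
  by (simp_all add: src_hcomp tgt_hcomp)

lemma bhcomp_mor [simp]:
  assumes "\<psi> \<in> Mor (cells B)" "\<phi> \<in> Mor (cells B)"
    "bsrc B (Dom (cells B) \<psi>) = btgt B (Dom (cells B) \<phi>)"
  shows "\<psi> \<ast>\<^bsub>bhcomp B\<^esub> \<phi> \<in> Mor (cells B)"
    and "Dom (cells B) (\<psi> \<ast>\<^bsub>bhcomp B\<^esub> \<phi>) = Dom (cells B) \<psi> \<star>\<^bsub>bhcomp B\<^esub> Dom (cells B) \<phi>"
    and "Cod (cells B) (\<psi> \<ast>\<^bsub>bhcomp B\<^esub> \<phi>) = Cod (cells B) \<psi> \<star>\<^bsub>bhcomp B\<^esub> Cod (cells B) \<phi>"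
  using assms cat_functor.fun_mor[OF hcomp_functor, of "(\<psi>, \<phi>)"]
    cat_functor.fun_dom[OF hcomp_functor, of "(\<psi>, \<phi>)"]
    cat_functor.fun_cod[OF hcomp_functor, of "(\<psi>, \<phi>)"]
  by (simp_all add: bpairs_def bsrc_ftr_def btgt_ftr_def)

lemma bhcomp_idn [simp]:
  "\<lbrakk>\<beta> \<in> Ob (cells B); \<alpha> \<in> Ob (cells B); bsrc B \<beta> = btgt B \<alpha>\<rbrakk>
    \<Longrightarrow> Idn (cells B) \<beta> \<ast>\<^bsub>bhcomp B\<^esub> Idn (cells B) \<alpha> = Idn (cells B) (\<beta> \<star>\<^bsub>bhcomp B\<^esub> \<alpha>)"
  using cat_functor.fun_idn[OF hcomp_functor, of "(\<beta>, \<alpha>)"]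
  by (simp add: bpairs_def bsrc_ftr_def btgt_ftr_def)

lemma bassoc_simps [simp]:
  assumes "\<gamma> \<in> Ob (cells B)" "\<beta> \<in> Ob (cells B)" "\<alpha> \<in> Ob (cells B)"
    "bsrc B \<gamma> = btgt B \<beta>" "bsrc B \<beta> = btgt B \<alpha>"
  shows "bassoc B \<gamma> \<beta> \<alpha> \<in> Mor (cells B)"
    and "is_iso (cells B) (bassoc B \<gamma> \<beta> \<alpha>)"
    and "Dom (cells B) (bassoc B \<gamma> \<beta> \<alpha>) = (\<gamma> \<star>\<^bsub>bhcomp B\<^esub> \<beta>) \<star>\<^bsub>bhcomp B\<^esub> \<alpha>"
    and "Cod (cells B) (bassoc B \<gamma> \<beta> \<alpha>) = \<gamma> \<star>\<^bsub>bhcomp B\<^esub> (\<beta> \<star>\<^bsub>bhcomp B\<^esub> \<alpha>)"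
  using assms assoc_iso[of \<gamma> \<beta> \<alpha>] assoc_dom[of \<gamma> \<beta> \<alpha>] assoc_cod[of \<gamma> \<beta> \<alpha>] by simp_all

lemma blunit_simps [simp]:
  assumes "\<alpha> \<in> Ob (cells B)"
  shows "blunit B \<alpha> \<in> Mor (cells B)"
    and "is_iso (cells B) (blunit B \<alpha>)"
    and "Dom (cells B) (blunit B \<alpha>) = bunit B (btgt B \<alpha>) \<star>\<^bsub>bhcomp B\<^esub> \<alpha>"
    and "Cod (cells B) (blunit B \<alpha>) = \<alpha>"
  using assms lunit_iso lunit_dom lunit_cod by simp_all

lemma brunit_simps [simp]:
  assumes "\<alpha> \<in> Ob (cells B)"
  shows "brunit B \<alpha> \<in> Mor (cells B)"
    and "is_iso (cells B) (brunit B \<alpha>)"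
    and "Dom (cells B) (brunit B \<alpha>) = \<alpha> \<star>\<^bsub>bhcomp B\<^esub> bunit B (bsrc B \<alpha>)"
    and "Cod (cells B) (brunit B \<alpha>) = \<alpha>"
  using assms runit_iso runit_dom runit_cod by simp_all

end

section \<open>Decorated horizontalization\<close>

lemma horizontal_bicategory_simps [simp]:
  "cells0 (horizontal_bicategory D) = Ob (vert D)"
  "Ob (cells (horizontal_bicategory D)) = Ob (hsq D)"
  "Mor (cells (horizontal_bicategory D)) = globular D"
  "Dom (cells (horizontal_bicategory D)) = Dom (hsq D)"
  "Cod (cells (horizontal_bicategory D)) = Cod (hsq D)"
  "Idn (cells (horizontal_bicategory D)) = Idn (hsq D)"
  "Cmp (cells (horizontal_bicategory D)) = Cmp (hsq D)"
  "bsrc (horizontal_bicategory D) = FO (lft D)"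
  "btgt (horizontal_bicategory D) = FO (rgt D)"
  "bunit (horizontal_bicategory D) = FO (hid D)"
  "bhcomp (horizontal_bicategory D) = dhcomp D"
  "bassoc (horizontal_bicategory D) = dassoc D"
  "blunit (horizontal_bicategory D) = dlunit D"
  "brunit (horizontal_bicategory D) = drunit D"
  by (simp_all add: horizontal_bicategory_def)

lemma Hstar_simps [simp]:
  "und (Hstar D) = horizontal_bicategory D"
  "deco (Hstar D) = vert D"
  by (simp_all add: Hstar_def)

lemma horizontal_bpairs_Ob [simp]: "Ob (bpairs (horizontal_bicategory D)) = Ob (dpairs D)"
  by (auto simp: bpairs_def dpairs_def fibre_product_def bsrc_ftr_def btgt_ftr_def)

lemma is_iso_horizontalD:
  "is_iso (cells (horizontal_bicategory D)) \<Phi> \<Longrightarrow> is_iso (hsq D) \<Phi>"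
  by (auto simp: is_iso_def globular_def)

lemma is_iso_globular: "is_iso (cells (horizontal_bicategory D)) \<Phi> \<Longrightarrow> \<Phi> \<in> globular D"
  by (simp add: is_iso_def)

context double_category
begin

lemma is_iso_horizontal:
  "is_iso (cells (horizontal_bicategory D)) \<Phi> \<longleftrightarrow> is_iso (hsq D) \<Phi> \<and> \<Phi> \<in> globular D"
proof (intro iffI conjI)
  assume \<Phi>: "is_iso (hsq D) \<Phi> \<and> \<Phi> \<in> globular D"
  note c = L.src.cinv[of \<Phi>] globular_cinv[of \<Phi>]
  show "is_iso (cells (horizontal_bicategory D)) \<Phi>"
    unfolding is_iso_def[of "cells (horizontal_bicategory D)"] horizontal_bicategory_simps
    using \<Phi> c by blast
qed (rule is_iso_horizontalD is_iso_globular, assumption)+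

lemma category_horizontal: "category (cells (horizontal_bicategory D))"
  by unfold_locales (simp_all add: globularD(1) L.src.cmp_assoc)

lemma horizontal_bpairs_Mor [simp]:
  "(\<Psi>, \<Phi>) \<in> Mor (bpairs (horizontal_bicategory D)) \<longleftrightarrow> \<Psi> \<in> globular D \<and> \<Phi> \<in> globular D \<and>
     FO (lft D) (Dom (hsq D) \<Psi>) = FO (rgt D) (Dom (hsq D) \<Phi>)"
  by (simp add: bpairs_def bsrc_ftr_def btgt_ftr_def)

lemma horizontal_edge_functors:
  "cat_functor (cells (horizontal_bicategory D)) (discrete_cat (Ob (vert D)))
     (bsrc_ftr (horizontal_bicategory D))"
  "cat_functor (cells (horizontal_bicategory D)) (discrete_cat (Ob (vert D)))
     (btgt_ftr (horizontal_bicategory D))"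
  by (unfold cat_functor_def)
    (simp_all add: category_horizontal category_discrete,
     simp_all add: bsrc_ftr_def btgt_ftr_def discrete_cat_def globularD)

text \<open>The edges of \<open>\<phi>\<close> are identities, so the squares \<open>i_f\<close>
  occurring in the unitor naturality of \<open>D\<close> are identities of horizontal units, which
  is the form a bicategory requires.\<close>

lemma globular_unit_natural:
  assumes "\<phi> \<in> globular D"
  shows "dlunit D (Cod (hsq D) \<phi>) \<bullet>\<^bsub>D\<^esub>
        Idn (hsq D) (FO (hid D) (FO (rgt D) (Dom (hsq D) \<phi>))) \<otimes>\<^bsub>D\<^esub> \<phi>
      = \<phi> \<bullet>\<^bsub>D\<^esub> dlunit D (Dom (hsq D) \<phi>)"
    and "drunit D (Cod (hsq D) \<phi>) \<bullet>\<^bsub>D\<^esub>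
        \<phi> \<otimes>\<^bsub>D\<^esub> Idn (hsq D) (FO (hid D) (FO (lft D) (Dom (hsq D) \<phi>)))
      = \<phi> \<bullet>\<^bsub>D\<^esub> drunit D (Dom (hsq D) \<phi>)"
  using lunit_natural[of \<phi>] runit_natural[of \<phi>] globularD[OF assms] by simp_all

lemma bicategory_horizontal: "bicategory (horizontal_bicategory D)"
proof (intro bicategory.intro, goal_cases)
  \<comment> \<open>The sixth axiom is functoriality of horizontal composition. It needs the
    category of composable pairs, and \<open>globular_edge_eq\<close> to move between its two
    descriptions.\<close>
  case 6
  have "category (bpairs (horizontal_bicategory D))"
    unfolding bpairs_def by (rule category_fibre_product)
      (use horizontal_edge_functors in auto)
  moreover have "category (cells (horizontal_bicategory D))"
    by (rule category_horizontal)
  ultimately show ?case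
    by (unfold cat_functor_def)
      (auto simp: bpairs_def fibre_product_def bsrc_ftr_def btgt_ftr_def globularD globular_edge_eq
        interchange)
qed (simp_all add: horizontal_edge_functors is_iso_horizontal globularD globular_edge_eq
     assoc_natural pentagon triangle globular_unit_natural)

lemma decorated_bicategory_Hstar: "decorated_bicategory (Hstar D)"
  by (simp add: decorated_bicategory_def bicategory_horizontal L.target_category)

end

section \<open>Double functors: restriction to the horizontal bicategory, identities,
  composition\<close>

context double_functor
begin

sublocale A: double_category D by (rule source_double_category)
sublocale B: double_category D' by (rule target_double_category)
sublocale V: cat_functor "vert D" "vert D'" "D_vert F"
  using D_vert_functor by (simp add: ext_functor_def)
sublocale H: cat_functor "hsq D" "hsq D'" "D_hsq F"
  using D_hsq_functor by (simp add: ext_functor_def)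

lemma D_edges [simp]:
  "\<alpha> \<in> Ob (hsq D) \<Longrightarrow> FO (lft D') (FO (D_hsq F) \<alpha>) = FO (D_vert F) (FO (lft D) \<alpha>)"
  "\<Phi> \<in> Mor (hsq D) \<Longrightarrow> FM (lft D') (FM (D_hsq F) \<Phi>) = FM (D_vert F) (FM (lft D) \<Phi>)"
  "\<alpha> \<in> Ob (hsq D) \<Longrightarrow> FO (rgt D') (FO (D_hsq F) \<alpha>) = FO (D_vert F) (FO (rgt D) \<alpha>)"
  "\<Phi> \<in> Mor (hsq D) \<Longrightarrow> FM (rgt D') (FM (D_hsq F) \<Phi>) = FM (D_vert F) (FM (rgt D) \<Phi>)"
  by (simp_all add: lft_ob lft_mor rgt_ob rgt_mor)

lemma Dcmp_simps [simp]:
  assumes "\<beta> \<in> Ob (hsq D)" "\<alpha> \<in> Ob (hsq D)" "FO (lft D) \<beta> = FO (rgt D) \<alpha>"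
  shows "Dcmp F (\<beta>, \<alpha>) \<in> globular D'"
    and "Dcmp F (\<beta>, \<alpha>) \<in> Mor (hsq D')"
    and "is_iso (hsq D') (Dcmp F (\<beta>, \<alpha>))"
    and "Dom (hsq D') (Dcmp F (\<beta>, \<alpha>)) = FO (D_hsq F) \<beta> \<odot>\<^bsub>D'\<^esub> FO (D_hsq F) \<alpha>"
    and "Cod (hsq D') (Dcmp F (\<beta>, \<alpha>)) = FO (D_hsq F) (\<beta> \<odot>\<^bsub>D\<^esub> \<alpha>)"
    and "FM (lft D') (Dcmp F (\<beta>, \<alpha>)) = Idn (vert D') (FO (D_vert F) (FO (lft D) \<alpha>))"
    and "FM (rgt D') (Dcmp F (\<beta>, \<alpha>)) = Idn (vert D') (FO (D_vert F) (FO (rgt D) \<beta>))"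
  using assms Dcmp_globular Dcmp_iso Dcmp_dom Dcmp_cod B.globularD[of "Dcmp F (\<beta>, \<alpha>)"]
  by simp_all

lemma Dunit_simps [simp]:
  assumes "a \<in> Ob (vert D)"
  shows "Dunit F a \<in> globular D'"
    and "Dunit F a \<in> Mor (hsq D')"
    and "is_iso (hsq D') (Dunit F a)"
    and "Dom (hsq D') (Dunit F a) = FO (hid D') (FO (D_vert F) a)"
    and "Cod (hsq D') (Dunit F a) = FO (D_hsq F) (FO (hid D) a)"
    and "FM (lft D') (Dunit F a) = Idn (vert D') (FO (D_vert F) a)"
    and "FM (rgt D') (Dunit F a) = Idn (vert D') (FO (D_vert F) a)"
  using assms Dunit_globular Dunit_iso Dunit_dom Dunit_cod B.globularD[of "Dunit F a"]
  by simp_all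

lemma D_globular [simp]: "\<Phi> \<in> globular D \<Longrightarrow> FM (D_hsq F) \<Phi> \<in> globular D'"
  using A.globularD[of \<Phi>]
  by (intro B.globularI[where a = "FO (D_vert F) (FO (lft D) (Dom (hsq D) \<Phi>))"
      and b = "FO (D_vert F) (FO (rgt D) (Dom (hsq D) \<Phi>))"]) simp_all

lemma decorated_pseudofunctor_Hstar_map:
  "decorated_pseudofunctor (Hstar D) (Hstar D') (Hstar_map D F)"
proof -
  have "pseudofunctor (horizontal_bicategory D) (horizontal_bicategory D') (psf_part (Hstar_map D F))"
  proof (intro pseudofunctor.intro, goal_cases)
    case 4
    show ?case
      using D_hsq_functor
      by (auto simp: ext_functor_def Hstar_map_def cat_functor_def A.category_horizontal
          B.category_horizontal A.globularD)
  qed (use D_vert_functor in \<open>simp_all add: Hstar_map_def A.bicategory_horizontal B.bicategory_horizontal B.is_iso_horizontal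
      A.globularD A.globular_edge_eq Dcmp_natural D_assoc D_lunit D_runit D_extensional ext_functor_def\<close>)
  then show ?thesis
    using D_vert_functor
    by (simp add: decorated_pseudofunctor_def A.decorated_bicategory_Hstar
        B.decorated_bicategory_Hstar) (simp add: Hstar_map_def)
qed

end

lemma globular_Mor: "\<Phi> \<in> globular D \<Longrightarrow> \<Phi> \<in> Mor (hsq D)"
  by (simp add: globular_def)

lemma Hstar_map_id: "double_category D \<Longrightarrow> Hstar_map D (id_dftr D) = id_dpsf (Hstar D)"
proof -
  assume "double_category D"
  then interpret double_category D .
  show ?thesis
    by (auto simp: Hstar_map_def id_dftr_def id_dpsf_def id_psf_def id_ftr_def restrict_def
      fun_eq_iff globular_Mor)
qed

text \<open>Restriction commutes with composition because double functors preserve globular squares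
  and have globular comparison squares, so the outer functor is never evaluated at a junk
  value.\<close>

lemma Hstar_map_comp:
  assumes "double_functor D D' F" "double_functor D' D'' F'"
  shows "Hstar_map D (comp_dftr D D'' F' F)
     = comp_dpsf (Hstar D) (Hstar D'') (Hstar_map D' F') (Hstar_map D F)"
proof -
  interpret F: double_functor D D' F by fact
  interpret F': double_functor D' D'' F' by fact
  show ?thesis
    by (auto simp: Hstar_map_def comp_dftr_def comp_dpsf_def comp_psf_def comp_ftr_def
      restrict_def compose_def fun_eq_iff globular_Mor)
qed

lemma double_functor_id:
  assumes "double_category D"
  shows "double_functor D D (id_dftr D)"
proof -
  interpret double_category D by fact
  show ?thesis
    by (intro double_functor.intro)
      (simp_all add: assms id_dftr_def ext_functor_id L.source_category L.target_category,
       simp_all add: id_ftr_def edge_ends)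
qed

text \<open>The comparison squares of the composite are those of \<open>F\<close> pushed through
  \<open>G\<close>, followed vertically after those of \<open>G\<close>. Each coherence equation is
  the one for \<open>F\<close> under \<open>G\<close> pasted to the one for \<open>G\<close> at
  images under \<open>F\<close>; naturality of the comparison squares of \<open>G\<close> makes the
  two meet.\<close>

lemma double_functor_comp:
  assumes "double_functor D D' F" "double_functor D' D'' G"
  shows "double_functor D D'' (comp_dftr D D'' G F)"
proof -
  interpret F: double_functor D D' F by fact
  interpret G: double_functor D' D'' G by fact
  note [simp] = F.B.L.src.cmp_assoc G.B.L.src.cmp_assoc
  have dfs: "D_vert (comp_dftr D D'' G F) = comp_ftr (vert D) (D_vert G) (D_vert F)"
    "D_hsq (comp_dftr D D'' G F) = comp_ftr (hsq D) (D_hsq G) (D_hsq F)"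
    by (simp_all add: comp_dftr_def)
  have cmp: "Dcmp (comp_dftr D D'' G F) (\<beta>, \<alpha>)
      = FM (D_hsq G) (Dcmp F (\<beta>, \<alpha>)) \<bullet>\<^bsub>D''\<^esub> Dcmp G (FO (D_hsq F) \<beta>, FO (D_hsq F) \<alpha>)"
    if "\<beta> \<in> Ob (hsq D)" "\<alpha> \<in> Ob (hsq D)" "FO (lft D) \<beta> = FO (rgt D) \<alpha>" for \<beta> \<alpha>
    using that by (simp add: comp_dftr_def)
  have unit: "Dunit (comp_dftr D D'' G F) a = FM (D_hsq G) (Dunit F a) \<bullet>\<^bsub>D''\<^esub> Dunit G (FO (D_vert F) a)"
    if "a \<in> Ob (vert D)" for a
    using that by (simp add: comp_dftr_def)
  have ext: "Dcmp (comp_dftr D D'' G F) \<in> extensional (Ob (dpairs D))"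
    "Dunit (comp_dftr D D'' G F) \<in> extensional (Ob (vert D))"
    by (simp_all add: comp_dftr_def)
  have ftr: "FO (comp_ftr C K J) a = FO K (FO J a)" if "a \<in> Ob C"
      for C :: "('x, 'y) cat" and K :: "('x1, 'y1, 'x2, 'y2) ftr" and J a
    using that by (simp add: comp_ftr_def compose_eq)
  have ftm: "FM (comp_ftr C K J) f = FM K (FM J f)" if "f \<in> Mor C"
      for C :: "('x, 'y) cat" and K :: "('x1, 'y1, 'x2, 'y2) ftr" and J f
    using that by (simp add: comp_ftr_def compose_eq)
  show ?thesis
  proof (intro double_functor.intro, goal_cases)
    \<comment> \<open>Naturality of horizontal comparison: the naturality square of
      \<open>F\<close>, mapped by \<open>G\<close>, is stacked on that of \<open>G\<close> at the
      images of \<open>\<Psi>\<close> and \<open>\<Phi>\<close>.\<close>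
    case (13 \<Psi> \<Phi>)
    then have m: "\<Psi> \<in> Mor (hsq D)" "\<Phi> \<in> Mor (hsq D)" "FM (lft D) \<Psi> = FM (rgt D) \<Phi>"
      by simp_all
    note e = F.A.edge_ends[OF m]
    let ?F = "FM (D_hsq F)" and ?G = "FM (D_hsq G)"
    let ?c = "Dcmp F (Dom (hsq D) \<Psi>, Dom (hsq D) \<Phi>)" and ?d = "Dcmp F (Cod (hsq D) \<Psi>, Cod (hsq D) \<Phi>)"
    let ?c' = "Dcmp G (Dom (hsq D') (?F \<Psi>), Dom (hsq D') (?F \<Phi>))"
    let ?d' = "Dcmp G (Cod (hsq D') (?F \<Psi>), Cod (hsq D') (?F \<Phi>))"
    have "?G (?F (\<Psi> \<otimes>\<^bsub>D\<^esub> \<Phi>)) \<bullet>\<^bsub>D''\<^esub> ?G ?c \<bullet>\<^bsub>D''\<^esub> ?c' = ?G (?F (\<Psi> \<otimes>\<^bsub>D\<^esub> \<Phi>) \<bullet>\<^bsub>D'\<^esub> ?c) \<bullet>\<^bsub>D''\<^esub> ?c'"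
      using m e by simp
    also have "\<dots> = ?G (?d \<bullet>\<^bsub>D'\<^esub> (?F \<Psi> \<otimes>\<^bsub>D'\<^esub> ?F \<Phi>)) \<bullet>\<^bsub>D''\<^esub> ?c'"
      using F.Dcmp_natural[of \<Psi> \<Phi>] 13 by simp
    also have "\<dots> = ?G ?d \<bullet>\<^bsub>D''\<^esub> (?G (?F \<Psi> \<otimes>\<^bsub>D'\<^esub> ?F \<Phi>) \<bullet>\<^bsub>D''\<^esub> ?c')"
      using m e by simp
    also have "\<dots> = ?G ?d \<bullet>\<^bsub>D''\<^esub> (?d' \<bullet>\<^bsub>D''\<^esub> (?G (?F \<Psi>) \<otimes>\<^bsub>D''\<^esub> ?G (?F \<Phi>)))"
      using G.Dcmp_natural[of "?F \<Psi>" "?F \<Phi>"] m by simp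
    finally show ?case
      using m e by (simp add: dfs cmp ftr ftm)
  next
    case (18 f)
    let ?F = "FM (D_hsq F)" and ?G = "FM (D_hsq G)" and ?f = "FM (D_vert F) f"
    let ?u = "Dunit F (Dom (vert D) f)" and ?v = "Dunit F (Cod (vert D) f)"
    let ?u' = "Dunit G (Dom (vert D') ?f)" and ?v' = "Dunit G (Cod (vert D') ?f)"
    have "?G (?F (FM (hid D) f)) \<bullet>\<^bsub>D''\<^esub> ?G ?u \<bullet>\<^bsub>D''\<^esub> ?u' = ?G (?F (FM (hid D) f) \<bullet>\<^bsub>D'\<^esub> ?u) \<bullet>\<^bsub>D''\<^esub> ?u'"
      using 18 by simp
    also have "\<dots> = ?G (?v \<bullet>\<^bsub>D'\<^esub> FM (hid D') ?f) \<bullet>\<^bsub>D''\<^esub> ?u'"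
      using F.Dunit_natural[of f] 18 by simp
    also have "\<dots> = ?G ?v \<bullet>\<^bsub>D''\<^esub> ?G (FM (hid D') ?f) \<bullet>\<^bsub>D''\<^esub> ?u'"
      using 18 by simp
    also have "\<dots> = ?G ?v \<bullet>\<^bsub>D''\<^esub> ?v' \<bullet>\<^bsub>D''\<^esub> FM (hid D'') (FM (D_vert G) ?f)"
      using G.Dunit_natural[of ?f] 18 by simp
    finally show ?case
      using 18 by (simp add: dfs unit ftr ftm)
  next
    \<comment> \<open>Compatibility with associators. Interchange splits the whiskered comparisons
      (\<open>split1\<close>, \<open>split2\<close>); naturality of the comparison of
      \<open>G\<close> against an identity (\<open>n1\<close>, \<open>n2\<close>) then collects
      first the hexagon of \<open>F\<close> and afterwards that of \<open>G\<close>.\<close>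
    case (19 \<gamma> \<beta> \<alpha>)
    then have m: "\<gamma> \<in> Ob (hsq D)" "\<beta> \<in> Ob (hsq D)" "\<alpha> \<in> Ob (hsq D)"
      "FO (lft D) \<gamma> = FO (rgt D) \<beta>" "FO (lft D) \<beta> = FO (rgt D) \<alpha>"
      by simp_all
    let ?F = "FO (D_hsq F)" and ?G = "FO (D_hsq G)" and ?FM = "FM (D_hsq F)" and ?GM = "FM (D_hsq G)"
    let ?iF = "\<lambda>\<alpha>. Idn (hsq D') (?F \<alpha>)" and ?iG = "\<lambda>\<alpha>. Idn (hsq D'') (?G (?F \<alpha>))"
    let ?a = "?FM (dassoc D \<gamma> \<beta> \<alpha>)"
    let ?a' = "dassoc D' (?F \<gamma>) (?F \<beta>) (?F \<alpha>)"
    let ?a'' = "dassoc D'' (?G (?F \<gamma>)) (?G (?F \<beta>)) (?G (?F \<alpha>))"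
    let ?c1 = "Dcmp F (\<gamma> \<odot>\<^bsub>D\<^esub> \<beta>, \<alpha>)" and ?c2 = "Dcmp F (\<gamma>, \<beta>)"
      and ?c3 = "Dcmp F (\<gamma>, \<beta> \<odot>\<^bsub>D\<^esub> \<alpha>)" and ?c4 = "Dcmp F (\<beta>, \<alpha>)"
    let ?d1 = "Dcmp G (?F \<gamma> \<odot>\<^bsub>D'\<^esub> ?F \<beta>, ?F \<alpha>)" and ?d2 = "Dcmp G (?F \<gamma>, ?F \<beta>)"
      and ?d3 = "Dcmp G (?F \<gamma>, ?F \<beta> \<odot>\<^bsub>D'\<^esub> ?F \<alpha>)" and ?d4 = "Dcmp G (?F \<beta>, ?F \<alpha>)"
    let ?e1 = "Dcmp G (?F (\<gamma> \<odot>\<^bsub>D\<^esub> \<beta>), ?F \<alpha>)" and ?e3 = "Dcmp G (?F \<gamma>, ?F (\<beta> \<odot>\<^bsub>D\<^esub> \<alpha>))"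
    have split1: "(?GM ?c2 \<bullet>\<^bsub>D''\<^esub> ?d2) \<otimes>\<^bsub>D''\<^esub> ?iG \<alpha>
        = (?GM ?c2 \<otimes>\<^bsub>D''\<^esub> ?iG \<alpha>) \<bullet>\<^bsub>D''\<^esub> (?d2 \<otimes>\<^bsub>D''\<^esub> ?iG \<alpha>)"
      using m by (subst G.B.interchange) simp_all
    have split2: "?iG \<gamma> \<otimes>\<^bsub>D''\<^esub> (?GM ?c4 \<bullet>\<^bsub>D''\<^esub> ?d4)
        = (?iG \<gamma> \<otimes>\<^bsub>D''\<^esub> ?GM ?c4) \<bullet>\<^bsub>D''\<^esub> (?iG \<gamma> \<otimes>\<^bsub>D''\<^esub> ?d4)"
      using m by (subst G.B.interchange) simp_all
    have n1: "?e1 \<bullet>\<^bsub>D''\<^esub> (?GM ?c2 \<otimes>\<^bsub>D''\<^esub> ?iG \<alpha>) = ?GM (?c2 \<otimes>\<^bsub>D'\<^esub> ?iF \<alpha>) \<bullet>\<^bsub>D''\<^esub> ?d1"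
      using G.Dcmp_natural[of ?c2 "?iF \<alpha>"] m by simp
    have n2: "?GM (?iF \<gamma> \<otimes>\<^bsub>D'\<^esub> ?c4) \<bullet>\<^bsub>D''\<^esub> ?d3 = ?e3 \<bullet>\<^bsub>D''\<^esub> (?iG \<gamma> \<otimes>\<^bsub>D''\<^esub> ?GM ?c4)"
      using G.Dcmp_natural[of "?iF \<gamma>" ?c4] m by simp
    have "?GM ?a \<bullet>\<^bsub>D''\<^esub> (?GM ?c1 \<bullet>\<^bsub>D''\<^esub> ?e1) \<bullet>\<^bsub>D''\<^esub> ((?GM ?c2 \<bullet>\<^bsub>D''\<^esub> ?d2) \<otimes>\<^bsub>D''\<^esub> ?iG \<alpha>)
        = ?GM ?a \<bullet>\<^bsub>D''\<^esub> ?GM ?c1 \<bullet>\<^bsub>D''\<^esub> (?e1 \<bullet>\<^bsub>D''\<^esub> (?GM ?c2 \<otimes>\<^bsub>D''\<^esub> ?iG \<alpha>)) \<bullet>\<^bsub>D''\<^esub> (?d2 \<otimes>\<^bsub>D''\<^esub> ?iG \<alpha>)"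
      using m by (subst split1) simp
    also have "\<dots> = ?GM (?a \<bullet>\<^bsub>D'\<^esub> ?c1 \<bullet>\<^bsub>D'\<^esub> (?c2 \<otimes>\<^bsub>D'\<^esub> ?iF \<alpha>)) \<bullet>\<^bsub>D''\<^esub> ?d1 \<bullet>\<^bsub>D''\<^esub> (?d2 \<otimes>\<^bsub>D''\<^esub> ?iG \<alpha>)"
      using m by (subst n1) simp
    also have "\<dots> = ?GM (?c3 \<bullet>\<^bsub>D'\<^esub> (?iF \<gamma> \<otimes>\<^bsub>D'\<^esub> ?c4) \<bullet>\<^bsub>D'\<^esub> ?a') \<bullet>\<^bsub>D''\<^esub> ?d1 \<bullet>\<^bsub>D''\<^esub> (?d2 \<otimes>\<^bsub>D''\<^esub> ?iG \<alpha>)"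
      using F.D_assoc[of \<gamma> \<beta> \<alpha>] 19 by simp
    also have "\<dots> = ?GM ?c3 \<bullet>\<^bsub>D''\<^esub> ?GM (?iF \<gamma> \<otimes>\<^bsub>D'\<^esub> ?c4) \<bullet>\<^bsub>D''\<^esub> (?GM ?a' \<bullet>\<^bsub>D''\<^esub> ?d1 \<bullet>\<^bsub>D''\<^esub> (?d2 \<otimes>\<^bsub>D''\<^esub> ?iG \<alpha>))"
      using m by simp
    also have "\<dots> = ?GM ?c3 \<bullet>\<^bsub>D''\<^esub> ?GM (?iF \<gamma> \<otimes>\<^bsub>D'\<^esub> ?c4) \<bullet>\<^bsub>D''\<^esub> (?d3 \<bullet>\<^bsub>D''\<^esub> (?iG \<gamma> \<otimes>\<^bsub>D''\<^esub> ?d4) \<bullet>\<^bsub>D''\<^esub> ?a'')"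
      using G.D_assoc[of "?F \<gamma>" "?F \<beta>" "?F \<alpha>"] m by simp
    also have "\<dots> = ?GM ?c3 \<bullet>\<^bsub>D''\<^esub> (?GM (?iF \<gamma> \<otimes>\<^bsub>D'\<^esub> ?c4) \<bullet>\<^bsub>D''\<^esub> ?d3) \<bullet>\<^bsub>D''\<^esub> (?iG \<gamma> \<otimes>\<^bsub>D''\<^esub> ?d4) \<bullet>\<^bsub>D''\<^esub> ?a''"
      using m by simp
    also have "\<dots> = (?GM ?c3 \<bullet>\<^bsub>D''\<^esub> ?e3) \<bullet>\<^bsub>D''\<^esub> ((?iG \<gamma> \<otimes>\<^bsub>D''\<^esub> ?GM ?c4) \<bullet>\<^bsub>D''\<^esub> (?iG \<gamma> \<otimes>\<^bsub>D''\<^esub> ?d4)) \<bullet>\<^bsub>D''\<^esub> ?a''"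
      using m by (subst n2) simp
    also have "\<dots> = (?GM ?c3 \<bullet>\<^bsub>D''\<^esub> ?e3) \<bullet>\<^bsub>D''\<^esub> (?iG \<gamma> \<otimes>\<^bsub>D''\<^esub> (?GM ?c4 \<bullet>\<^bsub>D''\<^esub> ?d4)) \<bullet>\<^bsub>D''\<^esub> ?a''"
      by (subst split2) simp
    finally show ?case
      using m by (simp add: dfs cmp ftr ftm)
  next
    \<comment> \<open>Left unitors follow the same pattern, with one whiskered unit comparison to
      split and one naturality step.\<close>
    case (20 \<alpha>)
    let ?F = "FO (D_hsq F)" and ?G = "FO (D_hsq G)" and ?FM = "FM (D_hsq F)" and ?GM = "FM (D_hsq G)"
    let ?b = "FO (rgt D) \<alpha>"
    let ?u = "Dunit F ?b" and ?u' = "Dunit G (FO (D_vert F) ?b)"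
    let ?c = "Dcmp F (FO (hid D) ?b, \<alpha>)" and ?e = "Dcmp G (?F (FO (hid D) ?b), ?F \<alpha>)"
      and ?d = "Dcmp G (FO (hid D') (FO (D_vert F) ?b), ?F \<alpha>)"
    let ?i = "Idn (hsq D') (?F \<alpha>)" and ?i' = "Idn (hsq D'') (?G (?F \<alpha>))"
    have split: "(?GM ?u \<bullet>\<^bsub>D''\<^esub> ?u') \<otimes>\<^bsub>D''\<^esub> ?i' = (?GM ?u \<otimes>\<^bsub>D''\<^esub> ?i') \<bullet>\<^bsub>D''\<^esub> (?u' \<otimes>\<^bsub>D''\<^esub> ?i')"
      using 20 by (subst G.B.interchange) simp_all
    have n: "?e \<bullet>\<^bsub>D''\<^esub> (?GM ?u \<otimes>\<^bsub>D''\<^esub> ?i') = ?GM (?u \<otimes>\<^bsub>D'\<^esub> ?i) \<bullet>\<^bsub>D''\<^esub> ?d"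
      using G.Dcmp_natural[of ?u ?i] 20 by simp
    have "?GM (?FM (dlunit D \<alpha>)) \<bullet>\<^bsub>D''\<^esub> (?GM ?c \<bullet>\<^bsub>D''\<^esub> ?e) \<bullet>\<^bsub>D''\<^esub> ((?GM ?u \<bullet>\<^bsub>D''\<^esub> ?u') \<otimes>\<^bsub>D''\<^esub> ?i')
        = ?GM (?FM (dlunit D \<alpha>)) \<bullet>\<^bsub>D''\<^esub> ?GM ?c \<bullet>\<^bsub>D''\<^esub> (?e \<bullet>\<^bsub>D''\<^esub> (?GM ?u \<otimes>\<^bsub>D''\<^esub> ?i')) \<bullet>\<^bsub>D''\<^esub> (?u' \<otimes>\<^bsub>D''\<^esub> ?i')"
      using 20 by (subst split) simp
    also have "\<dots> = ?GM (?FM (dlunit D \<alpha>) \<bullet>\<^bsub>D'\<^esub> ?c \<bullet>\<^bsub>D'\<^esub> (?u \<otimes>\<^bsub>D'\<^esub> ?i)) \<bullet>\<^bsub>D''\<^esub> ?d \<bullet>\<^bsub>D''\<^esub> (?u' \<otimes>\<^bsub>D''\<^esub> ?i')"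
      using 20 by (subst n) simp
    also have "\<dots> = dlunit D'' (?G (?F \<alpha>))"
      using F.D_lunit[of \<alpha>] G.D_lunit[of "?F \<alpha>"] 20 by simp
    finally show ?case
      using 20 by (simp add: dfs cmp unit ftr ftm)
  next
    case (21 \<alpha>)
    let ?F = "FO (D_hsq F)" and ?G = "FO (D_hsq G)" and ?FM = "FM (D_hsq F)" and ?GM = "FM (D_hsq G)"
    let ?b = "FO (lft D) \<alpha>"
    let ?u = "Dunit F ?b" and ?u' = "Dunit G (FO (D_vert F) ?b)"
    let ?c = "Dcmp F (\<alpha>, FO (hid D) ?b)" and ?e = "Dcmp G (?F \<alpha>, ?F (FO (hid D) ?b))"
      and ?d = "Dcmp G (?F \<alpha>, FO (hid D') (FO (D_vert F) ?b))"
    let ?i = "Idn (hsq D') (?F \<alpha>)" and ?i' = "Idn (hsq D'') (?G (?F \<alpha>))"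
    have split: "?i' \<otimes>\<^bsub>D''\<^esub> (?GM ?u \<bullet>\<^bsub>D''\<^esub> ?u') = (?i' \<otimes>\<^bsub>D''\<^esub> ?GM ?u) \<bullet>\<^bsub>D''\<^esub> (?i' \<otimes>\<^bsub>D''\<^esub> ?u')"
      using 21 by (subst G.B.interchange) simp_all
    have n: "?e \<bullet>\<^bsub>D''\<^esub> (?i' \<otimes>\<^bsub>D''\<^esub> ?GM ?u) = ?GM (?i \<otimes>\<^bsub>D'\<^esub> ?u) \<bullet>\<^bsub>D''\<^esub> ?d"
      using G.Dcmp_natural[of ?i ?u] 21 by simp
    have "?GM (?FM (drunit D \<alpha>)) \<bullet>\<^bsub>D''\<^esub> (?GM ?c \<bullet>\<^bsub>D''\<^esub> ?e) \<bullet>\<^bsub>D''\<^esub> (?i' \<otimes>\<^bsub>D''\<^esub> (?GM ?u \<bullet>\<^bsub>D''\<^esub> ?u'))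
        = ?GM (?FM (drunit D \<alpha>)) \<bullet>\<^bsub>D''\<^esub> ?GM ?c \<bullet>\<^bsub>D''\<^esub> (?e \<bullet>\<^bsub>D''\<^esub> (?i' \<otimes>\<^bsub>D''\<^esub> ?GM ?u)) \<bullet>\<^bsub>D''\<^esub> (?i' \<otimes>\<^bsub>D''\<^esub> ?u')"
      using 21 by (subst split) simp
    also have "\<dots> = ?GM (?FM (drunit D \<alpha>) \<bullet>\<^bsub>D'\<^esub> ?c \<bullet>\<^bsub>D'\<^esub> (?i \<otimes>\<^bsub>D'\<^esub> ?u)) \<bullet>\<^bsub>D''\<^esub> ?d \<bullet>\<^bsub>D''\<^esub> (?i' \<otimes>\<^bsub>D''\<^esub> ?u')"
      using 21 by (subst n) simp
    also have "\<dots> = drunit D'' (?G (?F \<alpha>))"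
      using F.D_runit[of \<alpha>] G.D_runit[of "?F \<alpha>"] 21 by simp
    finally show ?case
      using 21 by (simp add: dfs cmp unit ftr ftm)
  qed (simp_all add: dfs cmp unit ext F.source_double_category G.target_double_category
      ext_functor_comp[OF F.D_vert_functor G.D_vert_functor]
      ext_functor_comp[OF F.D_hsq_functor G.D_hsq_functor] ftr ftm F.A.edge_ends G.B.L.src.iso_cmp)
qed

section \<open>The free globularly generated double category\<close>

lemma decorated_bicategoryD:
  assumes "decorated_bicategory B"
  shows "bicategory (und B)" "category (deco B)" "Ob (deco B) = cells0 (und B)"
  using assms by (simp_all add: decorated_bicategory_def)

locale decorated =
  fixes B :: "('o, 'v, 'h, 'c) dbicat"
  assumes decorated: "decorated_bicategory B"
begin

sublocale U: bicategory "und B" by (rule decorated_bicategoryD(1)[OF decorated])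
sublocale V: category "deco B" by (rule decorated_bicategoryD(2)[OF decorated])

lemma Ob_deco [simp]: "Ob (deco B) = cells0 (und B)"
  by (rule decorated_bicategoryD(3)[OF decorated])

lemma deco_simps [simp]:
  "a \<in> cells0 (und B) \<Longrightarrow> Idn (deco B) a \<in> Mor (deco B)"
  "a \<in> cells0 (und B) \<Longrightarrow> Dom (deco B) (Idn (deco B) a) = a"
  "a \<in> cells0 (und B) \<Longrightarrow> Cod (deco B) (Idn (deco B) a) = a"
  "f \<in> Mor (deco B) \<Longrightarrow> Dom (deco B) f \<in> cells0 (und B)"
  "f \<in> Mor (deco B) \<Longrightarrow> Cod (deco B) f \<in> cells0 (und B)"
  using V.idn_mor V.dom_idn V.cod_idn V.dom_ob V.cod_ob by simp_all

text \<open>All clauses are proved together: \<open>fwf\<close> only matches vertical edges at an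
  \<open>HComp\<close> node, and the domains and codomains of those edges are what shows that the
  tops and bottoms compose as 1-cells.\<close>

lemma fwf_boundary [simp]:
  assumes "fwf B \<Phi>"
  shows "ftop B \<Phi> \<in> Ob (cells (und B))" "fbot B \<Phi> \<in> Ob (cells (und B))"
    "flft B \<Phi> \<in> Mor (deco B)" "frgt B \<Phi> \<in> Mor (deco B)"
    "Dom (deco B) (flft B \<Phi>) = bsrc (und B) (ftop B \<Phi>)"
    "Cod (deco B) (flft B \<Phi>) = bsrc (und B) (fbot B \<Phi>)"
    "Dom (deco B) (frgt B \<Phi>) = btgt (und B) (ftop B \<Phi>)"
    "Cod (deco B) (frgt B \<Phi>) = btgt (und B) (fbot B \<Phi>)"
proof -
  have "ftop B \<Phi> \<in> Ob (cells (und B)) \<and> fbot B \<Phi> \<in> Ob (cells (und B)) \<and>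
    flft B \<Phi> \<in> Mor (deco B) \<and> frgt B \<Phi> \<in> Mor (deco B) \<and>
    Dom (deco B) (flft B \<Phi>) = bsrc (und B) (ftop B \<Phi>) \<and>
    Cod (deco B) (flft B \<Phi>) = bsrc (und B) (fbot B \<Phi>) \<and>
    Dom (deco B) (frgt B \<Phi>) = btgt (und B) (ftop B \<Phi>) \<and>
    Cod (deco B) (frgt B \<Phi>) = btgt (und B) (fbot B \<Phi>)"
    using assms
  proof (induction \<Phi>)
    case (HComp \<Psi> \<Phi>)
    then have e: "frgt B \<Phi> = flft B \<Psi>" by simp
    have "bsrc (und B) (ftop B \<Psi>) = btgt (und B) (ftop B \<Phi>)"
      "bsrc (und B) (fbot B \<Psi>) = btgt (und B) (fbot B \<Phi>)"
      using HComp arg_cong[OF e, of "Dom (deco B)"] arg_cong[OF e, of "Cod (deco B)"] by simp_all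
    then show ?case
      using HComp by simp
  qed simp_all
  then show "ftop B \<Phi> \<in> Ob (cells (und B))" "fbot B \<Phi> \<in> Ob (cells (und B))"
    "flft B \<Phi> \<in> Mor (deco B)" "frgt B \<Phi> \<in> Mor (deco B)"
    "Dom (deco B) (flft B \<Phi>) = bsrc (und B) (ftop B \<Phi>)"
    "Cod (deco B) (flft B \<Phi>) = bsrc (und B) (fbot B \<Phi>)"
    "Dom (deco B) (frgt B \<Phi>) = btgt (und B) (ftop B \<Phi>)"
    "Cod (deco B) (frgt B \<Phi>) = btgt (und B) (fbot B \<Phi>)"
    by simp_all
qed

lemma edge_ends:
  assumes "fwf B \<Psi>" "fwf B \<Phi>" "frgt B \<Phi> = flft B \<Psi>"
  shows "bsrc (und B) (ftop B \<Psi>) = btgt (und B) (ftop B \<Phi>)"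
    "bsrc (und B) (fbot B \<Psi>) = btgt (und B) (fbot B \<Phi>)"
  using fwf_boundary(5,6)[OF assms(1)] fwf_boundary(7,8)[OF assms(2)] assms(3) by simp_all

lemma cell_ends:
  assumes "\<phi> \<in> Mor (cells (und B))" "\<psi> \<in> Mor (cells (und B))"
    "Cod (cells (und B)) \<phi> = Dom (cells (und B)) \<psi>"
  shows "bsrc (und B) (Dom (cells (und B)) \<phi>) = bsrc (und B) (Dom (cells (und B)) \<psi>)"
    "btgt (und B) (Dom (cells (und B)) \<phi>) = btgt (und B) (Dom (cells (und B)) \<psi>)"
  using U.bsrc_simps(2,4)[OF assms(1)] assms(3) by simp_all

text \<open>Makes the boundary of a class meaningful: the representative chosen by
  \<open>frep\<close> has the same top, bottom and edges as any other member.\<close>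

lemma feq_boundary:
  assumes "feq B \<Phi> \<Psi>"
  shows "fwf B \<Phi>" "fwf B \<Psi>" "ftop B \<Phi> = ftop B \<Psi>" "fbot B \<Phi> = fbot B \<Psi>"
    "flft B \<Phi> = flft B \<Psi>" "frgt B \<Phi> = frgt B \<Psi>"
proof -
  have "fwf B \<Phi> \<and> fwf B \<Psi> \<and> ftop B \<Phi> = ftop B \<Psi> \<and> fbot B \<Phi> = fbot B \<Psi> \<and>
    flft B \<Phi> = flft B \<Psi> \<and> frgt B \<Phi> = frgt B \<Psi>"
    using assms by induction (simp_all add: edge_ends cell_ends V.cmp_assoc)
  then show "fwf B \<Phi>" "fwf B \<Psi>" "ftop B \<Phi> = ftop B \<Psi>" "fbot B \<Phi> = fbot B \<Psi>"
    "flft B \<Phi> = flft B \<Psi>" "frgt B \<Phi> = frgt B \<Psi>"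
    by simp_all
qed

lemma fclass_eqI:
  assumes "feq B \<Phi> \<Psi>" shows "fclass B \<Phi> = fclass B \<Psi>"
  using assms unfolding fclass_def by (blast intro: feq_sym feq_trans)

lemma feq_frep:
  assumes "fwf B \<Phi>" shows "feq B \<Phi> (frep (fclass B \<Phi>))"
  using someI[of "\<lambda>\<Psi>. \<Psi> \<in> fclass B \<Phi>", OF CollectI[of "feq B \<Phi>", OF feq_refl[OF assms], folded fclass_def]]
  by (simp add: frep_def fclass_def)

lemma Q_simps [simp]:
  "vert (Q B) = deco B"
  "Ob (hsq (Q B)) = Ob (cells (und B))"
  "Mor (hsq (Q B)) = fclass B ` {\<Phi>. fwf B \<Phi>}"
  "Idn (hsq (Q B)) \<alpha> = fclass B (Cell (Idn (cells (und B)) \<alpha>))"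
  "FO (lft (Q B)) = bsrc (und B)"
  "FO (rgt (Q B)) = btgt (und B)"
  "FO (hid (Q B)) = bunit (und B)"
  "FM (hid (Q B)) f = fclass B (HId f)"
  "FO (dhcomp (Q B)) = FO (bhcomp (und B))"
  "dassoc (Q B) \<gamma> \<beta> \<alpha> = fclass B (Cell (bassoc (und B) \<gamma> \<beta> \<alpha>))"
  "dlunit (Q B) \<alpha> = fclass B (Cell (blunit (und B) \<alpha>))"
  "drunit (Q B) \<alpha> = fclass B (Cell (brunit (und B) \<alpha>))"
  by (simp_all add: Q_def)

lemma Q_boundary [simp]:
  assumes "fwf B \<Phi>"
  shows "Dom (hsq (Q B)) (fclass B \<Phi>) = ftop B \<Phi>"
    "Cod (hsq (Q B)) (fclass B \<Phi>) = fbot B \<Phi>"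
    "FM (lft (Q B)) (fclass B \<Phi>) = flft B \<Phi>"
    "FM (rgt (Q B)) (fclass B \<Phi>) = frgt B \<Phi>"
  using feq_boundary[OF feq_frep[OF assms]] by (simp_all add: Q_def)

lemma Q_vcomp [simp]:
  assumes "fwf B \<Psi>" "fwf B \<Phi>" "fbot B \<Phi> = ftop B \<Psi>"
  shows "fclass B \<Psi> \<bullet>\<^bsub>Q B\<^esub> fclass B \<Phi> = fclass B (VComp \<Psi> \<Phi>)"
  using assms feq_boundary[OF feq_frep[OF assms(1)]] feq_boundary[OF feq_frep[OF assms(2)]]
  by (simp add: Q_def) (intro fclass_eqI feq_VComp feq_sym[OF feq_frep], simp_all)

lemma Q_hcomp [simp]:
  assumes "fwf B \<Psi>" "fwf B \<Phi>" "frgt B \<Phi> = flft B \<Psi>"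
  shows "fclass B \<Psi> \<otimes>\<^bsub>Q B\<^esub> fclass B \<Phi> = fclass B (HComp \<Psi> \<Phi>)"
  using assms feq_boundary[OF feq_frep[OF assms(1)]] feq_boundary[OF feq_frep[OF assms(2)]]
  by (simp add: Q_def) (intro fclass_eqI feq_HComp feq_sym[OF feq_frep], simp_all)

text \<open>As rewrite rules these fold every composite of 2-cells into one \<open>Cell\<close>, so
  that equations among such classes reduce to equations in \<open>B\<close>.\<close>

lemma fclass_Cell [simp]:
  "\<lbrakk>\<phi> \<in> Mor (cells (und B)); \<psi> \<in> Mor (cells (und B)); Cod (cells (und B)) \<phi> = Dom (cells (und B)) \<psi>\<rbrakk>
    \<Longrightarrow> fclass B (VComp (Cell \<psi>) (Cell \<phi>)) = fclass B (Cell (\<psi> \<cdot>\<^bsub>cells (und B)\<^esub> \<phi>))"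
  "\<lbrakk>\<psi> \<in> Mor (cells (und B)); \<phi> \<in> Mor (cells (und B));
     bsrc (und B) (Dom (cells (und B)) \<psi>) = btgt (und B) (Dom (cells (und B)) \<phi>)\<rbrakk>
    \<Longrightarrow> fclass B (HComp (Cell \<psi>) (Cell \<phi>)) = fclass B (Cell (\<psi> \<ast>\<^bsub>bhcomp (und B)\<^esub> \<phi>))"
  by (rule fclass_eqI, simp add: feq_cell_vcomp) (rule fclass_eqI, simp add: feq_cell_hcomp)

lemmas fclass_vidn = fclass_eqI[OF feq_vidn_top] fclass_eqI[OF feq_vidn_bot]
lemmas fclass_vassoc = fclass_eqI[OF feq_vassoc]
lemmas fclass_hid = fclass_eqI[OF feq_hid_idn] fclass_eqI[OF feq_hid_vcomp]
lemmas fclass_exchange = fclass_eqI[OF feq_exchange]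
lemmas fclass_natural = fclass_eqI[OF feq_assoc] fclass_eqI[OF feq_lunit] fclass_eqI[OF feq_runit]

section \<open>The quotient is a globularly generated double category\<close>

lemma category_hsq_Q: "category (hsq (Q B))"
proof (unfold_locales, goal_cases)
  case (9 f)
  then show ?case
    by (auto simp: fclass_vidn)
next
  case (10 f)
  then show ?case
    by (auto simp: fclass_vidn)
next
  case (11 f g h)
  then show ?case
    by (auto simp: fclass_vassoc)
qed auto

lemma cat_functor_edges_Q:
  "cat_functor (hsq (Q B)) (deco B) (lft (Q B))"
  "cat_functor (hsq (Q B)) (deco B) (rgt (Q B))"
  by (unfold cat_functor_def) (auto simp: category_hsq_Q V.category_axioms)

lemma cat_functor_hid_Q: "cat_functor (deco B) (hsq (Q B)) (hid (Q B))"
  by (unfold cat_functor_def)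
    (auto simp: category_hsq_Q V.category_axioms fclass_hid)

lemma cat_functor_hcomp_Q: "cat_functor (dpairs (Q B)) (hsq (Q B)) (dhcomp (Q B))"
proof -
  have "category (dpairs (Q B))"
    unfolding dpairs_def by (rule category_fibre_product) (use cat_functor_edges_Q in auto)
  then show ?thesis
    unfolding dpairs_def
    by (unfold cat_functor_def)
      (auto simp: category_hsq_Q edge_ends fibre_product_def fclass_exchange)
qed

lemma is_iso_fclass:
  assumes "is_iso (cells (und B)) e" shows "is_iso (hsq (Q B)) (fclass B (Cell e))"
proof -
  interpret Q: category "hsq (Q B)" by (rule category_hsq_Q)
  show ?thesis
    using assms by (intro Q.isoI[where g = "fclass B (Cell (U.S.src.cinv e))"]) auto
qed

lemma globular_fclass:
  assumes "\<phi> \<in> Mor (cells (und B))" shows "fclass B (Cell \<phi>) \<in> globular (Q B)"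
  using assms by (auto simp: globular_def)

text \<open>Naturality of associators and unitors holds because it was imposed as relations.
  Pentagon and triangle involve classes of 2-cells only, so they are inherited from
  \<open>B\<close>.\<close>

lemma double_category_Q: "double_category (Q B)"
proof (intro double_category.intro, goal_cases)
  case (17 \<Theta> \<Psi> \<Phi>)
  then show ?case
    by (auto simp: dpairs_def edge_ends fclass_natural)
next
  case (22 \<Phi>)
  then show ?case
    by (auto simp: edge_ends fclass_natural)
next
  case (27 \<Phi>)
  then show ?case
    by (auto simp: edge_ends fclass_natural)
next
  case (28 \<delta> \<gamma> \<beta> \<alpha>)
  then show ?case
    using U.pentagon[of \<delta> \<gamma> \<beta> \<alpha>] by (simp add: dpairs_def)
next
  case (29 \<beta> \<alpha>)
  then show ?case
    using U.triangle[of \<beta> \<alpha>] by (simp add: dpairs_def)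
qed (use cat_functor_edges_Q cat_functor_hid_Q cat_functor_hcomp_Q in
    \<open>auto simp: dpairs_def is_iso_fclass globular_fclass\<close>)

text \<open>The four constructors of formal squares correspond to the four clauses of
  \<open>generated_squares\<close>.\<close>

lemma globularly_generated_Q: "globularly_generated_double_category (Q B)"
proof -
  have "fwf B \<Phi> \<Longrightarrow> fclass B \<Phi> \<in> generated_squares (Q B)" for \<Phi>
  proof (induction \<Phi>)
    case (Cell \<phi>)
    then show ?case
      by (auto intro: gen_globular globular_fclass)
  next
    case (HId f)
    then show ?case
      using gen_hid[of f "Q B"] by simp
  next
    case (VComp \<Psi> \<Phi>)
    then show ?case
      using gen_vcomp[of "fclass B \<Phi>" "Q B" "fclass B \<Psi>"] by simp
  next
    case (HComp \<Psi> \<Phi>)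
    then show ?case
      using gen_hcomp[of "fclass B \<Phi>" "Q B" "fclass B \<Psi>"] by simp
  qed
  then show ?thesis
    by (auto simp: globularly_generated_double_category_def double_category_Q)
qed

end

section \<open>The universal property of the inclusion\<close>

locale free_extension = src: decorated B + tgt: double_category D
  for B :: "('o, 'v, 'h, 'c) dbicat" and D :: "('p, 'w, 'k, 's) dbl" +
  fixes G :: "('o, 'v, 'h, 'c, 'p, 'w, 'k, 's) dpsf"
  assumes decorated_pseudofunctor: "decorated_pseudofunctor B (Hstar D) G"
begin

abbreviation "U \<equiv> und B"
abbreviation "g \<equiv> P_cells (psf_part G)"
abbreviation "gv \<equiv> deco_part G"
abbreviation "c \<equiv> Pcmp (psf_part G)"
abbreviation "u \<equiv> Punit (psf_part G)"
abbreviation "vinv \<equiv> tgt.L.src.cinv"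

sublocale P: pseudofunctor U "horizontal_bicategory D" "psf_part G"
  using decorated_pseudofunctor by (simp add: decorated_pseudofunctor_def)

sublocale V: cat_functor "deco B" "vert D" gv
  using decorated_pseudofunctor by (simp add: decorated_pseudofunctor_def ext_functor_def)

sublocale H: cat_functor "cells U" "cells (horizontal_bicategory D)" g
  using P.P_cells_functor by (simp add: ext_functor_def)

text \<open>\<open>G\<close> lands in the horizontal bicategory; its properties are restated in
  \<open>D\<close> because the extension mixes its values with squares that are not
  globular.\<close>

lemma g_simps [simp]:
  "\<alpha> \<in> Ob (cells U) \<Longrightarrow> FO g \<alpha> \<in> Ob (hsq D)"
  "\<phi> \<in> Mor (cells U) \<Longrightarrow> FM g \<phi> \<in> globular D"
  "\<phi> \<in> Mor (cells U) \<Longrightarrow> Dom (hsq D) (FM g \<phi>) = FO g (Dom (cells U) \<phi>)"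
  "\<phi> \<in> Mor (cells U) \<Longrightarrow> Cod (hsq D) (FM g \<phi>) = FO g (Cod (cells U) \<phi>)"
  "\<alpha> \<in> Ob (cells U) \<Longrightarrow> FM g (Idn (cells U) \<alpha>) = Idn (hsq D) (FO g \<alpha>)"
  "\<lbrakk>\<phi> \<in> Mor (cells U); \<psi> \<in> Mor (cells U); Cod (cells U) \<phi> = Dom (cells U) \<psi>\<rbrakk>
    \<Longrightarrow> FM g (\<psi> \<cdot>\<^bsub>cells U\<^esub> \<phi>) = FM g \<psi> \<bullet>\<^bsub>D\<^esub> FM g \<phi>"
  using H.fun_ob[of \<alpha>] H.fun_mor[of \<phi>] H.fun_dom[of \<phi>] H.fun_cod[of \<phi>] H.fun_idn[of \<alpha>]
    H.fun_cmp[of \<phi> \<psi>] by simp_all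

lemma P_ob_eq [simp]: "a \<in> cells0 U \<Longrightarrow> P_ob (psf_part G) a = FO gv a"
  using decorated_pseudofunctor by (simp add: decorated_pseudofunctor_def)

lemma gv_ob [simp]: "a \<in> cells0 U \<Longrightarrow> FO gv a \<in> Ob (vert D)"
  using V.fun_ob[of a] by simp

lemma gv_idn [simp]: "a \<in> cells0 U \<Longrightarrow> FM gv (Idn (deco B) a) = Idn (vert D) (FO gv a)"
  using V.fun_idn[of a] by simp

lemma g_edges [simp]:
  "\<alpha> \<in> Ob (cells U) \<Longrightarrow> FO (lft D) (FO g \<alpha>) = FO gv (bsrc U \<alpha>)"
  "\<alpha> \<in> Ob (cells U) \<Longrightarrow> FO (rgt D) (FO g \<alpha>) = FO gv (btgt U \<alpha>)"
  using P.P_src[of \<alpha>] P.P_tgt[of \<alpha>] by simp_all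

lemma g_mor [simp]:
  assumes "\<phi> \<in> Mor (cells U)"
  shows "FM g \<phi> \<in> Mor (hsq D)"
    and "FM (lft D) (FM g \<phi>) = Idn (vert D) (FO gv (bsrc U (Dom (cells U) \<phi>)))"
    and "FM (rgt D) (FM g \<phi>) = Idn (vert D) (FO gv (btgt U (Dom (cells U) \<phi>)))"
  using tgt.globularD[of "FM g \<phi>"] assms by simp_all

lemma c_simps [simp]:
  assumes "\<beta> \<in> Ob (cells U)" "\<alpha> \<in> Ob (cells U)" "bsrc U \<beta> = btgt U \<alpha>"
  shows "c (\<beta>, \<alpha>) \<in> Mor (hsq D)"
    and "c (\<beta>, \<alpha>) \<in> globular D"
    and "is_iso (hsq D) (c (\<beta>, \<alpha>))"
    and "Dom (hsq D) (c (\<beta>, \<alpha>)) = FO g \<beta> \<odot>\<^bsub>D\<^esub> FO g \<alpha>"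
    and "Cod (hsq D) (c (\<beta>, \<alpha>)) = FO g (\<beta> \<star>\<^bsub>bhcomp U\<^esub> \<alpha>)"
    and "FM (lft D) (c (\<beta>, \<alpha>)) = Idn (vert D) (FO gv (bsrc U \<alpha>))"
    and "FM (rgt D) (c (\<beta>, \<alpha>)) = Idn (vert D) (FO gv (btgt U \<beta>))"
    and "FM (lft D) (vinv (c (\<beta>, \<alpha>))) = Idn (vert D) (FO gv (bsrc U \<alpha>))"
    and "FM (rgt D) (vinv (c (\<beta>, \<alpha>))) = Idn (vert D) (FO gv (btgt U \<beta>))"
proof -
  have i: "is_iso (hsq D) (c (\<beta>, \<alpha>)) \<and> c (\<beta>, \<alpha>) \<in> globular D"
    using P.Pcmp_iso[of \<beta> \<alpha>] assms by (simp add: tgt.is_iso_horizontal)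
  then show "c (\<beta>, \<alpha>) \<in> Mor (hsq D)" "c (\<beta>, \<alpha>) \<in> globular D" "is_iso (hsq D) (c (\<beta>, \<alpha>))"
    by simp_all
  show d: "Dom (hsq D) (c (\<beta>, \<alpha>)) = FO g \<beta> \<odot>\<^bsub>D\<^esub> FO g \<alpha>"
    "Cod (hsq D) (c (\<beta>, \<alpha>)) = FO g (\<beta> \<star>\<^bsub>bhcomp U\<^esub> \<alpha>)"
    using P.Pcmp_dom[of \<beta> \<alpha>] P.Pcmp_cod[of \<beta> \<alpha>] assms by simp_all
  \<comment> \<open>The inverse comparison enters the extension as well, so its edges must be
    known.\<close>
  have j: "vinv (c (\<beta>, \<alpha>)) \<in> globular D"
    using i tgt.globular_cinv by blast
  show "FM (lft D) (c (\<beta>, \<alpha>)) = Idn (vert D) (FO gv (bsrc U \<alpha>))"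
    "FM (rgt D) (c (\<beta>, \<alpha>)) = Idn (vert D) (FO gv (btgt U \<beta>))"
    "FM (lft D) (vinv (c (\<beta>, \<alpha>))) = Idn (vert D) (FO gv (bsrc U \<alpha>))"
    "FM (rgt D) (vinv (c (\<beta>, \<alpha>))) = Idn (vert D) (FO gv (btgt U \<beta>))"
    using tgt.globularD[OF conjunct2[OF i]] tgt.globularD[OF j] assms d i by simp_all
qed

lemma u_simps [simp]:
  assumes "a \<in> cells0 U"
  shows "u a \<in> Mor (hsq D)"
    and "u a \<in> globular D"
    and "is_iso (hsq D) (u a)"
    and "Dom (hsq D) (u a) = FO (hid D) (FO gv a)"
    and "Cod (hsq D) (u a) = FO g (bunit U a)"
    and "FM (lft D) (u a) = Idn (vert D) (FO gv a)"
    and "FM (rgt D) (u a) = Idn (vert D) (FO gv a)"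
    and "FM (lft D) (vinv (u a)) = Idn (vert D) (FO gv a)"
    and "FM (rgt D) (vinv (u a)) = Idn (vert D) (FO gv a)"
proof -
  have i: "is_iso (hsq D) (u a) \<and> u a \<in> globular D"
    using P.Punit_iso[of a] assms by (simp add: tgt.is_iso_horizontal)
  then show "u a \<in> Mor (hsq D)" "u a \<in> globular D" "is_iso (hsq D) (u a)"
    by simp_all
  show d: "Dom (hsq D) (u a) = FO (hid D) (FO gv a)" "Cod (hsq D) (u a) = FO g (bunit U a)"
    using P.Punit_dom[of a] P.Punit_cod[of a] assms by simp_all
  have j: "vinv (u a) \<in> globular D"
    using i tgt.globular_cinv by blast
  show "FM (lft D) (u a) = Idn (vert D) (FO gv a)"
    "FM (rgt D) (u a) = Idn (vert D) (FO gv a)"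
    "FM (lft D) (vinv (u a)) = Idn (vert D) (FO gv a)"
    "FM (rgt D) (vinv (u a)) = Idn (vert D) (FO gv a)"
    using tgt.globularD[OF conjunct2[OF i]] tgt.globularD[OF j] assms d i by simp_all
qed

text \<open>Naturality of the comparison squares forces the value of the extension on the squares
  \<^term>\<open>HId f\<close> and on horizontal composites.\<close>

primrec ext :: "('v, 'c) fexp \<Rightarrow> 's" where
  "ext (Cell \<phi>) = FM g \<phi>"
| "ext (HId f) = u (Cod (deco B) f) \<bullet>\<^bsub>D\<^esub> FM (hid D) (FM gv f) \<bullet>\<^bsub>D\<^esub> vinv (u (Dom (deco B) f))"
| "ext (VComp \<Psi> \<Phi>) = ext \<Psi> \<bullet>\<^bsub>D\<^esub> ext \<Phi>"
| "ext (HComp \<Psi> \<Phi>) = c (fbot B \<Psi>, fbot B \<Phi>) \<bullet>\<^bsub>D\<^esub> (ext \<Psi> \<otimes>\<^bsub>D\<^esub> ext \<Phi>)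
     \<bullet>\<^bsub>D\<^esub> vinv (c (ftop B \<Psi>, ftop B \<Phi>))"

text \<open>Conjugating by globular comparison squares changes tops and bottoms but leaves the
  vertical edges alone.\<close>

lemma ext_boundary [simp]:
  assumes "fwf B \<Phi>"
  shows "ext \<Phi> \<in> Mor (hsq D)"
    and "Dom (hsq D) (ext \<Phi>) = FO g (ftop B \<Phi>)"
    and "Cod (hsq D) (ext \<Phi>) = FO g (fbot B \<Phi>)"
    and "FM (lft D) (ext \<Phi>) = FM gv (flft B \<Phi>)"
    and "FM (rgt D) (ext \<Phi>) = FM gv (frgt B \<Phi>)"
proof -
  have "ext \<Phi> \<in> Mor (hsq D) \<and> Dom (hsq D) (ext \<Phi>) = FO g (ftop B \<Phi>) \<and>
    Cod (hsq D) (ext \<Phi>) = FO g (fbot B \<Phi>) \<and>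
    FM (lft D) (ext \<Phi>) = FM gv (flft B \<Phi>) \<and> FM (rgt D) (ext \<Phi>) = FM gv (frgt B \<Phi>)"
    using assms by (induction \<Phi>) (simp_all add: src.edge_ends)
  then show "ext \<Phi> \<in> Mor (hsq D)"
    "Dom (hsq D) (ext \<Phi>) = FO g (ftop B \<Phi>)"
    "Cod (hsq D) (ext \<Phi>) = FO g (fbot B \<Phi>)"
    "FM (lft D) (ext \<Phi>) = FM gv (flft B \<Phi>)"
    "FM (rgt D) (ext \<Phi>) = FM gv (frgt B \<Phi>)"
    by simp_all
qed

section \<open>The extension respects the relations on formal squares\<close>

lemma ext_HId_u:
  "f \<in> Mor (deco B) \<Longrightarrow> ext (HId f) \<bullet>\<^bsub>D\<^esub> u (Dom (deco B) f)
     = u (Cod (deco B) f) \<bullet>\<^bsub>D\<^esub> FM (hid D) (FM gv f)"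
  by (simp add: tgt.L.src.cmp_assoc)

text \<open>With the inverse cleared, the recursion equation becomes exactly the naturality that a
  double functor with comparison \<open>c\<close> has to satisfy; the later arguments use this
  form.\<close>

lemma ext_HComp_c:
  assumes "fwf B (HComp \<Psi> \<Phi>)"
  shows "ext (HComp \<Psi> \<Phi>) \<bullet>\<^bsub>D\<^esub> c (ftop B \<Psi>, ftop B \<Phi>)
     = c (fbot B \<Psi>, fbot B \<Phi>) \<bullet>\<^bsub>D\<^esub> (ext \<Psi> \<otimes>\<^bsub>D\<^esub> ext \<Phi>)"
  using assms by (simp add: tgt.L.src.cmp_assoc src.edge_ends)

text \<open>On the right the bottom comparison of the first row meets its own inverse at the top of
  the second row; after this cancellation interchange in \<open>D\<close> is left.\<close>

lemma ext_exchange: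
  assumes "fwf B (HComp (VComp \<Psi>\<^sub>2 \<Psi>\<^sub>1) (VComp \<Phi>\<^sub>2 \<Phi>\<^sub>1))"
    "fwf B (VComp (HComp \<Psi>\<^sub>2 \<Phi>\<^sub>2) (HComp \<Psi>\<^sub>1 \<Phi>\<^sub>1))"
  shows "ext (HComp (VComp \<Psi>\<^sub>2 \<Psi>\<^sub>1) (VComp \<Phi>\<^sub>2 \<Phi>\<^sub>1)) = ext (VComp (HComp \<Psi>\<^sub>2 \<Phi>\<^sub>2) (HComp \<Psi>\<^sub>1 \<Phi>\<^sub>1))"
proof -
  note e = src.edge_ends[of \<Psi>\<^sub>1 \<Phi>\<^sub>1] src.edge_ends[of \<Psi>\<^sub>2 \<Phi>\<^sub>2]
  have "(ext \<Psi>\<^sub>2 \<bullet>\<^bsub>D\<^esub> ext \<Psi>\<^sub>1) \<otimes>\<^bsub>D\<^esub> (ext \<Phi>\<^sub>2 \<bullet>\<^bsub>D\<^esub> ext \<Phi>\<^sub>1)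
      = (ext \<Psi>\<^sub>2 \<otimes>\<^bsub>D\<^esub> ext \<Phi>\<^sub>2) \<bullet>\<^bsub>D\<^esub> (ext \<Psi>\<^sub>1 \<otimes>\<^bsub>D\<^esub> ext \<Phi>\<^sub>1)"
    using assms by (subst tgt.interchange) simp_all
  then show ?thesis
    using assms e by (simp add: tgt.L.src.cmp_assoc)
qed

lemma ext_cell_hcomp:
  assumes "(\<psi>, \<phi>) \<in> Mor (bpairs U)"
  shows "ext (HComp (Cell \<psi>) (Cell \<phi>)) = ext (Cell (\<psi> \<ast>\<^bsub>bhcomp U\<^esub> \<phi>))"
proof (rule tgt.L.src.iso_epi)
  show "ext (HComp (Cell \<psi>) (Cell \<phi>)) \<bullet>\<^bsub>D\<^esub> c (Dom (cells U) \<psi>, Dom (cells U) \<phi>)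
      = ext (Cell (\<psi> \<ast>\<^bsub>bhcomp U\<^esub> \<phi>)) \<bullet>\<^bsub>D\<^esub> c (Dom (cells U) \<psi>, Dom (cells U) \<phi>)"
    using P.Pcmp_natural[OF assms] assms by (simp add: tgt.L.src.cmp_assoc)
qed (use assms in simp_all)

text \<open>Precomposition with the invertible square formed from \<open>ct\<close> and
  \<open>vt\<close> absorbs both comparisons. The unit axiom of the pseudofunctor turns the image of
  \<open>blunit\<close> into \<open>dlunit\<close>, first at the bottom and then back at the top,
  with naturality of \<open>dlunit\<close> in \<open>D\<close> in between.\<close>

lemma ext_lunit:
  assumes "fwf B \<Phi>"
  shows "ext (VComp (Cell (blunit U (fbot B \<Phi>))) (HComp (HId (frgt B \<Phi>)) \<Phi>))
     = ext (VComp \<Phi> (Cell (blunit U (ftop B \<Phi>))))"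
proof -
  define b t h where "b = fbot B \<Phi>" and "t = ftop B \<Phi>" and "h = FM (hid D) (FM gv (frgt B \<Phi>))"
  define vt vb where "vt = u (btgt U t)" and "vb = u (btgt U b)"
  define ct cb where "ct = c (bunit U (btgt U t), t)" and "cb = c (bunit U (btgt U b), b)"
  note defs = b_def t_def h_def vt_def vb_def ct_def cb_def
  let ?it = "Idn (hsq D) (FO g t)" and ?ib = "Idn (hsq D) (FO g b)"
  let ?H = "HComp (HId (frgt B \<Phi>)) \<Phi>"
  \<comment> \<open>Images of \<open>HId\<close> and \<open>HComp\<close> stay folded, so that they
    only move by the inverse-free equations.\<close>
  note [simp del] = ext.simps and [simp] = tgt.L.src.cmp_assoc ext.simps(1,3)
  have wf: "fwf B ?H"
    using assms by simp
  show ?thesis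
  proof (rule tgt.L.src.iso_epi)
    show "is_iso (hsq D) (ct \<bullet>\<^bsub>D\<^esub> (vt \<otimes>\<^bsub>D\<^esub> ?it))"
      using assms by (simp add: tgt.L.src.iso_cmp tgt.iso_hcomp defs)
    have l: "FM g (blunit U \<alpha>) \<bullet>\<^bsub>D\<^esub> c (bunit U (btgt U \<alpha>), \<alpha>) \<bullet>\<^bsub>D\<^esub> (u (btgt U \<alpha>) \<otimes>\<^bsub>D\<^esub> Idn (hsq D) (FO g \<alpha>))
        = dlunit D (FO g \<alpha>)" if "\<alpha> \<in> Ob (cells U)" for \<alpha>
      using P.P_lunit[OF that] by simp
    have 1: "ext ?H \<bullet>\<^bsub>D\<^esub> ct = cb \<bullet>\<^bsub>D\<^esub> (ext (HId (frgt B \<Phi>)) \<otimes>\<^bsub>D\<^esub> ext \<Phi>)"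
      using ext_HComp_c[OF wf] assms by (simp add: defs)
    \<comment> \<open>By interchange this is \<open>ext_HId_u\<close> in the left factor, beside the
      two identity laws for \<open>ext \<Phi>\<close>.\<close>
    have 2: "(ext (HId (frgt B \<Phi>)) \<otimes>\<^bsub>D\<^esub> ext \<Phi>) \<bullet>\<^bsub>D\<^esub> (vt \<otimes>\<^bsub>D\<^esub> ?it) = (vb \<otimes>\<^bsub>D\<^esub> ?ib) \<bullet>\<^bsub>D\<^esub> (h \<otimes>\<^bsub>D\<^esub> ext \<Phi>)"
      using assms ext_HId_u[of "frgt B \<Phi>"] by (simp add: tgt.interchange defs)
    have "ext (VComp (Cell (blunit U b)) ?H) \<bullet>\<^bsub>D\<^esub> ct \<bullet>\<^bsub>D\<^esub> (vt \<otimes>\<^bsub>D\<^esub> ?it)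
        = FM g (blunit U b) \<bullet>\<^bsub>D\<^esub> (ext ?H \<bullet>\<^bsub>D\<^esub> ct) \<bullet>\<^bsub>D\<^esub> (vt \<otimes>\<^bsub>D\<^esub> ?it)"
      using assms wf by (simp add: defs)
    also have "\<dots> = FM g (blunit U b) \<bullet>\<^bsub>D\<^esub> cb \<bullet>\<^bsub>D\<^esub> (ext (HId (frgt B \<Phi>)) \<otimes>\<^bsub>D\<^esub> ext \<Phi>) \<bullet>\<^bsub>D\<^esub> (vt \<otimes>\<^bsub>D\<^esub> ?it)"
      unfolding 1 using assms wf by (simp add: defs)
    also have "\<dots> = (FM g (blunit U b) \<bullet>\<^bsub>D\<^esub> cb \<bullet>\<^bsub>D\<^esub> (vb \<otimes>\<^bsub>D\<^esub> ?ib)) \<bullet>\<^bsub>D\<^esub> (h \<otimes>\<^bsub>D\<^esub> ext \<Phi>)"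
      unfolding 2 using assms wf by (simp add: defs)
    also have "\<dots> = dlunit D (FO g b) \<bullet>\<^bsub>D\<^esub> (h \<otimes>\<^bsub>D\<^esub> ext \<Phi>)"
      using l[of b] assms by (simp add: defs)
    also have "\<dots> = ext \<Phi> \<bullet>\<^bsub>D\<^esub> dlunit D (FO g t)"
      using tgt.lunit_natural[of "ext \<Phi>"] assms by (simp add: defs)
    also have "\<dots> = ext \<Phi> \<bullet>\<^bsub>D\<^esub> FM g (blunit U t) \<bullet>\<^bsub>D\<^esub> ct \<bullet>\<^bsub>D\<^esub> (vt \<otimes>\<^bsub>D\<^esub> ?it)"
      using l[of t] assms by (simp add: defs)
    also have "\<dots> = ext (VComp \<Phi> (Cell (blunit U t))) \<bullet>\<^bsub>D\<^esub> ct \<bullet>\<^bsub>D\<^esub> (vt \<otimes>\<^bsub>D\<^esub> ?it)"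
      using assms by (simp add: defs)
    finally show "ext (VComp (Cell (blunit U (fbot B \<Phi>))) ?H) \<bullet>\<^bsub>D\<^esub> ct \<bullet>\<^bsub>D\<^esub> (vt \<otimes>\<^bsub>D\<^esub> ?it)
        = ext (VComp \<Phi> (Cell (blunit U (ftop B \<Phi>)))) \<bullet>\<^bsub>D\<^esub> ct \<bullet>\<^bsub>D\<^esub> (vt \<otimes>\<^bsub>D\<^esub> ?it)"
      by (simp only: b_def t_def)
  qed (use assms in \<open>simp_all add: defs\<close>)
qed

text \<open>Mirror image of the left unitor: the unit comparison now whiskers on the other
  side.\<close>

lemma ext_runit:
  assumes "fwf B \<Phi>"
  shows "ext (VComp (Cell (brunit U (fbot B \<Phi>))) (HComp \<Phi> (HId (flft B \<Phi>))))
     = ext (VComp \<Phi> (Cell (brunit U (ftop B \<Phi>))))"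
proof -
  define b t h where "b = fbot B \<Phi>" and "t = ftop B \<Phi>" and "h = FM (hid D) (FM gv (flft B \<Phi>))"
  define vt vb where "vt = u (bsrc U t)" and "vb = u (bsrc U b)"
  define ct cb where "ct = c (t, bunit U (bsrc U t))" and "cb = c (b, bunit U (bsrc U b))"
  note defs = b_def t_def h_def vt_def vb_def ct_def cb_def
  let ?it = "Idn (hsq D) (FO g t)" and ?ib = "Idn (hsq D) (FO g b)"
  let ?H = "HComp \<Phi> (HId (flft B \<Phi>))"
  note [simp del] = ext.simps and [simp] = tgt.L.src.cmp_assoc ext.simps(1,3)
  have wf: "fwf B ?H"
    using assms by simp
  show ?thesis
  proof (rule tgt.L.src.iso_epi)
    show "is_iso (hsq D) (ct \<bullet>\<^bsub>D\<^esub> (?it \<otimes>\<^bsub>D\<^esub> vt))"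
      using assms by (simp add: tgt.L.src.iso_cmp tgt.iso_hcomp defs)
    have l: "FM g (brunit U \<alpha>) \<bullet>\<^bsub>D\<^esub> c (\<alpha>, bunit U (bsrc U \<alpha>)) \<bullet>\<^bsub>D\<^esub> (Idn (hsq D) (FO g \<alpha>) \<otimes>\<^bsub>D\<^esub> u (bsrc U \<alpha>))
        = drunit D (FO g \<alpha>)" if "\<alpha> \<in> Ob (cells U)" for \<alpha>
      using P.P_runit[OF that] by simp
    have 1: "ext ?H \<bullet>\<^bsub>D\<^esub> ct = cb \<bullet>\<^bsub>D\<^esub> (ext \<Phi> \<otimes>\<^bsub>D\<^esub> ext (HId (flft B \<Phi>)))"
      using ext_HComp_c[OF wf] assms by (simp add: defs)
    have 2: "(ext \<Phi> \<otimes>\<^bsub>D\<^esub> ext (HId (flft B \<Phi>))) \<bullet>\<^bsub>D\<^esub> (?it \<otimes>\<^bsub>D\<^esub> vt) = (?ib \<otimes>\<^bsub>D\<^esub> vb) \<bullet>\<^bsub>D\<^esub> (ext \<Phi> \<otimes>\<^bsub>D\<^esub> h)"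
      using assms ext_HId_u[of "flft B \<Phi>"] by (simp add: tgt.interchange defs)
    have "ext (VComp (Cell (brunit U b)) ?H) \<bullet>\<^bsub>D\<^esub> ct \<bullet>\<^bsub>D\<^esub> (?it \<otimes>\<^bsub>D\<^esub> vt)
        = FM g (brunit U b) \<bullet>\<^bsub>D\<^esub> (ext ?H \<bullet>\<^bsub>D\<^esub> ct) \<bullet>\<^bsub>D\<^esub> (?it \<otimes>\<^bsub>D\<^esub> vt)"
      using assms wf by (simp add: defs)
    also have "\<dots> = FM g (brunit U b) \<bullet>\<^bsub>D\<^esub> cb \<bullet>\<^bsub>D\<^esub> (ext \<Phi> \<otimes>\<^bsub>D\<^esub> ext (HId (flft B \<Phi>))) \<bullet>\<^bsub>D\<^esub> (?it \<otimes>\<^bsub>D\<^esub> vt)"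
      unfolding 1 using assms wf by (simp add: defs)
    also have "\<dots> = (FM g (brunit U b) \<bullet>\<^bsub>D\<^esub> cb \<bullet>\<^bsub>D\<^esub> (?ib \<otimes>\<^bsub>D\<^esub> vb)) \<bullet>\<^bsub>D\<^esub> (ext \<Phi> \<otimes>\<^bsub>D\<^esub> h)"
      unfolding 2 using assms wf by (simp add: defs)
    also have "\<dots> = drunit D (FO g b) \<bullet>\<^bsub>D\<^esub> (ext \<Phi> \<otimes>\<^bsub>D\<^esub> h)"
      using l[of b] assms by (simp add: defs)
    also have "\<dots> = ext \<Phi> \<bullet>\<^bsub>D\<^esub> drunit D (FO g t)"
      using tgt.runit_natural[of "ext \<Phi>"] assms by (simp add: defs)
    also have "\<dots> = ext \<Phi> \<bullet>\<^bsub>D\<^esub> FM g (brunit U t) \<bullet>\<^bsub>D\<^esub> ct \<bullet>\<^bsub>D\<^esub> (?it \<otimes>\<^bsub>D\<^esub> vt)"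
      using l[of t] assms by (simp add: defs)
    also have "\<dots> = ext (VComp \<Phi> (Cell (brunit U t))) \<bullet>\<^bsub>D\<^esub> ct \<bullet>\<^bsub>D\<^esub> (?it \<otimes>\<^bsub>D\<^esub> vt)"
      using assms by (simp add: defs)
    finally show "ext (VComp (Cell (brunit U (fbot B \<Phi>))) ?H) \<bullet>\<^bsub>D\<^esub> ct \<bullet>\<^bsub>D\<^esub> (?it \<otimes>\<^bsub>D\<^esub> vt)
        = ext (VComp \<Phi> (Cell (brunit U (ftop B \<Phi>)))) \<bullet>\<^bsub>D\<^esub> ct \<bullet>\<^bsub>D\<^esub> (?it \<otimes>\<^bsub>D\<^esub> vt)"
      by (simp only: b_def t_def)
  qed (use assms in \<open>simp_all add: defs\<close>)
qed

text \<open>After precomposition with \<open>?e\<close>, the composite that starts the associativity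
  axiom of the pseudofunctor, that axiom applies at the bottoms, then naturality of the associator
  of \<open>D\<close>, then the same axiom backwards at the tops.\<close>

lemma ext_assoc:
  assumes wf1: "fwf B (HComp \<Theta> \<Psi>)" and wf2: "fwf B (HComp \<Psi> \<Phi>)"
  shows "ext (VComp (Cell (bassoc U (fbot B \<Theta>) (fbot B \<Psi>) (fbot B \<Phi>))) (HComp (HComp \<Theta> \<Psi>) \<Phi>))
     = ext (VComp (HComp \<Theta> (HComp \<Psi> \<Phi>)) (Cell (bassoc U (ftop B \<Theta>) (ftop B \<Psi>) (ftop B \<Phi>))))"
proof -
  note [simp del] = ext.simps and [simp] = tgt.L.src.cmp_assoc ext.simps(1,3)
  define x y z x' y' z' where "x = ftop B \<Theta>" and "y = ftop B \<Psi>" and "z = ftop B \<Phi>"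
    and "x' = fbot B \<Theta>" and "y' = fbot B \<Psi>" and "z' = fbot B \<Phi>"
  note defs = x_def y_def z_def x'_def y'_def z'_def
  let ?i = "\<lambda>\<alpha>. Idn (hsq D) (FO g \<alpha>)"
  have wf: "fwf B \<Theta>" "fwf B \<Psi>" "fwf B \<Phi>" "frgt B \<Psi> = flft B \<Theta>" "frgt B \<Phi> = flft B \<Psi>"
    using assms by simp_all
  note e = src.edge_ends[OF wf(1,2,4)] src.edge_ends[OF wf(2,3,5)]
  have wf3: "fwf B (HComp (HComp \<Theta> \<Psi>) \<Phi>)" "fwf B (HComp \<Theta> (HComp \<Psi> \<Phi>))"
    using wf by simp_all
  have a: "FM g (bassoc U \<gamma> \<beta> \<alpha>) \<bullet>\<^bsub>D\<^esub> c (\<gamma> \<star>\<^bsub>bhcomp U\<^esub> \<beta>, \<alpha>) \<bullet>\<^bsub>D\<^esub> (c (\<gamma>, \<beta>) \<otimes>\<^bsub>D\<^esub> ?i \<alpha>)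
      = c (\<gamma>, \<beta> \<star>\<^bsub>bhcomp U\<^esub> \<alpha>) \<bullet>\<^bsub>D\<^esub> (?i \<gamma> \<otimes>\<^bsub>D\<^esub> c (\<beta>, \<alpha>)) \<bullet>\<^bsub>D\<^esub> dassoc D (FO g \<gamma>) (FO g \<beta>) (FO g \<alpha>)"
    if "\<gamma> \<in> Ob (cells U)" "\<beta> \<in> Ob (cells U)" "\<alpha> \<in> Ob (cells U)" "bsrc U \<gamma> = btgt U \<beta>" "bsrc U \<beta> = btgt U \<alpha>"
    for \<gamma> \<beta> \<alpha>
    using P.P_assoc[of \<gamma> \<beta> \<alpha>] that by simp
  let ?a = "FM g (bassoc U x' y' z')" and ?a' = "dassoc D (FO g x') (FO g y') (FO g z')"
    and ?b = "FM g (bassoc U x y z)" and ?b' = "dassoc D (FO g x) (FO g y) (FO g z)"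
  let ?L = "HComp (HComp \<Theta> \<Psi>) \<Phi>" and ?R = "HComp \<Theta> (HComp \<Psi> \<Phi>)"
  have L1: "ext ?L \<bullet>\<^bsub>D\<^esub> c (x \<star>\<^bsub>bhcomp U\<^esub> y, z) = c (x' \<star>\<^bsub>bhcomp U\<^esub> y', z') \<bullet>\<^bsub>D\<^esub> (ext (HComp \<Theta> \<Psi>) \<otimes>\<^bsub>D\<^esub> ext \<Phi>)"
    using ext_HComp_c[OF wf3(1)] by (simp add: defs)
  have L2: "(ext (HComp \<Theta> \<Psi>) \<otimes>\<^bsub>D\<^esub> ext \<Phi>) \<bullet>\<^bsub>D\<^esub> (c (x, y) \<otimes>\<^bsub>D\<^esub> ?i z)
      = (c (x', y') \<otimes>\<^bsub>D\<^esub> ?i z') \<bullet>\<^bsub>D\<^esub> ((ext \<Theta> \<otimes>\<^bsub>D\<^esub> ext \<Psi>) \<otimes>\<^bsub>D\<^esub> ext \<Phi>)"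
    using wf e ext_HComp_c[OF wf1] by (simp add: tgt.interchange defs)
  have R1: "ext ?R \<bullet>\<^bsub>D\<^esub> c (x, y \<star>\<^bsub>bhcomp U\<^esub> z) = c (x', y' \<star>\<^bsub>bhcomp U\<^esub> z') \<bullet>\<^bsub>D\<^esub> (ext \<Theta> \<otimes>\<^bsub>D\<^esub> ext (HComp \<Psi> \<Phi>))"
    using ext_HComp_c[OF wf3(2)] by (simp add: defs)
  have R2: "(?i x' \<otimes>\<^bsub>D\<^esub> c (y', z')) \<bullet>\<^bsub>D\<^esub> (ext \<Theta> \<otimes>\<^bsub>D\<^esub> (ext \<Psi> \<otimes>\<^bsub>D\<^esub> ext \<Phi>))
      = (ext \<Theta> \<otimes>\<^bsub>D\<^esub> ext (HComp \<Psi> \<Phi>)) \<bullet>\<^bsub>D\<^esub> (?i x \<otimes>\<^bsub>D\<^esub> c (y, z))"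
    using wf e ext_HComp_c[OF wf2] by (simp add: tgt.interchange defs)
  have N: "?a' \<bullet>\<^bsub>D\<^esub> ((ext \<Theta> \<otimes>\<^bsub>D\<^esub> ext \<Psi>) \<otimes>\<^bsub>D\<^esub> ext \<Phi>) = (ext \<Theta> \<otimes>\<^bsub>D\<^esub> (ext \<Psi> \<otimes>\<^bsub>D\<^esub> ext \<Phi>)) \<bullet>\<^bsub>D\<^esub> ?b'"
    using tgt.assoc_natural[of "ext \<Theta>" "ext \<Psi>" "ext \<Phi>"] wf by (simp add: defs)
  let ?e = "c (x \<star>\<^bsub>bhcomp U\<^esub> y, z) \<bullet>\<^bsub>D\<^esub> (c (x, y) \<otimes>\<^bsub>D\<^esub> ?i z)"
  show ?thesis
  proof (rule tgt.L.src.iso_epi)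
    show "is_iso (hsq D) ?e"
      using wf e by (simp add: tgt.L.src.iso_cmp tgt.iso_hcomp defs)
    have "ext (VComp (Cell (bassoc U x' y' z')) ?L) \<bullet>\<^bsub>D\<^esub> ?e
        = ?a \<bullet>\<^bsub>D\<^esub> (ext ?L \<bullet>\<^bsub>D\<^esub> c (x \<star>\<^bsub>bhcomp U\<^esub> y, z)) \<bullet>\<^bsub>D\<^esub> (c (x, y) \<otimes>\<^bsub>D\<^esub> ?i z)"
      using wf wf3 e by (simp add: defs)
    also have "\<dots> = ?a \<bullet>\<^bsub>D\<^esub> c (x' \<star>\<^bsub>bhcomp U\<^esub> y', z') \<bullet>\<^bsub>D\<^esub> (ext (HComp \<Theta> \<Psi>) \<otimes>\<^bsub>D\<^esub> ext \<Phi>) \<bullet>\<^bsub>D\<^esub> (c (x, y) \<otimes>\<^bsub>D\<^esub> ?i z)"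
      unfolding L1 using wf e by (simp add: defs)
    also have "\<dots> = (?a \<bullet>\<^bsub>D\<^esub> c (x' \<star>\<^bsub>bhcomp U\<^esub> y', z') \<bullet>\<^bsub>D\<^esub> (c (x', y') \<otimes>\<^bsub>D\<^esub> ?i z'))
        \<bullet>\<^bsub>D\<^esub> ((ext \<Theta> \<otimes>\<^bsub>D\<^esub> ext \<Psi>) \<otimes>\<^bsub>D\<^esub> ext \<Phi>)"
      unfolding L2 using wf e by (simp add: defs)
    also have "\<dots> = (c (x', y' \<star>\<^bsub>bhcomp U\<^esub> z') \<bullet>\<^bsub>D\<^esub> (?i x' \<otimes>\<^bsub>D\<^esub> c (y', z')) \<bullet>\<^bsub>D\<^esub> ?a')
        \<bullet>\<^bsub>D\<^esub> ((ext \<Theta> \<otimes>\<^bsub>D\<^esub> ext \<Psi>) \<otimes>\<^bsub>D\<^esub> ext \<Phi>)"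
      \<comment> \<open>Only boundary facts are used for rewriting, so the bracket keeps the shape
        of the associativity axiom instead of being reassociated.\<close>
      using a[of x' y' z'] wf e by (simp only: defs src.fwf_boundary)
    also have "\<dots> = c (x', y' \<star>\<^bsub>bhcomp U\<^esub> z') \<bullet>\<^bsub>D\<^esub> (?i x' \<otimes>\<^bsub>D\<^esub> c (y', z'))
        \<bullet>\<^bsub>D\<^esub> (?a' \<bullet>\<^bsub>D\<^esub> ((ext \<Theta> \<otimes>\<^bsub>D\<^esub> ext \<Psi>) \<otimes>\<^bsub>D\<^esub> ext \<Phi>))"
      using wf e by (simp add: defs)
    also have "\<dots> = c (x', y' \<star>\<^bsub>bhcomp U\<^esub> z')
        \<bullet>\<^bsub>D\<^esub> ((?i x' \<otimes>\<^bsub>D\<^esub> c (y', z')) \<bullet>\<^bsub>D\<^esub> (ext \<Theta> \<otimes>\<^bsub>D\<^esub> (ext \<Psi> \<otimes>\<^bsub>D\<^esub> ext \<Phi>))) \<bullet>\<^bsub>D\<^esub> ?b'"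
      unfolding N using wf e by (simp add: defs)
    also have "\<dots> = (c (x', y' \<star>\<^bsub>bhcomp U\<^esub> z') \<bullet>\<^bsub>D\<^esub> (ext \<Theta> \<otimes>\<^bsub>D\<^esub> ext (HComp \<Psi> \<Phi>)))
        \<bullet>\<^bsub>D\<^esub> (?i x \<otimes>\<^bsub>D\<^esub> c (y, z)) \<bullet>\<^bsub>D\<^esub> ?b'"
      unfolding R2 using wf wf2 e by (simp add: defs)
    also have "\<dots> = ext ?R \<bullet>\<^bsub>D\<^esub> (c (x, y \<star>\<^bsub>bhcomp U\<^esub> z) \<bullet>\<^bsub>D\<^esub> (?i x \<otimes>\<^bsub>D\<^esub> c (y, z)) \<bullet>\<^bsub>D\<^esub> ?b')"
      unfolding R1[symmetric] using wf wf3 e by (simp add: defs)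
    also have "\<dots> = ext ?R \<bullet>\<^bsub>D\<^esub> (?b \<bullet>\<^bsub>D\<^esub> ?e)"
      using a[of x y z] wf e by (simp only: defs src.fwf_boundary)
    also have "\<dots> = ext (VComp ?R (Cell (bassoc U x y z))) \<bullet>\<^bsub>D\<^esub> ?e"
      using wf wf3 e by (simp add: defs)
    finally show "ext (VComp (Cell (bassoc U (fbot B \<Theta>) (fbot B \<Psi>) (fbot B \<Phi>))) ?L) \<bullet>\<^bsub>D\<^esub> ?e
        = ext (VComp ?R (Cell (bassoc U (ftop B \<Theta>) (ftop B \<Psi>) (ftop B \<Phi>)))) \<bullet>\<^bsub>D\<^esub> ?e"
      by (simp only: defs)
  qed (use wf wf3 e in \<open>simp_all add: defs\<close>)
qed

lemma ext_feq:
  assumes "feq B \<Phi> \<Psi>" shows "ext \<Phi> = ext \<Psi>"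
  using assms
proof induction
  case (feq_HComp \<Psi> \<Psi>' \<Phi> \<Phi>')
  then show ?case
    \<comment> \<open>The comparison squares in \<open>ext\<close> depend on tops and bottoms, which
      equivalent expressions share.\<close>
    using src.feq_boundary[OF feq_HComp(1)] src.feq_boundary[OF feq_HComp(2)] by simp
next
  case (feq_exchange \<Psi>\<^sub>2 \<Psi>\<^sub>1 \<Phi>\<^sub>2 \<Phi>\<^sub>1)
  then show ?case by (rule ext_exchange)
next
  case (feq_cell_hcomp \<psi> \<phi>)
  then show ?case by (rule ext_cell_hcomp)
next
  case (feq_lunit \<Phi>)
  then show ?case by (rule ext_lunit)
next
  case (feq_runit \<Phi>)
  then show ?case by (rule ext_runit)
next
  case (feq_assoc \<Theta> \<Psi> \<Phi>)
  then show ?case by (rule ext_assoc)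
next
  case (feq_vassoc \<Theta> \<Psi> \<Phi>)
  then show ?case by (simp add: tgt.L.src.cmp_assoc)
next
  case (feq_hid_vcomp f h)
  then show ?case by (simp add: tgt.L.src.cmp_assoc)
qed simp_all

end

section \<open>Uniqueness: double functors on the free double category agree if they agree on
  generators\<close>

lemma (in decorated) generator_simps:
  assumes "double_functor (Q B) D F"
  defines "K \<equiv> comp_dpsf B (Hstar D) (Hstar_map (Q B) F) (jincl B)"
  shows "a \<in> cells0 (und B) \<Longrightarrow> FO (deco_part K) a = FO (D_vert F) a"
    and "f \<in> Mor (deco B) \<Longrightarrow> FM (deco_part K) f = FM (D_vert F) f"
    and "\<alpha> \<in> Ob (cells (und B)) \<Longrightarrow> FO (P_cells (psf_part K)) \<alpha> = FO (D_hsq F) \<alpha>"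
    and "\<phi> \<in> Mor (cells (und B)) \<Longrightarrow>
      FM (P_cells (psf_part K)) \<phi> = FM (D_hsq F) (fclass B (Cell \<phi>))"
    and "\<lbrakk>\<beta> \<in> Ob (cells (und B)); \<alpha> \<in> Ob (cells (und B)); bsrc (und B) \<beta> = btgt (und B) \<alpha>\<rbrakk>
      \<Longrightarrow> Pcmp (psf_part K) (\<beta>, \<alpha>) = Dcmp F (\<beta>, \<alpha>)"
    and "a \<in> cells0 (und B) \<Longrightarrow> Punit (psf_part K) a = Dunit F a"
proof -
  interpret F: double_functor "Q B" D F by fact
  note [simp del] = Q_simps(3)
  show "a \<in> cells0 (und B) \<Longrightarrow> FO (deco_part K) a = FO (D_vert F) a"
    "f \<in> Mor (deco B) \<Longrightarrow> FM (deco_part K) f = FM (D_vert F) f"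
    "\<alpha> \<in> Ob (cells (und B)) \<Longrightarrow> FO (P_cells (psf_part K)) \<alpha> = FO (D_hsq F) \<alpha>"
    "\<phi> \<in> Mor (cells (und B)) \<Longrightarrow> FM (P_cells (psf_part K)) \<phi> = FM (D_hsq F) (fclass B (Cell \<phi>))"
    by (simp_all add: K_def comp_dpsf_def comp_psf_def comp_ftr_def compose_eq jincl_def id_ftr_def
      Hstar_map_def globular_fclass)
  have m: "fclass B (Cell (Idn (cells (und B)) \<alpha>)) \<in> globular (Q B)" if "\<alpha> \<in> Ob (cells (und B))" for \<alpha>
    using that by (intro globular_fclass) simp
  \<comment> \<open>The comparisons of j are identities, so their images are identities and
    disappear from the composite; this leaves the comparison squares of \<open>F\<close>.\<close>
  have i: "FM (D_hsq F) (fclass B (Cell (Idn (cells (und B)) \<alpha>))) = Idn (hsq D) (FO (D_hsq F) \<alpha>)"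
    if "\<alpha> \<in> Ob (cells (und B))" for \<alpha>
    using F.H.fun_idn[of \<alpha>] that by simp
  show "\<lbrakk>\<beta> \<in> Ob (cells (und B)); \<alpha> \<in> Ob (cells (und B)); bsrc (und B) \<beta> = btgt (und B) \<alpha>\<rbrakk>
      \<Longrightarrow> Pcmp (psf_part K) (\<beta>, \<alpha>) = Dcmp F (\<beta>, \<alpha>)"
    "a \<in> cells0 (und B) \<Longrightarrow> Punit (psf_part K) a = Dunit F a"
    using F.Dcmp_simps[of \<beta> \<alpha>] F.Dunit_simps[of a]
    by (simp_all add: K_def comp_dpsf_def comp_psf_def comp_ftr_def compose_eq jincl_def id_ftr_def
      Hstar_map_def m i)
qed

text \<open>Stated pointwise, not through restriction along j, because
  \<open>canonical_projection\<close> is also characterised pointwise.\<close>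

lemma (in decorated) double_functor_eq_on_generators:
  assumes F: "double_functor (Q B) D F" and F': "double_functor (Q B) D F'"
    and v: "\<And>a. a \<in> cells0 (und B) \<Longrightarrow> FO (D_vert F) a = FO (D_vert F') a"
    and vm: "\<And>f. f \<in> Mor (deco B) \<Longrightarrow> FM (D_vert F) f = FM (D_vert F') f"
    and o: "\<And>\<alpha>. \<alpha> \<in> Ob (cells (und B)) \<Longrightarrow> FO (D_hsq F) \<alpha> = FO (D_hsq F') \<alpha>"
    and cell: "\<And>\<phi>. \<phi> \<in> Mor (cells (und B))
      \<Longrightarrow> FM (D_hsq F) (fclass B (Cell \<phi>)) = FM (D_hsq F') (fclass B (Cell \<phi>))"
    and c: "\<And>\<beta> \<alpha>. \<lbrakk>\<beta> \<in> Ob (cells (und B)); \<alpha> \<in> Ob (cells (und B)); bsrc (und B) \<beta> = btgt (und B) \<alpha>\<rbrakk>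
      \<Longrightarrow> Dcmp F (\<beta>, \<alpha>) = Dcmp F' (\<beta>, \<alpha>)"
    and u: "\<And>a. a \<in> cells0 (und B) \<Longrightarrow> Dunit F a = Dunit F' a"
  shows "F = F'"
proof -
  interpret F: double_functor "Q B" D F by fact
  interpret F': double_functor "Q B" D F' by fact
  have cls: "FM (D_hsq F) (fclass B \<Phi>) = FM (D_hsq F') (fclass B \<Phi>)" if "fwf B \<Phi>" for \<Phi>
    using that
  proof (induction \<Phi>)
    case (Cell \<phi>)
    then show ?case
      by (simp add: cell)
  next
    case (HId f)
    \<comment> \<open>Naturality rewrites both sides to a square built only from the unit comparison
      and the vertical functor, on which the two double functors agree.\<close>
    have "FM (D_hsq F) (fclass B (HId f)) \<bullet>\<^bsub>D\<^esub> Dunit F (Dom (deco B) f)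
        = FM (D_hsq F') (fclass B (HId f)) \<bullet>\<^bsub>D\<^esub> Dunit F (Dom (deco B) f)"
      using F.Dunit_natural[of f] F'.Dunit_natural[of f] HId by (simp add: u vm)
    from F.B.L.src.iso_epi[OF _ _ _ _ _ this] show ?case
      using HId o by simp
  next
    case (VComp \<Psi> \<Phi>)
    then show ?case
      using F.H.fun_cmp[of "fclass B \<Phi>" "fclass B \<Psi>"] F'.H.fun_cmp[of "fclass B \<Phi>" "fclass B \<Psi>"]
      by simp
  next
    case (HComp \<Psi> \<Phi>)
    let ?c = "Dcmp F (ftop B \<Psi>, ftop B \<Phi>)"
    note e = edge_ends[of \<Psi> \<Phi>]
    have "FM (D_hsq F) (fclass B (HComp \<Psi> \<Phi>)) \<bullet>\<^bsub>D\<^esub> ?c = FM (D_hsq F') (fclass B (HComp \<Psi> \<Phi>)) \<bullet>\<^bsub>D\<^esub> ?c"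
      using F.Dcmp_natural[of "fclass B \<Psi>" "fclass B \<Phi>"] F'.Dcmp_natural[of "fclass B \<Psi>" "fclass B \<Phi>"]
        HComp e by (simp add: c)
    from F.B.L.src.iso_epi[OF _ _ _ _ _ this] show ?case
      using HComp o e by simp
  qed
  have "D_vert F = D_vert F'"
    using F.D_vert_functor F'.D_vert_functor v vm
    by (intro ftr.equality extensionalityI[of _ "Ob (deco B)"] extensionalityI[of _ "Mor (deco B)"])
      (simp_all add: ext_functor_def)
  moreover have "D_hsq F = D_hsq F'"
    using F.D_hsq_functor F'.D_hsq_functor o cls
    by (intro ftr.equality extensionalityI[of _ "Ob (hsq (Q B))"] extensionalityI[of _ "Mor (hsq (Q B))"])
      (auto simp: ext_functor_def)
  moreover have "Dcmp F = Dcmp F'"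
    using F.D_extensional F'.D_extensional c
    by (intro extensionalityI[of _ "Ob (dpairs (Q B))"]) auto
  moreover have "Dunit F = Dunit F'"
    using F.D_extensional F'.D_extensional u
    by (intro extensionalityI[of _ "cells0 (und B)"]) simp_all
  ultimately show ?thesis
    by (intro dftr.equality) simp_all
qed

theorem (in decorated) double_functor_eqI:
  assumes F: "double_functor (Q B) D F" and F': "double_functor (Q B) D F'"
    and eq: "comp_dpsf B (Hstar D) (Hstar_map (Q B) F) (jincl B)
      = comp_dpsf B (Hstar D) (Hstar_map (Q B) F') (jincl B)"
  shows "F = F'"
proof -
  show ?thesis
    using generator_simps[OF F] generator_simps[OF F', folded eq]
    by (intro double_functor_eq_on_generators[OF F F']) simp_all
qed

section \<open>Existence: the extension as a double functor\<close>

context free_extension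
begin

text \<open>The value at a class is read off its representative, a harmless choice by
  \<open>ext_feq\<close>. The comparison data are those of \<open>G\<close> unchanged, since
  \<open>Q B\<close> has the objects and 1-cells of \<open>B\<close>.\<close>

definition ext_dftr :: "('o, 'v, 'h, ('v, 'c) fexp set, 'p, 'w, 'k, 's) dftr" where
  "ext_dftr = \<lparr> D_vert = gv,
     D_hsq = \<lparr> FO = FO g, FM = (\<lambda>X\<in>Mor (hsq (Q B)). ext (frep X)) \<rparr>,
     Dcmp = c, Dunit = u \<rparr>"

lemma ext_dftr_fclass [simp]:
  assumes "fwf B \<Phi>" shows "FM (D_hsq ext_dftr) (fclass B \<Phi>) = ext \<Phi>"
  using assms ext_feq[OF src.feq_frep[OF assms]] by (simp add: ext_dftr_def)

lemma ext_dftr_simps [simp]: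
  "D_vert ext_dftr = gv" "FO (D_hsq ext_dftr) = FO g" "Dcmp ext_dftr = c" "Dunit ext_dftr = u"
  by (simp_all add: ext_dftr_def)

lemma ext_functor_ext: "ext_functor (hsq (Q B)) (hsq D) (D_hsq ext_dftr)"
proof -
  have "cat_functor (hsq (Q B)) (hsq D) (D_hsq ext_dftr)"
    by (unfold cat_functor_def) (auto simp: src.category_hsq_Q tgt.L.source_category)
  moreover have "FO g \<in> extensional (Ob (cells U))"
    using P.P_cells_functor by (simp add: ext_functor_def)
  ultimately show ?thesis
    by (simp add: ext_functor_def) (simp add: ext_dftr_def)
qed

lemma Ob_bpairs_Q: "Ob (dpairs (Q B)) = Ob (bpairs U)"
  by (auto simp: dpairs_def bpairs_def fibre_product_def bsrc_ftr_def btgt_ftr_def)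

text \<open>Naturality of the comparisons (cases 13 and 18) is \<open>ext_HComp_c\<close> and
  \<open>ext_HId_u\<close>; the coherence axioms (19 to 21) only involve 2-cells of \<open>B\<close>
  and are those of the pseudofunctor.\<close>

theorem double_functor_ext: "double_functor (Q B) D ext_dftr"
proof -
  interpret Q: double_category "Q B" by (rule src.double_category_Q)
  have v: "ext_functor (deco B) (vert D) gv"
    using decorated_pseudofunctor by (simp add: decorated_pseudofunctor_def)
  show ?thesis
  proof (intro double_functor.intro, goal_cases)
    case (13 \<Psi> \<Phi>)
    then obtain \<Psi>' \<Phi>' where
      *: "\<Psi> = fclass B \<Psi>'" "\<Phi> = fclass B \<Phi>'" "fwf B \<Psi>'" "fwf B \<Phi>'" "frgt B \<Phi>' = flft B \<Psi>'"
      by auto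
    show ?case
      using * src.edge_ends[OF *(3-5)] ext_HComp_c[of \<Psi>' \<Phi>'] by (simp del: ext.simps)
  next
    case (18 f)
    then show ?case
      using ext_HId_u[of f] by (simp del: ext.simps)
  next
    case (19 \<gamma> \<beta> \<alpha>)
    then show ?case
      using P.P_assoc[of \<gamma> \<beta> \<alpha>] by simp
  next
    case (20 \<alpha>)
    then show ?case
      using P.P_lunit[of \<alpha>] by simp
  next
    case (21 \<alpha>)
    then show ?case
      using P.P_runit[of \<alpha>] by simp
  next
    case 22
    then show ?case
      using P.P_extensional by (simp add: Ob_bpairs_Q)
  next
    case 23
    then show ?case
      using P.P_extensional by simp
  qed (use v src.double_category_Q tgt.double_category_axioms ext_functor_ext in
      \<open>auto simp del: ext.simps\<close>)
qed

theorem ext_dftr_jincl: "comp_dpsf B (Hstar D) (Hstar_map (Q B) ext_dftr) (jincl B) = G"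
proof -
  let ?K = "comp_dpsf B (Hstar D) (Hstar_map (Q B) ext_dftr) (jincl B)"
  note gen = src.generator_simps[OF double_functor_ext]
  have d: "deco_part ?K = gv"
    using decorated_pseudofunctor gen(1,2)
    by (intro ftr.equality extensionalityI[of _ "Ob (deco B)"] extensionalityI[of _ "Mor (deco B)"])
      (simp_all add: decorated_pseudofunctor_def ext_functor_def comp_dpsf_def comp_ftr_def)
  have p: "P_cells (psf_part ?K) = g"
    using P.P_cells_functor gen(3,4)
    by (intro ftr.equality extensionalityI[of _ "Ob (cells U)"] extensionalityI[of _ "Mor (cells U)"])
      (simp_all add: ext_functor_def comp_dpsf_def comp_psf_def comp_ftr_def)
  have "P_ob (psf_part ?K) = P_ob (psf_part G)"
    using P.P_extensional
    by (intro extensionalityI[of _ "cells0 U"])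
      (simp_all add: comp_dpsf_def comp_psf_def jincl_def Hstar_map_def compose_eq)
  moreover have "Pcmp (psf_part ?K) = c"
    using P.P_extensional gen(5)
    by (intro extensionalityI[of _ "Ob (bpairs U)"])
      (auto simp: comp_dpsf_def comp_psf_def)
  moreover have "Punit (psf_part ?K) = u"
    using P.P_extensional gen(6)
    by (intro extensionalityI[of _ "cells0 U"])
      (auto simp: comp_dpsf_def comp_psf_def)
  ultimately show ?thesis
    using d p by (intro dpsf.equality psf.equality) simp_all
qed

end

text \<open>j is thus a universal arrow from \<open>B\<close> to \<open>Hstar\<close>; with the
  target \<open>Q B'\<close> this also shows that the description defining \<open>Q_map\<close> has
  exactly one solution.\<close>

theorem universal_property:
  assumes "decorated_bicategory B" "double_category D" "decorated_pseudofunctor B (Hstar D) G"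
  shows "\<exists>!F. double_functor (Q B) D F \<and>
    comp_dpsf B (Hstar D) (Hstar_map (Q B) F) (jincl B) = G"
proof -
  interpret decorated B by unfold_locales fact
  interpret D: double_category D by fact
  interpret free_extension B D G by unfold_locales fact
  show ?thesis
    using double_functor_ext ext_dftr_jincl double_functor_eqI by blast
qed

section \<open>Composition of decorated pseudofunctors\<close>

context pseudofunctor
begin

sublocale A: bicategory B by (rule source_bicategory)
sublocale A': bicategory B' by (rule target_bicategory)
sublocale F: cat_functor "cells B" "cells B'" "P_cells P"
  using P_cells_functor by (simp add: ext_functor_def)

lemma pseudofunctor_simps [simp]:
  "a \<in> cells0 B \<Longrightarrow> P_ob P a \<in> cells0 B'"
  "\<alpha> \<in> Ob (cells B) \<Longrightarrow> bsrc B' (FO (P_cells P) \<alpha>) = P_ob P (bsrc B \<alpha>)"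
  "\<alpha> \<in> Ob (cells B) \<Longrightarrow> btgt B' (FO (P_cells P) \<alpha>) = P_ob P (btgt B \<alpha>)"
  by (simp_all add: P_ob_cell P_src P_tgt)

lemma Pcmp_simps [simp]:
  assumes "\<beta> \<in> Ob (cells B)" "\<alpha> \<in> Ob (cells B)" "bsrc B \<beta> = btgt B \<alpha>"
  shows "is_iso (cells B') (Pcmp P (\<beta>, \<alpha>))"
    and "Pcmp P (\<beta>, \<alpha>) \<in> Mor (cells B')"
    and "Dom (cells B') (Pcmp P (\<beta>, \<alpha>)) = FO (P_cells P) \<beta> \<star>\<^bsub>bhcomp B'\<^esub> FO (P_cells P) \<alpha>"
    and "Cod (cells B') (Pcmp P (\<beta>, \<alpha>)) = FO (P_cells P) (\<beta> \<star>\<^bsub>bhcomp B\<^esub> \<alpha>)"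
  using assms Pcmp_iso[of \<beta> \<alpha>] Pcmp_dom[of \<beta> \<alpha>] Pcmp_cod[of \<beta> \<alpha>] by simp_all

lemma Punit_simps [simp]:
  assumes "a \<in> cells0 B"
  shows "is_iso (cells B') (Punit P a)"
    and "Punit P a \<in> Mor (cells B')"
    and "Dom (cells B') (Punit P a) = bunit B' (P_ob P a)"
    and "Cod (cells B') (Punit P a) = FO (P_cells P) (bunit B a)"
  using assms Punit_iso[of a] Punit_dom[of a] Punit_cod[of a] by simp_all

end

text \<open>Only the comparison cells need an argument: functoriality of \<open>G3\<close>
  distributes over a vertical composite, which is then reassociated.\<close>

lemma comp_dpsf_assoc:
  assumes "decorated_pseudofunctor B B1 G1" "decorated_pseudofunctor B1 B2 G2"
    "decorated_pseudofunctor B2 B3 G3"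
  shows "comp_dpsf B B3 G3 (comp_dpsf B B2 G2 G1) = comp_dpsf B B3 (comp_dpsf B1 B3 G3 G2) G1"
proof -
  interpret P1: pseudofunctor "und B" "und B1" "psf_part G1"
    using assms by (simp add: decorated_pseudofunctor_def)
  interpret P2: pseudofunctor "und B1" "und B2" "psf_part G2"
    using assms by (simp add: decorated_pseudofunctor_def)
  interpret P3: pseudofunctor "und B2" "und B3" "psf_part G3"
    using assms by (simp add: decorated_pseudofunctor_def)
  interpret V1: cat_functor "deco B" "deco B1" "deco_part G1"
    using assms by (simp add: decorated_pseudofunctor_def ext_functor_def)
  show ?thesis
    by (auto simp: comp_dpsf_def comp_psf_def comp_ftr_def compose_def restrict_def fun_eq_iff
      P3.A'.S.src.cmp_assoc)
qed

lemma comp_dpsf_id_left: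
  assumes "decorated_pseudofunctor B B' G"
  shows "comp_dpsf B B' (id_dpsf B') G = G"
proof -
  interpret P: pseudofunctor "und B" "und B'" "psf_part G"
    using assms by (simp add: decorated_pseudofunctor_def)
  interpret V: cat_functor "deco B" "deco B'" "deco_part G"
    using assms by (simp add: decorated_pseudofunctor_def ext_functor_def)
  have "ext_functor (deco B) (deco B') (deco_part G)"
    using assms by (simp add: decorated_pseudofunctor_def)
  then show ?thesis
    using P.P_extensional P.P_cells_functor
    by (intro dpsf.equality psf.equality ftr.equality)
      (auto simp: comp_dpsf_def comp_psf_def comp_ftr_def id_dpsf_def id_psf_def id_ftr_def
        compose_def restrict_def fun_eq_iff ext_functor_def extensional_def)
qed

lemma comp_dpsf_id_right:
  assumes "decorated_pseudofunctor B B' G"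
  shows "comp_dpsf B B' G (id_dpsf B) = G"
proof -
  interpret P: pseudofunctor "und B" "und B'" "psf_part G"
    using assms by (simp add: decorated_pseudofunctor_def)
  have "ext_functor (deco B) (deco B') (deco_part G)"
    using assms by (simp add: decorated_pseudofunctor_def)
  then show ?thesis
    using P.P_extensional P.P_cells_functor
    by (intro dpsf.equality psf.equality ftr.equality)
      (auto simp: comp_dpsf_def comp_psf_def comp_ftr_def id_dpsf_def id_psf_def id_ftr_def
        compose_def restrict_def fun_eq_iff ext_functor_def extensional_def)
qed

lemma (in decorated) decorated_pseudofunctor_jincl:
  "decorated_pseudofunctor B (Hstar (Q B)) (jincl B)"
proof -
  interpret Q: double_category "Q B" by (rule double_category_Q)
  have "pseudofunctor (und B) (horizontal_bicategory (Q B)) (psf_part (jincl B))"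
  proof (intro pseudofunctor.intro, goal_cases)
    case 4
    show ?case
      by (auto simp: ext_functor_def jincl_def cat_functor_def Q.category_horizontal
          U.S.source_category globular_fclass)
  qed (simp_all add: jincl_def Q.bicategory_horizontal U.bicategory_axioms Q.is_iso_horizontal
      is_iso_fclass globular_fclass del: Q_simps(3))
  then show ?thesis
    using Q.decorated_bicategory_Hstar
    by (simp add: decorated_pseudofunctor_def decorated jincl_def ext_functor_id V.category_axioms)
      (simp add: id_ftr_def)
qed

text \<open>Since j is strict, the comparison cells of the composite are just the classes of those
  of \<open>G\<close>, and each axiom is the class of the corresponding axiom for
  \<open>G\<close>.\<close>

lemma decorated_pseudofunctor_jincl_comp:
  assumes "decorated_pseudofunctor B B' G"
  shows "decorated_pseudofunctor B (Hstar (Q B')) (comp_dpsf B (Hstar (Q B')) (jincl B') G)"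
proof -
  have B: "decorated_bicategory B" "decorated_bicategory B'"
    using assms by (simp_all add: decorated_pseudofunctor_def)
  interpret decorated B by unfold_locales fact
  interpret B': decorated B' by unfold_locales fact
  interpret P: pseudofunctor "und B" "und B'" "psf_part G"
    using assms by (simp add: decorated_pseudofunctor_def)
  interpret j: pseudofunctor "und B'" "horizontal_bicategory (Q B')" "psf_part (jincl B')"
    using B'.decorated_pseudofunctor_jincl by (simp add: decorated_pseudofunctor_def)
  interpret Q: double_category "Q B'" by (rule B'.double_category_Q)
  let ?K = "comp_dpsf B (Hstar (Q B')) (jincl B') G"
  have cells: "P_cells (psf_part ?K)
      = comp_ftr (cells (und B)) (P_cells (psf_part (jincl B'))) (P_cells (psf_part G))"
    by (simp add: comp_dpsf_def comp_psf_def)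
  have [simp]: "P_ob (psf_part ?K) a = P_ob (psf_part G) a"
    "Punit (psf_part ?K) a = fclass B' (Cell (Punit (psf_part G) a))" if "a \<in> cells0 (und B)" for a
    using that by (simp_all add: comp_dpsf_def comp_psf_def jincl_def compose_eq del: B'.Q_simps(3))
  have [simp]: "Pcmp (psf_part ?K) (\<beta>, \<alpha>) = fclass B' (Cell (Pcmp (psf_part G) (\<beta>, \<alpha>)))"
    if "\<beta> \<in> Ob (cells (und B))" "\<alpha> \<in> Ob (cells (und B))" "bsrc (und B) \<beta> = btgt (und B) \<alpha>" for \<beta> \<alpha>
    using that by (simp add: comp_dpsf_def comp_psf_def jincl_def del: B'.Q_simps(3))
  have [simp]: "FO (P_cells (psf_part ?K)) \<alpha> = FO (P_cells (psf_part G)) \<alpha>"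
    if "\<alpha> \<in> Ob (cells (und B))" for \<alpha>
    using that by (simp add: comp_dpsf_def comp_psf_def comp_ftr_def jincl_def compose_eq)
  have [simp]: "FM (P_cells (psf_part ?K)) \<phi> = fclass B' (Cell (FM (P_cells (psf_part G)) \<phi>))"
    if "\<phi> \<in> Mor (cells (und B))" for \<phi>
    using that by (simp add: comp_dpsf_def comp_psf_def comp_ftr_def jincl_def compose_eq)
  have ext: "P_ob (psf_part ?K) \<in> extensional (cells0 (und B))"
    "Pcmp (psf_part ?K) \<in> extensional (Ob (bpairs (und B)))"
    "Punit (psf_part ?K) \<in> extensional (cells0 (und B))"
    by (simp_all add: comp_dpsf_def comp_psf_def)
  have "pseudofunctor (und B) (horizontal_bicategory (Q B')) (psf_part ?K)"
  proof (intro pseudofunctor.intro, goal_cases)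
    case 4
    show ?case
      unfolding cells by (rule ext_functor_comp[OF P.P_cells_functor j.P_cells_functor])
  next
    case (10 \<psi> \<phi>)
    then show ?case
      using P.Pcmp_natural[of \<psi> \<phi>] by (simp del: B'.Q_simps(3))
  next
    case (14 \<gamma> \<beta> \<alpha>)
    then show ?case
      using P.P_assoc[of \<gamma> \<beta> \<alpha>] by (simp del: B'.Q_simps(3))
  next
    case (15 \<alpha>)
    then show ?case
      using P.P_lunit[of \<alpha>] by (simp del: B'.Q_simps(3))
  next
    case (16 \<alpha>)
    then show ?case
      using P.P_runit[of \<alpha>] by (simp del: B'.Q_simps(3))
  qed (simp_all add: Q.bicategory_horizontal U.bicategory_axioms Q.is_iso_horizontal
      B'.is_iso_fclass B'.globular_fclass ext del: B'.Q_simps(3))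
  moreover have "ext_functor (deco B) (deco B') (deco_part ?K)"
  proof -
    have "ext_functor (deco B) (deco B') (deco_part G)"
      using assms by (simp add: decorated_pseudofunctor_def)
    from ext_functor_comp[OF this ext_functor_id[OF B'.V.category_axioms]] show ?thesis
      by (simp add: comp_dpsf_def jincl_def)
  qed
  moreover have "FO (deco_part ?K) a = P_ob (psf_part ?K) a" if "a \<in> cells0 (und B)" for a
    using that assms
    by (simp add: comp_dpsf_def comp_ftr_def jincl_def id_ftr_def compose_eq
        decorated_pseudofunctor_def comp_psf_def)
  ultimately show ?thesis
    using B Q.decorated_bicategory_Hstar by (simp add: decorated_pseudofunctor_def)
qed

section \<open>The adjunction\<close>

context
  fixes B :: "('o, 'v, 'h, 'c) dbicat" and B' :: "('p, 'w, 'k, 'd) dbicat"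
    and G :: "('o, 'v, 'h, 'c, 'p, 'w, 'k, 'd) dpsf"
  assumes G: "decorated_pseudofunctor B B' G"
begin

lemma Q_map_props:
  shows double_functor_Q_map: "double_functor (Q B) (Q B') (Q_map B B' G)"
    and jincl_natural: "comp_dpsf B (Hstar (Q B')) (Hstar_map (Q B) (Q_map B B' G)) (jincl B)
      = comp_dpsf B (Hstar (Q B')) (jincl B') G"
proof -
  have B: "decorated_bicategory B" and B': "decorated_bicategory B'"
    using G by (simp_all add: decorated_pseudofunctor_def)
  have "double_category (Q B')"
    using B' by (intro decorated.double_category_Q decorated.intro)
  from theI'[OF universal_property[OF B this decorated_pseudofunctor_jincl_comp[OF G]]]
  show "double_functor (Q B) (Q B') (Q_map B B' G)"
    "comp_dpsf B (Hstar (Q B')) (Hstar_map (Q B) (Q_map B B' G)) (jincl B)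
      = comp_dpsf B (Hstar (Q B')) (jincl B') G"
    unfolding Q_map_def by simp_all
qed

end

text \<open>The way functoriality of \<open>Q\<close> is proved: a candidate is recognised as the
  free double functor by its restriction along j.\<close>

lemma Q_map_eqI:
  assumes "decorated_bicategory B" "double_functor (Q B) (Q B') F"
    "comp_dpsf B (Hstar (Q B')) (Hstar_map (Q B) F) (jincl B)
      = comp_dpsf B (Hstar (Q B')) (jincl B') G"
  shows "Q_map B B' G = F"
  unfolding Q_map_def
proof (rule the_equality)
  fix F'
  assume "double_functor (Q B) (Q B') F' \<and>
    comp_dpsf B (Hstar (Q B')) (Hstar_map (Q B) F') (jincl B)
      = comp_dpsf B (Hstar (Q B')) (jincl B') G"
  then show "F' = F"
    using assms
    by (intro decorated.double_functor_eqI[OF decorated.intro[OF assms(1)], where D = "Q B'"]) simp_all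
qed (use assms in simp)

lemma Q_map_id:
  assumes "decorated_bicategory B"
  shows "Q_map B B (id_dpsf B) = id_dftr (Q B)"
proof (rule Q_map_eqI)
  interpret decorated B by unfold_locales fact
  show "double_functor (Q B) (Q B) (id_dftr (Q B))"
    by (rule double_functor_id[OF double_category_Q])
  show "comp_dpsf B (Hstar (Q B)) (Hstar_map (Q B) (id_dftr (Q B))) (jincl B)
      = comp_dpsf B (Hstar (Q B)) (jincl B) (id_dpsf B)"
    by (simp only: Hstar_map_id[OF double_category_Q]
        comp_dpsf_id_left[OF decorated_pseudofunctor_jincl]
        comp_dpsf_id_right[OF decorated_pseudofunctor_jincl])
qed (fact assms)

lemma Hstar_map_comp_jincl:
  assumes "decorated_bicategory B" "double_functor (Q B) D F" "double_functor D D' F'"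
  shows "comp_dpsf B (Hstar D') (Hstar_map (Q B) (comp_dftr (Q B) D' F' F)) (jincl B)
    = comp_dpsf B (Hstar D') (Hstar_map D F')
        (comp_dpsf B (Hstar D) (Hstar_map (Q B) F) (jincl B))"
  using comp_dpsf_assoc[OF decorated.decorated_pseudofunctor_jincl[OF decorated.intro[OF assms(1)]]
      double_functor.decorated_pseudofunctor_Hstar_map[OF assms(2)]
      double_functor.decorated_pseudofunctor_Hstar_map[OF assms(3)]]
  by (simp only: Hstar_map_comp[OF assms(2,3)])

text \<open>The naturality squares of j for \<open>G\<close> and for \<open>G'\<close> paste
  together to the one characterising the composite.\<close>

lemma Q_map_comp:
  assumes G: "decorated_pseudofunctor B B' G" and G': "decorated_pseudofunctor B' B'' G'"
  shows "Q_map B B'' (comp_dpsf B B'' G' G)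
    = comp_dftr (Q B) (Q B'') (Q_map B' B'' G') (Q_map B B' G)"
proof (rule Q_map_eqI)
  have B: "decorated_bicategory B" "decorated_bicategory B'" "decorated_bicategory B''"
    using G G' by (simp_all add: decorated_pseudofunctor_def)
  note F = double_functor_Q_map[OF G] and F' = double_functor_Q_map[OF G']
  note j = decorated.decorated_pseudofunctor_jincl[OF decorated.intro]
  show "decorated_bicategory B"
    by fact
  show "double_functor (Q B) (Q B'') (comp_dftr (Q B) (Q B'') (Q_map B' B'' G') (Q_map B B' G))"
    by (rule double_functor_comp[OF F F'])
  have "comp_dpsf B (Hstar (Q B''))
      (Hstar_map (Q B) (comp_dftr (Q B) (Q B'') (Q_map B' B'' G') (Q_map B B' G))) (jincl B)
    = comp_dpsf B (Hstar (Q B'')) (Hstar_map (Q B') (Q_map B' B'' G'))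
        (comp_dpsf B (Hstar (Q B')) (jincl B') G)"
    by (simp only: Hstar_map_comp_jincl[OF B(1) F F'] jincl_natural[OF G])
  also have "\<dots> = comp_dpsf B (Hstar (Q B'')) (comp_dpsf B' (Hstar (Q B'')) (jincl B'') G') G"
    by (simp only: comp_dpsf_assoc[OF G j[OF B(2)]
          double_functor.decorated_pseudofunctor_Hstar_map[OF F']] jincl_natural[OF G'])
  also have "\<dots> = comp_dpsf B (Hstar (Q B'')) (jincl B'') (comp_dpsf B B'' G' G)"
    by (rule comp_dpsf_assoc[OF G G' j[OF B(3)], symmetric])
  finally show "comp_dpsf B (Hstar (Q B''))
      (Hstar_map (Q B) (comp_dftr (Q B) (Q B'') (Q_map B' B'' G') (Q_map B B' G))) (jincl B)
    = comp_dpsf B (Hstar (Q B'')) (jincl B'') (comp_dpsf B B'' G' G)" .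
qed

section \<open>The counit and the triangle identities\<close>

lemma canonical_projection_props:
  assumes C: "double_category C"
  shows double_functor_projection: "double_functor (Q (Hstar C)) C (canonical_projection C)"
    and projection_jincl: "comp_dpsf (Hstar C) (Hstar C)
      (Hstar_map (Q (Hstar C)) (canonical_projection C)) (jincl (Hstar C)) = id_dpsf (Hstar C)"
proof -
  interpret C: double_category C by fact
  interpret decorated "Hstar C"
    by unfold_locales (rule C.decorated_bicategory_Hstar)
  have "decorated_pseudofunctor (Hstar C) (Hstar C) (id_dpsf (Hstar C))"
    using double_functor.decorated_pseudofunctor_Hstar_map[OF double_functor_id[OF C]]
    by (simp add: Hstar_map_id[OF C])
  from universal_property[OF decorated C this]
  obtain F where F: "double_functor (Q (Hstar C)) C F"
    and Fj: "comp_dpsf (Hstar C) (Hstar C) (Hstar_map (Q (Hstar C)) F) (jincl (Hstar C))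
      = id_dpsf (Hstar C)"
    by blast
  note gen = generator_simps[OF F, unfolded Fj]
  \<comment> \<open>Reading off the identity of \<open>Hstar C\<close> on generators shows that the
    extension \<open>F\<close> fixes all of \<open>Hstar C\<close> and is strict.\<close>
  have F_id: "a \<in> Ob (vert C) \<Longrightarrow> FO (D_vert F) a = a"
    "f \<in> Mor (vert C) \<Longrightarrow> FM (D_vert F) f = f"
    "\<alpha> \<in> Ob (hsq C) \<Longrightarrow> FO (D_hsq F) \<alpha> = \<alpha>"
    "\<phi> \<in> globular C \<Longrightarrow> FM (D_hsq F) (fclass (Hstar C) (Cell \<phi>)) = \<phi>"
    "\<lbrakk>\<beta> \<in> Ob (hsq C); \<alpha> \<in> Ob (hsq C); FO (lft C) \<beta> = FO (rgt C) \<alpha>\<rbrakk>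
      \<Longrightarrow> Dcmp F (\<beta>, \<alpha>) = Idn (hsq C) (\<beta> \<odot>\<^bsub>C\<^esub> \<alpha>)"
    "a \<in> Ob (vert C) \<Longrightarrow> Dunit F a = Idn (hsq C) (FO (hid C) a)" for a f \<alpha> \<beta> \<phi>
    using gen(1)[of a] gen(2)[of f] gen(3)[of \<alpha>] gen(4)[of \<phi>] gen(5)[of \<beta> \<alpha>] gen(6)[of a]
    by (simp_all add: id_dpsf_def id_psf_def id_ftr_def)
  have "canonical_projection C = F"
    unfolding canonical_projection_def
  proof (rule the_equality, goal_cases)
    case 1
    show ?case
      using F by (auto simp: strict_double_functor_def F_id dpairs_def[of "Q _"])
  next
    case (2 F')
    then have F': "double_functor (Q (Hstar C)) C F'"
      by (simp add: strict_double_functor_def)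
    \<comment> \<open>For a competing \<open>F'\<close> strictness determines the comparison
      squares, so together with its values on \<open>Hstar C\<close> all generator data agree with
      those of \<open>F\<close>.\<close>
    have "Dcmp F' (\<beta>, \<alpha>) = Idn (hsq C) (FO (D_hsq F') \<beta> \<odot>\<^bsub>C\<^esub> FO (D_hsq F') \<alpha>)"
      if "\<beta> \<in> Ob (hsq C)" "\<alpha> \<in> Ob (hsq C)" "FO (lft C) \<beta> = FO (rgt C) \<alpha>" for \<beta> \<alpha>
    proof -
      have "(\<beta>, \<alpha>) \<in> Ob (dpairs (Q (Hstar C)))"
        using that by (simp add: dpairs_def)
      then show ?thesis
        using 2 by (auto simp: strict_double_functor_def)
    qed
    then show ?case
      using 2
      by (intro double_functor_eq_on_generators[OF F' F]) (simp_all add: F_id strict_double_functor_def)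
  qed
  then show "double_functor (Q (Hstar C)) C (canonical_projection C)"
    "comp_dpsf (Hstar C) (Hstar C) (Hstar_map (Q (Hstar C)) (canonical_projection C))
      (jincl (Hstar C)) = id_dpsf (Hstar C)"
    using F Fj by simp_all
qed

text \<open>Both composites restrict along j to \<open>Hstar_map C F\<close>: one by the triangle
  identity at \<open>C\<close>, the other by naturality of j and the triangle identity at
  \<open>C'\<close>.\<close>

lemma projection_natural:
  assumes F: "double_functor C C' F"
  shows "comp_dftr (Q (Hstar C)) C' F (canonical_projection C)
    = comp_dftr (Q (Hstar C)) C' (canonical_projection C')
        (Q_map (Hstar C) (Hstar C') (Hstar_map C F))"
proof -
  have C: "double_category C" "double_category C'"
    using F by (simp_all add: double_functor_def)
  note B = double_category.decorated_bicategory_Hstar[OF C(1)]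
    double_category.decorated_bicategory_Hstar[OF C(2)]
  note HF = double_functor.decorated_pseudofunctor_Hstar_map[OF F]
  note p = double_functor_projection[OF C(1)] and p' = double_functor_projection[OF C(2)]
  note QF = double_functor_Q_map[OF HF]
  show ?thesis
  proof (rule decorated.double_functor_eqI[OF decorated.intro[OF B(1)]])
    show "double_functor (Q (Hstar C)) C' (comp_dftr (Q (Hstar C)) C' F (canonical_projection C))"
      by (rule double_functor_comp[OF p F])
    show "double_functor (Q (Hstar C)) C' (comp_dftr (Q (Hstar C)) C' (canonical_projection C')
        (Q_map (Hstar C) (Hstar C') (Hstar_map C F)))"
      by (rule double_functor_comp[OF QF p'])
    have "comp_dpsf (Hstar C) (Hstar C') (Hstar_map (Q (Hstar C))
        (comp_dftr (Q (Hstar C)) C' F (canonical_projection C))) (jincl (Hstar C)) = Hstar_map C F"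
      by (simp only: Hstar_map_comp_jincl[OF B(1) p F] projection_jincl[OF C(1)]
          comp_dpsf_id_right[OF HF])
    also have "\<dots> = comp_dpsf (Hstar C) (Hstar C')
        (comp_dpsf (Hstar C') (Hstar C') (Hstar_map (Q (Hstar C')) (canonical_projection C'))
          (jincl (Hstar C'))) (Hstar_map C F)"
      by (simp only: projection_jincl[OF C(2)] comp_dpsf_id_left[OF HF])
    also have "\<dots> = comp_dpsf (Hstar C) (Hstar C') (Hstar_map (Q (Hstar C)) (comp_dftr (Q (Hstar C)) C'
        (canonical_projection C') (Q_map (Hstar C) (Hstar C') (Hstar_map C F)))) (jincl (Hstar C))"
      by (simp only: Hstar_map_comp_jincl[OF B(1) QF p'] jincl_natural[OF HF]
          comp_dpsf_assoc[OF HF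
            decorated.decorated_pseudofunctor_jincl[OF decorated.intro[OF B(2)]]
            double_functor.decorated_pseudofunctor_Hstar_map[OF p']])
    finally show "comp_dpsf (Hstar C) (Hstar C') (Hstar_map (Q (Hstar C))
        (comp_dftr (Q (Hstar C)) C' F (canonical_projection C))) (jincl (Hstar C))
      = comp_dpsf (Hstar C) (Hstar C') (Hstar_map (Q (Hstar C)) (comp_dftr (Q (Hstar C)) C'
          (canonical_projection C') (Q_map (Hstar C) (Hstar C') (Hstar_map C F)))) (jincl (Hstar C))" .
  qed
qed

text \<open>Naturality of j moves the inner inclusion outwards, where the other triangle identity,
  taken at \<open>Q B\<close>, cancels it against the projection; what remains is j, as for the
  identity double functor.\<close>

lemma projection_Q_map_jincl:
  assumes B: "decorated_bicategory B"
  shows "comp_dftr (Q B) (Q B) (canonical_projection (Q B)) (Q_map B (Hstar (Q B)) (jincl B))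
    = id_dftr (Q B)"
proof -
  interpret decorated B by unfold_locales fact
  note QB = double_category_Q and j = decorated_pseudofunctor_jincl
  note p = double_functor_projection[OF QB] and Qj = double_functor_Q_map[OF j]
  interpret HQ: decorated "Hstar (Q B)"
    by unfold_locales (rule double_category.decorated_bicategory_Hstar[OF QB])
  show ?thesis
  proof (rule double_functor_eqI)
    show "double_functor (Q B) (Q B)
        (comp_dftr (Q B) (Q B) (canonical_projection (Q B)) (Q_map B (Hstar (Q B)) (jincl B)))"
      by (rule double_functor_comp[OF Qj p])
    show "double_functor (Q B) (Q B) (id_dftr (Q B))"
      by (rule double_functor_id[OF QB])
    have "comp_dpsf B (Hstar (Q B)) (Hstar_map (Q B) (comp_dftr (Q B) (Q B)
        (canonical_projection (Q B)) (Q_map B (Hstar (Q B)) (jincl B)))) (jincl B)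
      = comp_dpsf B (Hstar (Q B)) (comp_dpsf (Hstar (Q B)) (Hstar (Q B))
          (Hstar_map (Q (Hstar (Q B))) (canonical_projection (Q B))) (jincl (Hstar (Q B)))) (jincl B)"
      by (simp only: Hstar_map_comp_jincl[OF B Qj p] jincl_natural[OF j]
          comp_dpsf_assoc[OF j HQ.decorated_pseudofunctor_jincl
            double_functor.decorated_pseudofunctor_Hstar_map[OF p]])
    then show "comp_dpsf B (Hstar (Q B)) (Hstar_map (Q B) (comp_dftr (Q B) (Q B)
        (canonical_projection (Q B)) (Q_map B (Hstar (Q B)) (jincl B)))) (jincl B)
      = comp_dpsf B (Hstar (Q B)) (Hstar_map (Q B) (id_dftr (Q B))) (jincl B)"
      by (simp only: projection_jincl[OF QB] Hstar_map_id[OF QB])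
  qed
qed

text \<open>The objects carry independent type parameters because no single type holds all decorated
  bicategories or double categories; already \<open>Q B\<close> has squares of a different type from
  the 2-cells of \<open>B\<close>.\<close>

theorem theorem5p2:
  fixes B :: "('o, 'v, 'h, 'c) dbicat"
    and B' :: "('o1, 'v1, 'h1, 'c1) dbicat"
    and B'' :: "('o2, 'v2, 'h2, 'c2) dbicat"
    and C :: "('p, 'w, 'k, 's) dbl"
    and C' :: "('p1, 'w1, 'k1, 's1) dbl"
    and C'' :: "('p2, 'w2, 'k2, 's2) dbl"
  assumes "decorated_bicategory B" "decorated_bicategory B'" "decorated_bicategory B''"
    and "globularly_generated_double_category C"
        "globularly_generated_double_category C'"
        "globularly_generated_double_category C''"
  shows
    \<comment> \<open>\<open>Q\<close> is a functor from decorated bicategories to globularly generated double categories\<close>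
    "globularly_generated_double_category (Q B) \<and>
     (\<forall>G. decorated_pseudofunctor B B' G \<longrightarrow> double_functor (Q B) (Q B') (Q_map B B' G)) \<and>
     Q_map B B (id_dpsf B) = id_dftr (Q B) \<and>
     (\<forall>G G'. decorated_pseudofunctor B B' G \<longrightarrow> decorated_pseudofunctor B' B'' G' \<longrightarrow>
        Q_map B B'' (comp_dpsf B B'' G' G)
          = comp_dftr (Q B) (Q B'') (Q_map B' B'' G') (Q_map B B' G)) \<and>
    \<comment> \<open>\<open>Hstar\<close> is a functor in the opposite direction\<close>
     decorated_bicategory (Hstar C) \<and>
     (\<forall>F. double_functor C C' F \<longrightarrow>
        decorated_pseudofunctor (Hstar C) (Hstar C') (Hstar_map C F)) \<and>
     Hstar_map C (id_dftr C) = id_dpsf (Hstar C) \<and>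
     (\<forall>F F'. double_functor C C' F \<longrightarrow> double_functor C' C'' F' \<longrightarrow>
        Hstar_map C (comp_dftr C C'' F' F)
          = comp_dpsf (Hstar C) (Hstar C'') (Hstar_map C' F') (Hstar_map C F)) \<and>
    \<comment> \<open>the unit \<open>j\<close> is a natural transformation from the identity to \<open>Hstar \<circ> Q\<close>\<close>
     decorated_pseudofunctor B (Hstar (Q B)) (jincl B) \<and>
     (\<forall>G. decorated_pseudofunctor B B' G \<longrightarrow>
        comp_dpsf B (Hstar (Q B')) (Hstar_map (Q B) (Q_map B B' G)) (jincl B)
          = comp_dpsf B (Hstar (Q B')) (jincl B') G) \<and>
    \<comment> \<open>the counit \<open>\<pi>\<close> is a natural transformation from \<open>Q \<circ> Hstar\<close> to the identity\<close>
     double_functor (Q (Hstar C)) C (canonical_projection C) \<and>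
     (\<forall>F. double_functor C C' F \<longrightarrow>
        comp_dftr (Q (Hstar C)) C' F (canonical_projection C)
          = comp_dftr (Q (Hstar C)) C' (canonical_projection C')
              (Q_map (Hstar C) (Hstar C') (Hstar_map C F))) \<and>
    \<comment> \<open>the triangle identities\<close>
     comp_dpsf (Hstar C) (Hstar C) (Hstar_map (Q (Hstar C)) (canonical_projection C))
         (jincl (Hstar C))
       = id_dpsf (Hstar C) \<and>
     comp_dftr (Q B) (Q B) (canonical_projection (Q B)) (Q_map B (Hstar (Q B)) (jincl B))
       = id_dftr (Q B)"
proof -
  note B = assms(1-3)
  have C: "double_category C" "double_category C'" "double_category C''"
    using assms(4-6) by (simp_all add: globularly_generated_double_category_def)
  note dec = decorated.intro[OF B(1)]
  show ?thesis
    using decorated.globularly_generated_Q[OF dec] double_functor_Q_map Q_map_id[OF B(1)]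
      Q_map_comp double_category.decorated_bicategory_Hstar[OF C(1)]
      double_functor.decorated_pseudofunctor_Hstar_map Hstar_map_id[OF C(1)] Hstar_map_comp
      decorated.decorated_pseudofunctor_jincl[OF dec] jincl_natural
      double_functor_projection[OF C(1)] projection_natural projection_jincl[OF C(1)]
      projection_Q_map_jincl[OF B(1)]
    by (intro conjI allI impI) assumption+
qed

end
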